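(* Let $k$ be a field of characteristic zero, $R$ a commutative $k$-algebra, $A=(A,m)$ a minimal flat $A(\infty)$ $R$-algebra, $\tilde A$ its deformation to the normal cone, and $n\ge1$. a) $A$ is $n$-formal if and only if the Kaledin class $K_{\tilde A/h^{n+1}}\in HH^2_{R[h]/h^n}(\tilde A/h^n)$ is zero. b) Assume that $m_{\tilde A/h^{n+1}}=m_2+m_{n+2}h^n$. Then $A$ is $n$-formal if and only if the class $[m_{n+2}]\in HH^2_R(A(2))$ is zero.
   Context: For a commutative unital ring $R$ write $\otimes=\otimes_R$. An $A(\infty)$ $R$-algebra (no unit is required) is a graded $R$-module $A=\bigoplus_{n\in\mathbb Z}A^n$ with a collection $m=(m_1,m_2,\dots)$ of $R$-linear maps $m_i:A^{\otimes i}\to A$ of degree $2-i$ such that for each $n\ge 1$ $$\sum(-1)^{r+st}m_u(1^{\otimes r}\otimes m_s\otimes 1^{\otimes t})=0,$$ the sum being over all $n=r+s+t$ ($s\ge1$, $r,t\ge 0$), $u=r+1+t$. It is minimal if $m_1=0$; a minimal $A$ is flat if each $A^i$ is a projective $R$-module. An $A(\infty)$ morphism $f:A\to B$ is a collection $f=(f_1,f_2,\dots)$ of $R$-linear maps $f_i:A^{\otimes i}\to B$ of degree $1-i$ with, for each $n\ge1$, $$\sum(-1)^{r+st}f_u(1^{\otimes r}\otimes m_s\otimes1^{\otimes t})=\sum(-1)^{s}m_r(f_{i_1}\otimes\cdots\otimes f_{i_r}),$$ where the first sum is over $n=r+s+t$, $u=r+1+t$, the second over $1\le r\le n$ and $n=i_1+\dots+i_r$,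 with sign exponent $s=(r-1)(i_1-1)+(r-2)(i_2-1)+\dots+(i_{r-1}-1)$ on the right. It is a quasi-isomorphism if $f_1$ is a quasi-isomorphism of complexes. $A(2)$ is the $A(\infty)$ algebra on $A$ with $m_2$ that of $A$ and all other operations zero; $A(2)[h]$ is its base change to $R[h]$. The deformation to the normal cone $\tilde A$ is the $A(\infty)$ $R[h]$-algebra $A[h]$ with operations $\tilde m_1=0$, $\tilde m_i=m_ih^{i-2}$ ($i\ge2$), extended $R[h]$-linearly. $A$ is $n$-formal if there is a quasi-isomorphism of $A(\infty)$ $R[h]/h^{n+1}$-algebras $\gamma:\tilde A/h^{n+1}\to A(2)[h]/h^{n+1}$ with $\gamma\equiv(\mathrm{id},0,0,\dots)\pmod h$. Hochschild cohomology. Let $A[1]^n=A^{n+1}$, $s:A\to A[1]$ the shift, $\overline{T}A[1]=\bigoplus_{i\ge1}A[1]^{\otimes i}$ the reduced cofree coalgebra with comultiplication $\Delta(a_1,\dots,a_n)=\sum_{i=1}^{n-1}(a_1,\dots,a_i)\otimes(a_{i+1},\dots,a_n)$. $R$-linear coderivations of degree $p$ correspond, by projection to $A[1]$, to collections $(d_1,d_2,\dots)$ of $R$-linear maps $d_i:A[1]^{\otimes i}\to A[1]$ of degree $p$. Operations $m_i$ of degree $2-i$ correspond to degree-$1$ maps by $d_i(sa_1\otimes\cdots\otimes sa_i)=(-1)^{N}s\,m_i(a_1\otimes\cdots\otimes a_i)$, $N=\frac{i(i+1)}2+(i-1)\deg a_1+(i-2)\deg a_2+\cdots+\deg a_{i-1}$,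 and an $A(\infty)$ structure corresponds to a coderivation $m_A$ of degree $1$ with $m_A^2=0$. A single operation $m_i$ is also viewed as the coderivation with only this component nonzero. $C^p_R(A)=\prod_{n\ge1}\mathrm{Hom}^p_R(A[1]^{\otimes n},A[1])$ is the module of degree-$p$ coderivations, with differential $d\mapsto[m_A,d]=m_Ad-(-1)^{\deg d}dm_A$; $HH^{p+1}_R(A):=H^p(C^\bullet_R(A))$. Kaledin class. As a coderivation, $m_{\tilde A/h^{n+1}}=m_2+m_3h+\dots+m_{n+2}h^n$. Its derivative $\partial_h m=m_3+2m_4h+\dots+n\,m_{n+2}h^{n-1}$ is a $1$-cocycle of $C^\bullet_{R[h]/h^n}(\tilde A/h^n)$, and $K_{\tilde A/h^{n+1}}\in HH^2_{R[h]/h^n}(\tilde A/h^n)$ is its class. In b) the assumption means $m_3=\dots=m_{n+1}=0$, and then $m_{n+2}$ is a cocycle in $C^1_R(A(2))$.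
   Formalization: The sign exponent N relating m_i to d_i is taken without the summand i(i+1)/2, since with that summand the A(∞) relations with signs (-1)^{r+st} do not give m_A^2=0 (first failure in arity 5, the m_3 m_3 terms), so the Kaledin class would be undefined. *)

theory Defs
  imports "HOL-Algebra.Algebra"
begin

section \<open>Graded modules\<close>

record ('r, 'a) gmodule = "('r, 'a) module" +
  gr :: "int \<Rightarrow> 'a set"

text \<open>\<open>hcomps A x c\<close>: the family \<open>c\<close> consists of the homogeneous components of \<open>x\<close>.\<close>

definition hcomps :: "('r, 'a, 'z) gmodule_scheme \<Rightarrow> 'a \<Rightarrow> (int \<Rightarrow> 'a) \<Rightarrow> bool" where
  "hcomps A x c \<longleftrightarrow> (\<forall>n. c n \<in> gr A n) \<and> finite {n. c n \<noteq> \<zero>\<^bsub>A\<^esub>} \<and>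
     x = (\<Oplus>\<^bsub>A\<^esub>n\<in>{n. c n \<noteq> \<zero>\<^bsub>A\<^esub>}. c n)"

locale graded_module = module R A
  for R :: "('r, 'y) ring_scheme" (structure) and A :: "('r, 'a, 'z) gmodule_scheme" (structure) +
  assumes gr_submodule: "\<And>n. submodule (gr A n) R A"
    and gr_direct_sum: "\<And>x. x \<in> carrier A \<Longrightarrow> \<exists>!c. hcomps A x c"

definition shift :: "('r, 'a, 'z) gmodule_scheme \<Rightarrow> ('r, 'a, 'z) gmodule_scheme" where
  "shift A = A\<lparr>gr := (\<lambda>n. gr A (n + 1))\<rparr>"

text \<open>
  \<open>sgn_mult A e x\<close> is $(-1)^e x$, and \<open>koszul A p\<close> is the linear map sending a homogeneous \<open>x\<close>
  to $(-1)^{p \deg x} x$. The Koszul sign rule for maps \<open>f\<close>, \<open>g\<close>, with \<open>g\<close> of degree \<open>p\<close>, then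
  reads $(f \otimes g)(x \otimes y) = f(\mathrm{koszul}_p\, x) \otimes g(y)$ for all \<open>x\<close>,
  homogeneous or not.
\<close>

definition sgn_mult :: "('r, 'a, 'z) gmodule_scheme \<Rightarrow> int \<Rightarrow> 'a \<Rightarrow> 'a" where
  "sgn_mult A e x = (if even e then x else \<ominus>\<^bsub>A\<^esub> x)"

definition koszul :: "('r, 'a, 'z) gmodule_scheme \<Rightarrow> int \<Rightarrow> 'a \<Rightarrow> 'a" where
  "koszul A p x = (let c = (THE c. hcomps A x c)
     in \<Oplus>\<^bsub>A\<^esub>n\<in>{n. c n \<noteq> \<zero>\<^bsub>A\<^esub>}. sgn_mult A (p * n) (c n))"


section \<open>Projective modules\<close>

definition linear_map ::
  "('r, 'y) ring_scheme \<Rightarrow> ('r, 'a, 'z) module_scheme \<Rightarrow> ('r, 'b, 'w) module_scheme \<Rightarrow> ('a \<Rightarrow> 'b) \<Rightarrow> bool"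
where
  "linear_map R M N f \<longleftrightarrow> f \<in> carrier M \<rightarrow> carrier N \<and>
     (\<forall>x\<in>carrier M. \<forall>y\<in>carrier M. f (x \<oplus>\<^bsub>M\<^esub> y) = f x \<oplus>\<^bsub>N\<^esub> f y) \<and>
     (\<forall>a\<in>carrier R. \<forall>x\<in>carrier M. f (a \<odot>\<^bsub>M\<^esub> x) = a \<odot>\<^bsub>N\<^esub> f x)"

text \<open>The fields \<open>mult\<close> and \<open>one\<close> of a module record carry no meaning.\<close>

definition free_module :: "('r, 'y) ring_scheme \<Rightarrow> 'b set \<Rightarrow> ('r, 'b \<Rightarrow> 'r) module" where
  "free_module R S = \<lparr>
     carrier = {f. (\<forall>x. f x \<in> carrier R) \<and> (\<forall>x. x \<notin> S \<longrightarrow> f x = \<zero>\<^bsub>R\<^esub>) \<and> finite {x. f x \<noteq> \<zero>\<^bsub>R\<^esub>}},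
     monoid.mult = undefined, one = undefined,
     ring.zero = (\<lambda>_. \<zero>\<^bsub>R\<^esub>), ring.add = (\<lambda>f g x. f x \<oplus>\<^bsub>R\<^esub> g x), smult = (\<lambda>a f x. a \<otimes>\<^bsub>R\<^esub> f x)\<rparr>"

text \<open>
  A module is projective if it is a direct summand (a retract) of a free module. Bases \<open>S\<close> with
  elements in the type of \<open>P\<close> suffice: a retract of any free module is a retract of the free
  module on the set \<open>carrier P\<close>.
\<close>

definition projective_module :: "('r, 'y) ring_scheme \<Rightarrow> ('r, 'a, 'z) module_scheme \<Rightarrow> bool" where
  "projective_module R P \<longleftrightarrow> module R P \<and>
     (\<exists>(S :: 'a set) i q. linear_map R P (free_module R S) i \<and> linear_map R (free_module R S) P q \<and>
        (\<forall>x\<in>carrier P. q (i x) = x))"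


section \<open>Collections of multilinear maps\<close>

text \<open>
  A collection $(f_1, f_2, \dots)$ of $R$-linear maps $f_i : A^{\otimes i} \to B$ is encoded as one
  function \<open>f\<close> on nonempty lists, with $f_i(a_1 \otimes \dots \otimes a_i)$ written
  \<open>f [a1, ..., ai]\<close>; by the universal property of the tensor power, linearity of $f_i$ means that
  \<open>f\<close> is multilinear on the lists of length \<open>i\<close>. In \<open>multimaps R A B p f\<close> the map $f_i$ is
  homogeneous of degree \<open>p i\<close>.
\<close>

definition words :: "('r, 'a, 'z) gmodule_scheme \<Rightarrow> 'a list set" where
  "words A = {xs. xs \<noteq> [] \<and> set xs \<subseteq> carrier A}"

definition multimaps ::
  "('r, 'y) ring_scheme \<Rightarrow> ('r, 'a, 'z) gmodule_scheme \<Rightarrow> ('r, 'b, 'w) gmodule_scheme \<Rightarrow>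
   (nat \<Rightarrow> int) \<Rightarrow> ('a list \<Rightarrow> 'b) \<Rightarrow> bool"
where
  "multimaps R A B p f \<longleftrightarrow>
     (\<forall>xs\<in>words A. f xs \<in> carrier B) \<and>
     (\<forall>xs ys. \<forall>x\<in>carrier A. \<forall>y\<in>carrier A. set xs \<subseteq> carrier A \<and> set ys \<subseteq> carrier A \<longrightarrow>
        f (xs @ (x \<oplus>\<^bsub>A\<^esub> y) # ys) = f (xs @ x # ys) \<oplus>\<^bsub>B\<^esub> f (xs @ y # ys)) \<and>
     (\<forall>xs ys. \<forall>a\<in>carrier R. \<forall>x\<in>carrier A. set xs \<subseteq> carrier A \<and> set ys \<subseteq> carrier A \<longrightarrow>
        f (xs @ (a \<odot>\<^bsub>A\<^esub> x) # ys) = a \<odot>\<^bsub>B\<^esub> f (xs @ x # ys)) \<and>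
     (\<forall>xs ds. xs \<noteq> [] \<and> length ds = length xs \<and> (\<forall>j<length xs. xs ! j \<in> gr A (ds ! j)) \<longrightarrow>
        f xs \<in> gr B (sum_list ds + p (length xs)))"

definition arity_part ::
  "('r, 'b, 'w) gmodule_scheme \<Rightarrow> nat \<Rightarrow> ('a list \<Rightarrow> 'b) \<Rightarrow> ('a list \<Rightarrow> 'b)" where
  "arity_part B i f = (\<lambda>xs. if length xs = i then f xs else \<zero>\<^bsub>B\<^esub>)"

text \<open>$(1^{\otimes r} \otimes g_s \otimes 1^{\otimes t})(xs)$ for $g_s$ of degree \<open>p\<close>, \<open>t = length xs - r - s\<close>\<close>

definition insert_op ::
  "('r, 'a, 'z) gmodule_scheme \<Rightarrow> int \<Rightarrow> nat \<Rightarrow> nat \<Rightarrow> ('a list \<Rightarrow> 'a) \<Rightarrow> 'a list \<Rightarrow> 'a list" where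
  "insert_op A p r s g xs =
     map (koszul A p) (take r xs) @ g (take s (drop r xs)) # drop (r + s) xs"

text \<open>The pairs \<open>(r, s)\<close> with \<open>n = r + s + t\<close>, \<open>s \<ge> 1\<close>, \<open>r, t \<ge> 0\<close>\<close>

definition splits :: "nat \<Rightarrow> (nat \<times> nat) set" where
  "splits n = {(r, s). 1 \<le> s \<and> r + s \<le> n}"


section \<open>A-infinity algebras and morphisms\<close>

definition ainf_algebra ::
  "('r, 'y) ring_scheme \<Rightarrow> ('r, 'a, 'z) gmodule_scheme \<Rightarrow> ('a list \<Rightarrow> 'a) \<Rightarrow> bool" where
  "ainf_algebra R A m \<longleftrightarrow> graded_module R A \<and> multimaps R A A (\<lambda>i. 2 - int i) m \<and>
     (\<forall>xs\<in>words A. let n = length xs in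
        finsum A (\<lambda>(r, s). sgn_mult A (int (r + s * (n - r - s)))
           (m (insert_op A (2 - int s) r s m xs))) (splits n) = \<zero>\<^bsub>A\<^esub>)"

definition minimal_ainf :: "('r, 'a, 'z) gmodule_scheme \<Rightarrow> ('a list \<Rightarrow> 'a) \<Rightarrow> bool" where
  "minimal_ainf A m \<longleftrightarrow> (\<forall>x\<in>carrier A. m [x] = \<zero>\<^bsub>A\<^esub>)"

definition flat_ainf :: "('r, 'y) ring_scheme \<Rightarrow> ('r, 'a, 'z) gmodule_scheme \<Rightarrow> bool" where
  "flat_ainf R A \<longleftrightarrow> (\<forall>i. projective_module R (A\<lparr>carrier := gr A i\<rparr>))"

definition compositions :: "nat \<Rightarrow> nat list set" where
  "compositions n = {ls. sum_list ls = n \<and> 0 \<notin> set ls}"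

text \<open>
  \<open>tensor_op A f [i1, ..., ir]\<close> is $f_{i_1} \otimes \dots \otimes f_{i_r}$, where $f_i$ has degree
  $1 - i$.
\<close>

fun tensor_op ::
  "('r, 'a, 'z) gmodule_scheme \<Rightarrow> ('a list \<Rightarrow> 'b) \<Rightarrow> nat list \<Rightarrow> 'a list \<Rightarrow> 'b list" where
  "tensor_op A f [] xs = []"
| "tensor_op A f (i # ls) xs =
     f (map (koszul A (\<Sum>l\<leftarrow>ls. 1 - int l)) (take i xs)) # tensor_op A f ls (drop i xs)"

text \<open>The exponent $(r-1)(i_1-1)+(r-2)(i_2-1)+\dots+(i_{r-1}-1)$\<close>

fun tensor_exp :: "nat list \<Rightarrow> int" where
  "tensor_exp [] = 0"
| "tensor_exp (i # ls) = int (length ls) * (int i - 1) + tensor_exp ls"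

definition ainf_morphism ::
  "('r, 'y) ring_scheme \<Rightarrow> ('r, 'a, 'z) gmodule_scheme \<Rightarrow> ('a list \<Rightarrow> 'a) \<Rightarrow>
   ('r, 'b, 'w) gmodule_scheme \<Rightarrow> ('b list \<Rightarrow> 'b) \<Rightarrow> ('a list \<Rightarrow> 'b) \<Rightarrow> bool"
where
  "ainf_morphism R A mA B mB f \<longleftrightarrow> multimaps R A B (\<lambda>i. 1 - int i) f \<and>
     (\<forall>xs\<in>words A. let n = length xs in
        finsum B (\<lambda>(r, s). sgn_mult B (int (r + s * (n - r - s)))
           (f (insert_op A (2 - int s) r s mA xs))) (splits n) =
        (\<Oplus>\<^bsub>B\<^esub>ls\<in>compositions n. sgn_mult B (tensor_exp ls) (mB (tensor_op A f ls xs))))"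


section \<open>Cohomology\<close>

text \<open>
  Complexes are families of abelian groups written as monoid records, so the zero of a cohomology
  group is its \<open>one\<close>.
\<close>

definition coboundaries :: "(int \<Rightarrow> 'c monoid) \<Rightarrow> (int \<Rightarrow> 'c \<Rightarrow> 'c) \<Rightarrow> int \<Rightarrow> 'c set" where
  "coboundaries C \<delta> p = \<delta> (p - 1) ` carrier (C (p - 1))"

definition cocycles :: "(int \<Rightarrow> 'c monoid) \<Rightarrow> (int \<Rightarrow> 'c \<Rightarrow> 'c) \<Rightarrow> int \<Rightarrow> 'c monoid" where
  "cocycles C \<delta> p = (C p)\<lparr>carrier := {z \<in> carrier (C p). \<delta> p z = \<one>\<^bsub>C (p + 1)\<^esub>}\<rparr>"

definition cohomology :: "(int \<Rightarrow> 'c monoid) \<Rightarrow> (int \<Rightarrow> 'c \<Rightarrow> 'c) \<Rightarrow> int \<Rightarrow> 'c set monoid" where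
  "cohomology C \<delta> p = cocycles C \<delta> p Mod coboundaries C \<delta> p"

definition cohomology_class ::
  "(int \<Rightarrow> 'c monoid) \<Rightarrow> (int \<Rightarrow> 'c \<Rightarrow> 'c) \<Rightarrow> int \<Rightarrow> 'c \<Rightarrow> 'c set" where
  "cohomology_class C \<delta> p z = coboundaries C \<delta> p #>\<^bsub>cocycles C \<delta> p\<^esub> z"

definition graded_groups :: "('r, 'a, 'z) gmodule_scheme \<Rightarrow> int \<Rightarrow> 'a monoid" where
  "graded_groups A n = \<lparr>carrier = gr A n, monoid.mult = ring.add A, one = \<zero>\<^bsub>A\<^esub>\<rparr>"

definition ainf_quasi_iso ::
  "('r, 'y) ring_scheme \<Rightarrow> ('r, 'a, 'z) gmodule_scheme \<Rightarrow> ('a list \<Rightarrow> 'a) \<Rightarrow>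
   ('r, 'b, 'w) gmodule_scheme \<Rightarrow> ('b list \<Rightarrow> 'b) \<Rightarrow> ('a list \<Rightarrow> 'b) \<Rightarrow> bool"
where
  "ainf_quasi_iso R A mA B mB f \<longleftrightarrow> ainf_morphism R A mA B mB f \<and>
     (\<forall>n. bij_betw
        (\<lambda>c. \<Union>z\<in>c. cohomology_class (graded_groups B) (\<lambda>_ x. mB [x]) n (f [z]))
        (carrier (cohomology (graded_groups A) (\<lambda>_ x. mA [x]) n))
        (carrier (cohomology (graded_groups B) (\<lambda>_ x. mB [x]) n)))"


section \<open>Hochschild cohomology\<close>

text \<open>
  The degree-one coderivation of an A-infinity structure, given by its components
  \[ d_i(sa_1 \otimes \dots \otimes sa_i) = (-1)^N s\, m_i(a_1 \otimes \dots \otimes a_i), \qquad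
     N = (i-1)\deg a_1 + (i-2)\deg a_2 + \dots + \deg a_{i-1}, \]
  that is, $d_i \circ s^{\otimes i} = s \circ m_i$ with the Koszul sign rule; the shift \<open>s\<close> is the
  identity on underlying elements. With the signs $(-1)^{r+st}$ in the A-infinity relations this is
  the normalization for which they are equivalent to $m_A^2 = 0$. An additional factor
  $(-1)^{i(i+1)/2}$, found in the literature, belongs to the convention with signs $(-1)^{rs+t}$;
  combined with $(-1)^{r+st}$ it would give the terms with $r+1+t$ and $s$ both even the wrong
  relative sign.
\<close>

definition bar :: "('r, 'a, 'z) gmodule_scheme \<Rightarrow> ('a list \<Rightarrow> 'a) \<Rightarrow> ('a list \<Rightarrow> 'a)" where
  "bar A m = (\<lambda>xs\<in>words A.
     m (map (\<lambda>j. koszul A (int (length xs) - 1 - int j) (xs ! j)) [0..<length xs]))"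

text \<open>
  A coderivation \<open>E\<close> of degree \<open>p\<close> with components $e_s$ acts on $A[1]^{\otimes n}$ as
  $\sum 1^{\otimes r} \otimes e_s \otimes 1^{\otimes t}$, so the projection to $A[1]$ of the
  composite $D \circ E$ has the components
  $\sum d_{r+1+t} (1^{\otimes r} \otimes e_s \otimes 1^{\otimes t})$. In \<open>coder_comp S p D E\<close> the
  graded module \<open>S\<close> is $A[1]$ and \<open>p\<close> is the degree of \<open>E\<close>.
\<close>

definition coder_comp ::
  "('r, 'a, 'z) gmodule_scheme \<Rightarrow> int \<Rightarrow> ('a list \<Rightarrow> 'a) \<Rightarrow> ('a list \<Rightarrow> 'a) \<Rightarrow> ('a list \<Rightarrow> 'a)"
where
  "coder_comp S p D E = (\<lambda>xs. finsum S (\<lambda>(r, s). D (insert_op S p r s E xs)) (splits (length xs)))"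

definition hoch_cochains ::
  "('r, 'y) ring_scheme \<Rightarrow> ('r, 'a, 'z) gmodule_scheme \<Rightarrow> int \<Rightarrow> ('a list \<Rightarrow> 'a) monoid" where
  "hoch_cochains R A p = \<lparr>
     carrier = {d \<in> extensional (words A). multimaps R (shift A) (shift A) (\<lambda>_. p) d},
     monoid.mult = (\<lambda>d e. \<lambda>xs\<in>words A. d xs \<oplus>\<^bsub>A\<^esub> e xs),
     one = (\<lambda>xs\<in>words A. \<zero>\<^bsub>A\<^esub>)\<rparr>"

definition hoch_diff ::
  "('r, 'a, 'z) gmodule_scheme \<Rightarrow> ('a list \<Rightarrow> 'a) \<Rightarrow> int \<Rightarrow> ('a list \<Rightarrow> 'a) \<Rightarrow> ('a list \<Rightarrow> 'a)" where
  "hoch_diff A m p d = (\<lambda>xs\<in>words A.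
     coder_comp (shift A) p (bar A m) d xs \<ominus>\<^bsub>A\<^esub>
     sgn_mult A p (coder_comp (shift A) 1 d (bar A m) xs))"

definition HH ::
  "('r, 'y) ring_scheme \<Rightarrow> ('r, 'a, 'z) gmodule_scheme \<Rightarrow> ('a list \<Rightarrow> 'a) \<Rightarrow> int \<Rightarrow>
   ('a list \<Rightarrow> 'a) set monoid"
where
  "HH R A m q = cohomology (hoch_cochains R A) (hoch_diff A m) (q - 1)"

definition HH_class ::
  "('r, 'y) ring_scheme \<Rightarrow> ('r, 'a, 'z) gmodule_scheme \<Rightarrow> ('a list \<Rightarrow> 'a) \<Rightarrow> int \<Rightarrow>
   ('a list \<Rightarrow> 'a) \<Rightarrow> ('a list \<Rightarrow> 'a) set"
where
  "HH_class R A m q d = cohomology_class (hoch_cochains R A) (hoch_diff A m) (q - 1) d"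


section \<open>Base change to truncated polynomials\<close>

text \<open>
  \<open>hring R N\<close> is $R[h]/h^N$ and \<open>hmod R A N\<close> is $A[h]/h^N$; an element is represented by its
  sequence of coefficients of $1, h, \dots, h^{N-1}$, continued by zero (for the comparison with the
  library quotient see \<open>hring_iso_UP_Quot\<close>). The parameter \<open>h\<close> has
  degree 0.
\<close>

definition hring :: "('r, 'y) ring_scheme \<Rightarrow> nat \<Rightarrow> (nat \<Rightarrow> 'r) ring" where
  "hring R N = \<lparr>
     carrier = {p. (\<forall>i<N. p i \<in> carrier R) \<and> (\<forall>i\<ge>N. p i = \<zero>\<^bsub>R\<^esub>)},
     monoid.mult = (\<lambda>p q i. if i < N then \<Oplus>\<^bsub>R\<^esub>j\<in>{..i}. p j \<otimes>\<^bsub>R\<^esub> q (i - j) else \<zero>\<^bsub>R\<^esub>),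
     one = (\<lambda>i. if i = 0 \<and> 0 < N then \<one>\<^bsub>R\<^esub> else \<zero>\<^bsub>R\<^esub>),
     ring.zero = (\<lambda>_. \<zero>\<^bsub>R\<^esub>),
     ring.add = (\<lambda>p q i. p i \<oplus>\<^bsub>R\<^esub> q i)\<rparr>"

lemma carrier_UP: "carrier (UP R) = up R" by (simp add: UP_def)
lemma coeff_UP: "x \<in> up R \<Longrightarrow> up_ring.coeff (UP R) x = x" by (simp add: UP_def)

lemma hring_iso_UP_Quot:
  assumes R: "cring R" and N: "0 < N"
  shows "UP R Quot (PIdl\<^bsub>UP R\<^esub> (up_ring.monom (UP R) \<one>\<^bsub>R\<^esub> N)) \<simeq> hring R N"
proof -
  interpret R: cring R by (rule R)
  interpret UP_cring R "UP R" by (rule UP_cring.intro[OF R])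
  define P where "P = UP R"
  define \<phi> where "\<phi> = (\<lambda>p i. if i < N then up_ring.coeff P p i else \<zero>\<^bsub>R\<^esub>)"
  define T where "T = up_ring.monom P \<one>\<^bsub>R\<^esub> N"
  have T: "T \<in> carrier P" by (simp add: T_def P_def)
  have coeffT: "up_ring.coeff P T i = (if N = i then \<one>\<^bsub>R\<^esub> else \<zero>\<^bsub>R\<^esub>)" for i
    by (simp add: T_def P_def)
  have mulT: "up_ring.coeff P (q \<otimes>\<^bsub>P\<^esub> T) i = (if i < N then \<zero>\<^bsub>R\<^esub> else up_ring.coeff P q (i - N))"
    if q: "q \<in> carrier P" for q i
  proof -
    have "up_ring.coeff P (q \<otimes>\<^bsub>P\<^esub> T) i =
        finsum R (\<lambda>j. up_ring.coeff P q j \<otimes>\<^bsub>R\<^esub> (if N = i - j then \<one>\<^bsub>R\<^esub> else \<zero>\<^bsub>R\<^esub>)) {..i}"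
      using q T coeffT by (simp add: P_def)
    also have "\<dots> = finsum R (\<lambda>j. if N \<le> i \<and> i - N = j then up_ring.coeff P q j else \<zero>\<^bsub>R\<^esub>) {..i}"
      using q N by (intro R.finsum_cong') (auto simp: P_def)
    also have "\<dots> = (if i < N then \<zero>\<^bsub>R\<^esub> else up_ring.coeff P q (i - N))"
    proof (cases "i < N")
      case False
      then show ?thesis
        using q R.finsum_singleton[of "i - N" "{..i}" "up_ring.coeff P q"] by (auto simp: P_def Pi_def)
    qed (simp add: R.finsum_zero)
    finally show ?thesis .
  qed
  have hom: "\<phi> \<in> ring_hom P (hring R N)"
  proof (rule ring_hom_memI)
    fix p q assume pq: "p \<in> carrier P" "q \<in> carrier P"
    show "\<phi> p \<in> carrier (hring R N)" using pq by (simp add: \<phi>_def hring_def P_def)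
    show "\<phi> (p \<oplus>\<^bsub>P\<^esub> q) = \<phi> p \<oplus>\<^bsub>hring R N\<^esub> \<phi> q"
      using pq by (auto simp: \<phi>_def hring_def P_def fun_eq_iff)
    show "\<phi> (p \<otimes>\<^bsub>P\<^esub> q) = \<phi> p \<otimes>\<^bsub>hring R N\<^esub> \<phi> q"
    proof
      fix i
      show "\<phi> (p \<otimes>\<^bsub>P\<^esub> q) i = (\<phi> p \<otimes>\<^bsub>hring R N\<^esub> \<phi> q) i"
        using pq by (auto simp: \<phi>_def hring_def P_def intro!: R.finsum_cong')
    qed
  next
    show "\<phi> \<one>\<^bsub>P\<^esub> = \<one>\<^bsub>hring R N\<^esub>" using N by (auto simp: \<phi>_def hring_def P_def fun_eq_iff)
  qed
  have surj: "\<phi> ` carrier P = carrier (hring R N)"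
  proof
    show "\<phi> ` carrier P \<subseteq> carrier (hring R N)" using hom by (auto simp: ring_hom_def)
    show "carrier (hring R N) \<subseteq> \<phi> ` carrier P"
    proof
      fix x assume x: "x \<in> carrier (hring R N)"
      have x1: "x i \<in> carrier R" for i
        using x by (cases "i < N") (simp_all add: hring_def)
      have x2: "bound \<zero>\<^bsub>R\<^esub> N x"
        using x by (intro bound.intro) (simp add: hring_def)
      have "x \<in> up R" by (rule mem_upI) (rule x1, rule exI, rule x2)
      then have "x \<in> carrier P" unfolding P_def carrier_UP .
      moreover have "\<phi> x = x"
        using x unfolding \<phi>_def P_def coeff_UP[OF \<open>x \<in> up R\<close>] by (simp add: hring_def fun_eq_iff)
      ultimately show "x \<in> \<phi> ` carrier P" by (metis imageI)
    qed
  qed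
  have ringP: "ring P" using UP_ring by (simp add: P_def)
  have "\<phi> \<zero>\<^bsub>P\<^esub> = \<zero>\<^bsub>hring R N\<^esub>" by (auto simp: \<phi>_def hring_def P_def fun_eq_iff)
  then have "ring (hring R N)"
    using ring.ring_hom_imp_img_ring[OF ringP hom] surj by simp
  then interpret H: ring_hom_ring P "hring R N" \<phi>
    using ringP hom by (intro ring_hom_ringI2)
  have "a_kernel P (hring R N) \<phi> = PIdl\<^bsub>P\<^esub> T"
  proof
    show "PIdl\<^bsub>P\<^esub> T \<subseteq> a_kernel P (hring R N) \<phi>"
    proof
      fix p assume "p \<in> PIdl\<^bsub>P\<^esub> T"
      then obtain q where q: "q \<in> carrier P" "p = q \<otimes>\<^bsub>P\<^esub> T" by (auto simp: cgenideal_def)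
      then have "p \<in> carrier P" using T by (simp add: P_def)
      then show "p \<in> a_kernel P (hring R N) \<phi>"
        using mulT[OF q(1)] unfolding q(2) by (simp add: a_kernel_def' \<phi>_def hring_def fun_eq_iff)
    qed
    show "a_kernel P (hring R N) \<phi> \<subseteq> PIdl\<^bsub>P\<^esub> T"
    proof
      fix p assume "p \<in> a_kernel P (hring R N) \<phi>"
      then have p: "p \<in> carrier P" and p0: "\<And>i. i < N \<Longrightarrow> up_ring.coeff P p i = \<zero>\<^bsub>R\<^esub>"
        by (auto simp: a_kernel_def' \<phi>_def hring_def fun_eq_iff split: if_splits)
      define q where "q = (\<lambda>i. p (i + N))"
      obtain b where b: "bound \<zero>\<^bsub>R\<^esub> b p" using p unfolding P_def carrier_UP up_def by blast
      have pU: "p \<in> up R" using p unfolding P_def carrier_UP .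
      have bq: "bound \<zero>\<^bsub>R\<^esub> b q" using b by (simp add: q_def bound_def)
      have q1: "q i \<in> carrier R" for i unfolding q_def by (rule mem_upD[OF pU])
      have qU: "q \<in> up R" by (rule mem_upI) (rule q1, rule exI, rule bq)
      then have q: "q \<in> carrier P" unfolding P_def carrier_UP .
      have "p = q \<otimes>\<^bsub>P\<^esub> T"
      proof -
        have "up_ring.coeff P p i = up_ring.coeff P (q \<otimes>\<^bsub>P\<^esub> T) i" for i
          using p0[of i] unfolding mulT[OF q] unfolding P_def coeff_UP[OF pU] coeff_UP[OF qU] by (simp add: q_def)
        then show ?thesis using p q T by (intro up_eqI) (auto simp: P_def)
      qed
      then show "p \<in> PIdl\<^bsub>P\<^esub> T" using q by (auto simp: cgenideal_def)
    qed
  qed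
  then show ?thesis using H.FactRing_iso[OF surj] by (simp add: P_def T_def)
qed

definition hpow :: "('r, 'y) ring_scheme \<Rightarrow> nat \<Rightarrow> nat \<Rightarrow> (nat \<Rightarrow> 'r)" where
  "hpow R N e = (\<lambda>i. if i = e \<and> e < N then \<one>\<^bsub>R\<^esub> else \<zero>\<^bsub>R\<^esub>)"

definition hmod ::
  "('r, 'y) ring_scheme \<Rightarrow> ('r, 'a, 'z) gmodule_scheme \<Rightarrow> nat \<Rightarrow> (nat \<Rightarrow> 'r, nat \<Rightarrow> 'a) gmodule" where
  "hmod R A N = \<lparr>
     carrier = {x. (\<forall>i<N. x i \<in> carrier A) \<and> (\<forall>i\<ge>N. x i = \<zero>\<^bsub>A\<^esub>)},
     monoid.mult = undefined, one = undefined,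
     ring.zero = (\<lambda>_. \<zero>\<^bsub>A\<^esub>),
     ring.add = (\<lambda>x y i. x i \<oplus>\<^bsub>A\<^esub> y i),
     smult = (\<lambda>p x i. if i < N then \<Oplus>\<^bsub>A\<^esub>j\<in>{..i}. p j \<odot>\<^bsub>A\<^esub> x (i - j) else \<zero>\<^bsub>A\<^esub>),
     gr = (\<lambda>n. {x. (\<forall>i<N. x i \<in> gr A n) \<and> (\<forall>i\<ge>N. x i = \<zero>\<^bsub>A\<^esub>)})\<rparr>"

text \<open>
  The $R[h]/h^N$-multilinear extension: the coefficient of $h^j$ in $f(x_1, \dots, x_i)$ is the sum
  of $f(x_{1,j_1}, \dots, x_{i,j_i})$ over all $j_1 + \dots + j_i = j$.
\<close>

definition hext ::
  "('r, 'a, 'z) gmodule_scheme \<Rightarrow> nat \<Rightarrow> ('a list \<Rightarrow> 'a) \<Rightarrow> ((nat \<Rightarrow> 'a) list \<Rightarrow> (nat \<Rightarrow> 'a))" where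
  "hext A N f xs = (\<lambda>j. if j < N
     then \<Oplus>\<^bsub>A\<^esub>js\<in>{js. length js = length xs \<and> sum_list js = j}. f (map2 (\<lambda>x l. x l) xs js)
     else \<zero>\<^bsub>A\<^esub>)"

text \<open>The operations $\tilde m_1 = 0$, $\tilde m_i = m_i h^{i-2}$ of $\tilde A/h^N$ on $A[h]/h^N$\<close>

definition cone_op ::
  "('r, 'y) ring_scheme \<Rightarrow> ('r, 'a, 'z) gmodule_scheme \<Rightarrow> nat \<Rightarrow> ('a list \<Rightarrow> 'a) \<Rightarrow>
   ((nat \<Rightarrow> 'a) list \<Rightarrow> (nat \<Rightarrow> 'a))"
where
  "cone_op R A N m xs = (if length xs < 2 then \<zero>\<^bsub>hmod R A N\<^esub>
     else hpow R N (length xs - 2) \<odot>\<^bsub>hmod R A N\<^esub> hext A N m xs)"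


section \<open>Formality and the Kaledin class\<close>

definition n_formal ::
  "('r, 'y) ring_scheme \<Rightarrow> ('r, 'a, 'z) gmodule_scheme \<Rightarrow> ('a list \<Rightarrow> 'a) \<Rightarrow> nat \<Rightarrow> bool" where
  "n_formal R A m n \<longleftrightarrow> (\<exists>\<gamma>.
     ainf_quasi_iso (hring R (n + 1))
       (hmod R A (n + 1)) (cone_op R A (n + 1) m)
       (hmod R A (n + 1)) (hext A (n + 1) (arity_part A 2 m)) \<gamma> \<and>
     (\<forall>x\<in>carrier (hmod R A (n + 1)). \<gamma> [x] 0 = x 0) \<and>
     (\<forall>xs\<in>words (hmod R A (n + 1)). 2 \<le> length xs \<longrightarrow> \<gamma> xs 0 = \<zero>\<^bsub>A\<^esub>))"

text \<open>
  $\partial_h m = m_3 + 2 m_4 h + \dots + n\, m_{n+2} h^{n-1}$; in arity $i \ge 3$ this is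
  $(i-2)\, m_i h^{i-3}$, which vanishes in $A[h]/h^n$ for $i \ge n+3$.
\<close>

definition kaledin_cocycle ::
  "('r, 'y) ring_scheme \<Rightarrow> ('r, 'a, 'z) gmodule_scheme \<Rightarrow> ('a list \<Rightarrow> 'a) \<Rightarrow> nat \<Rightarrow>
   ((nat \<Rightarrow> 'a) list \<Rightarrow> (nat \<Rightarrow> 'a))"
where
  "kaledin_cocycle R A m n = (\<lambda>xs\<in>words (hmod R A n).
     if length xs < 3 then \<zero>\<^bsub>hmod R A n\<^esub>
     else add_pow (hmod R A n) (length xs - 2)
       (hpow R n (length xs - 3) \<odot>\<^bsub>hmod R A n\<^esub> hext A n (bar A m) xs))"

definition kaledin_class ::
  "('r, 'y) ring_scheme \<Rightarrow> ('r, 'a, 'z) gmodule_scheme \<Rightarrow> ('a list \<Rightarrow> 'a) \<Rightarrow> nat \<Rightarrow>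
   ((nat \<Rightarrow> 'a) list \<Rightarrow> (nat \<Rightarrow> 'a)) set"
where
  "kaledin_class R A m n =
     HH_class (hring R n) (hmod R A n) (cone_op R A n m) 2 (kaledin_cocycle R A m n)"

end

theory Submission
  imports Defs
begin

text \<open>
  Formality and the vanishing of the Kaledin class are two conditions on power series in \<open>h\<close>, and
  they are linked by a linear differential equation.

  With the signs of the bar construction, the component of arity \<open>a + 2\<close> of an A-infinity structure
  becomes a map \<open>M a\<close> of degree one, and the structure of the deformation to the normal cone is the
  series $M = \sum M_a h^a$. A coderivation \<open>E\<close> acts from the right on functions of words, by
  inserting its value at all places of a word; write $\varphi \cdot E$ for this action
  (\<open>coder_act\<close>). An A-infinity morphism from the cone to its quadratic part that is the identity
  modulo \<open>h\<close> is a series \<open>F\<close> of maps of degree zero whose constant term is the projection to words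
  of length one, and the equation of a morphism is $X = 0$ modulo $h^{n+1}$, where
  $X = F \cdot M - M_0(F, F)$ (\<open>formality_defect\<close>). The Kaledin class vanishes if and only if
  $Y = M' - [M, g]$ is zero modulo $h^n$ for some series \<open>g\<close> of maps of degree zero
  (\<open>kaledin_defect\<close>).

  Now let \<open>F\<close> and \<open>g\<close> be related by $F' = F \cdot g$. Then
  \[ X' = X \cdot g + F \cdot Y \]
  (\<open>formality_defect_derivative\<close>). Since $X(0) = 0$, since $F \cdot Y$ begins with \<open>Y\<close>, and since
  positive integers are invertible, a comparison of coefficients shows that \<open>X\<close> vanishes modulo
  $h^{n+1}$ exactly when \<open>Y\<close> vanishes modulo $h^n$ (\<open>formality_defect_zero_iff\<close>). For given \<open>g\<close> the
  equation $F' = F \cdot g$ is solved by dividing by integers; for given \<open>F\<close> it is solved for \<open>g\<close>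
  because \<open>F\<close> is invertible. This is the equivalence with the Kaledin class. If \<open>M a\<close>
  vanishes for $0 < a < n$, then $Y = 0$ reduces to $n M_n = [M_0, g_{n-1}]$, which is the second equivalence
  (\<open>kaledin_single_term\<close>).

  The formula for \<open>X'\<close> needs two identities: the commutator of the actions of two coderivations is
  the action of their bracket (\<open>coder_act_commutator\<close>), and a coderivation acts on $M_0(F, F)$ by the
  Leibniz rule (\<open>coder_act_bilin_op\<close>). Both follow from the compatibility of a coderivation with
  deconcatenation (\<open>coder_act_cut_sum\<close>).

  All of this takes place in a type of class \<open>ab_group_add\<close>, where sums carry no membership
  conditions. Graded modules are embedded into such a type, \<open>ab_universe\<close>, and multilinear maps are
  extended to it (\<open>lift_map\<close>). Maps over $R[h]/h^N$ correspond to families of \<open>N\<close> maps over \<open>R\<close>,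
  their coefficients on constant arguments (\<open>fam\<close>, \<open>ext\<close>); two maps are equal if these coefficients
  are. In this way the equation of a morphism and the coboundary equation over $R[h]/h^N$ become the
  conditions on \<open>X\<close> and \<open>Y\<close> above.
\<close>

section \<open>Coderivations acting on functions of words\<close>

text \<open>
  The first factor of a cut is nonempty; the second may be empty. This asymmetry makes \<open>cut_sum\<close>
  recursive in the first letter of the word.
\<close>

definition cut_sum :: "('x list \<Rightarrow> 'x list \<Rightarrow> 'w::ab_group_add) \<Rightarrow> 'x list \<Rightarrow> 'w" where
  "cut_sum K xs = (\<Sum>s=1..length xs. K (take s xs) (drop s xs))"

lemma cut_sum_Nil [simp]: "cut_sum K [] = 0"
  by (simp add: cut_sum_def)

lemma cut_sum_Cons:
  "cut_sum K (x # xs) = K [x] xs + cut_sum (\<lambda>u v. K (x # u) v) xs"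
proof -
  have "cut_sum K (x # xs) = (\<Sum>s=Suc 0..Suc (length xs). K (take s (x # xs)) (drop s (x # xs)))"
    by (simp add: cut_sum_def)
  also have "\<dots> = K [x] xs + (\<Sum>s=Suc 1..Suc (length xs). K (take s (x # xs)) (drop s (x # xs)))"
    by (subst sum.atLeast_Suc_atMost) simp_all
  also have "(\<Sum>s=Suc 1..Suc (length xs). K (take s (x # xs)) (drop s (x # xs)))
      = (\<Sum>s=1..length xs. K (x # take s xs) (drop s xs))"
    by (subst sum.shift_bounds_cl_Suc_ivl) simp
  finally show ?thesis by (simp add: cut_sum_def)
qed

lemma cut_sum_add: "cut_sum (\<lambda>u v. K u v + L u v) xs = cut_sum K xs + cut_sum L xs"
  by (simp add: cut_sum_def sum.distrib)

lemma cut_sum_cong: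
  assumes "\<And>u v. u \<noteq> [] \<Longrightarrow> xs = u @ v \<Longrightarrow> K u v = L u v"
  shows "cut_sum K xs = cut_sum L xs"
  unfolding cut_sum_def by (rule sum.cong) (auto intro!: assms)

text \<open>
  Coassociativity of deconcatenation: both sides are sums over the cuts of the word into three
  factors, the first nonempty and the others possibly empty. Splitting off the empty middle factor is forced by the
  convention that the first factor of a cut is nonempty.
\<close>

lemma cut_sum_coassoc:
  "cut_sum (\<lambda>u v. L u [] v + cut_sum (\<lambda>q w. L u q w) v) xs
     = cut_sum (\<lambda>u v. cut_sum (\<lambda>p q. L p q v) u) xs"
proof (induction xs arbitrary: L)
  case (Cons x xs)
  show ?case
    using Cons.IH[of "\<lambda>p. L (x # p)"]
    by (simp add: cut_sum_Cons cut_sum_add algebra_simps)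
qed simp

text \<open>
  \<open>insert_at \<sigma> r s E\<close> is $\sigma^{\otimes r} \otimes E_s \otimes 1^{\otimes t}$, where \<open>\<sigma>\<close> collects the
  Koszul signs that arise when \<open>E\<close> passes a letter.
\<close>

definition insert_at :: "('x \<Rightarrow> 'x) \<Rightarrow> nat \<Rightarrow> nat \<Rightarrow> ('x list \<Rightarrow> 'x) \<Rightarrow> 'x list \<Rightarrow> 'x list" where
  "insert_at \<sigma> r s E xs = map \<sigma> (take r xs) @ E (take s (drop r xs)) # drop (r + s) xs"

definition coder_act ::
  "('x \<Rightarrow> 'x) \<Rightarrow> ('x list \<Rightarrow> 'x) \<Rightarrow> ('x list \<Rightarrow> 'w::ab_group_add) \<Rightarrow> 'x list \<Rightarrow> 'w" where
  "coder_act \<sigma> E \<phi> xs = (\<Sum>(r, s)\<in>splits (length xs). \<phi> (insert_at \<sigma> r s E xs))"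

lemma finite_splits [simp]: "finite (splits n)"
  by (rule finite_subset[of _ "{..n} \<times> {..n}"]) (auto simp: splits_def)

lemma splits_0 [simp]: "splits 0 = {}"
  by (auto simp: splits_def)

lemma coder_act_Nil [simp]: "coder_act \<sigma> E \<phi> [] = 0"
  by (simp add: coder_act_def)

text \<open>
  Either the inserted operation consumes the first letter, and then its argument is a prefix of the
  word, or the first letter stays and contributes a sign. The identities of this section
  are proved with this recursion instead of a comparison of positions in a word.
\<close>

lemma coder_act_Cons:
  "coder_act \<sigma> E \<phi> (x # xs)
     = cut_sum (\<lambda>u v. \<phi> (E u # v)) (x # xs) + coder_act \<sigma> E (\<lambda>ys. \<phi> (\<sigma> x # ys)) xs"
proof -
  let ?n = "length xs"
  let ?f = "\<lambda>(r, s). \<phi> (insert_at \<sigma> r s E (x # xs))"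
  have eq: "splits (Suc ?n) = Pair 0 ` {1..Suc ?n} \<union> (\<lambda>(r, s). (Suc r, s)) ` splits ?n"
  proof (intro equalityI subsetI)
    fix p assume "p \<in> splits (Suc ?n)"
    then show "p \<in> Pair 0 ` {1..Suc ?n} \<union> (\<lambda>(r, s). (Suc r, s)) ` splits ?n"
      by (cases p; cases "fst p") (auto simp: splits_def image_iff)
  qed (auto simp: splits_def)
  have "coder_act \<sigma> E \<phi> (x # xs) = sum ?f (Pair 0 ` {1..Suc ?n}) + sum ?f ((\<lambda>(r, s). (Suc r, s)) ` splits ?n)"
    unfolding coder_act_def length_Cons eq by (rule sum.union_disjoint) auto
  also have "sum ?f (Pair 0 ` {1..Suc ?n}) = cut_sum (\<lambda>u v. \<phi> (E u # v)) (x # xs)"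
    by (subst sum.reindex) (auto simp: inj_on_def cut_sum_def insert_at_def)
  also have "sum ?f ((\<lambda>(r, s). (Suc r, s)) ` splits ?n) = coder_act \<sigma> E (\<lambda>ys. \<phi> (\<sigma> x # ys)) xs"
    by (subst sum.reindex) (auto simp: inj_on_def coder_act_def insert_at_def intro!: sum.cong)
  finally show ?thesis .
qed

lemma coder_act_add:
  "coder_act \<sigma> E (\<lambda>xs. \<phi> xs + \<psi> xs) xs = coder_act \<sigma> E \<phi> xs + coder_act \<sigma> E \<psi> xs"
  by (simp add: coder_act_def sum.distrib case_prod_unfold)

lemma coder_act_diff:
  "coder_act \<sigma> E (\<lambda>xs. \<phi> xs - \<psi> xs) xs = coder_act \<sigma> E \<phi> xs - coder_act \<sigma> E \<psi> xs"
  by (simp add: coder_act_def sum_subtractf case_prod_unfold)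

lemma coder_act_sum:
  "coder_act \<sigma> E (\<lambda>xs. \<Sum>i\<in>I. \<phi> i xs) xs = (\<Sum>i\<in>I. coder_act \<sigma> E (\<phi> i) xs)"
  by (simp add: coder_act_def case_prod_unfold sum.swap[of _ I])

text \<open>
  A coderivation is compatible with deconcatenation: after an insertion the cut runs either behind or
  before the inserted letter. In the second case the operation has passed the first factor, which
  accounts for \<open>map \<sigma> u\<close>.
\<close>

lemma coder_act_cut_sum:
  "coder_act \<sigma> E (cut_sum K) xs
     = cut_sum (\<lambda>u v. coder_act \<sigma> E (\<lambda>w. K w v) u + coder_act \<sigma> E (K (map \<sigma> u)) v) xs"
proof (induction xs arbitrary: K)
  case (Cons x xs)
  have "coder_act \<sigma> E (cut_sum K) (x # xs)
      = cut_sum (\<lambda>u v. cut_sum K (E u # v)) (x # xs)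
        + coder_act \<sigma> E (\<lambda>ys. cut_sum K (\<sigma> x # ys)) xs"
    by (rule coder_act_Cons)
  also have "cut_sum (\<lambda>u v. cut_sum K (E u # v)) (x # xs)
      = cut_sum (\<lambda>u v. cut_sum (\<lambda>p q. K (E p # q) v) u) (x # xs)"
    by (simp only: cut_sum_Cons[of K] cut_sum_coassoc[of "\<lambda>p q v. K (E p # q) v"])
  also have "coder_act \<sigma> E (\<lambda>ys. cut_sum K (\<sigma> x # ys)) xs
      = coder_act \<sigma> E (K [\<sigma> x]) xs
        + cut_sum (\<lambda>u v. coder_act \<sigma> E (\<lambda>w. K (\<sigma> x # w) v) u
            + coder_act \<sigma> E (K (\<sigma> x # map \<sigma> u)) v) xs"
    by (simp add: cut_sum_Cons coder_act_add Cons.IH)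
  finally show ?case
    by (simp add: cut_sum_Cons coder_act_Cons cut_sum_add algebra_simps)
qed simp

definition slot_additive :: "('x::ab_group_add list \<Rightarrow> 'w::ab_group_add) \<Rightarrow> bool" where
  "slot_additive \<phi> \<longleftrightarrow> (\<forall>us vs. additive (\<lambda>x. \<phi> (us @ x # vs)))"

lemma slot_additiveD: "slot_additive \<phi> \<Longrightarrow> additive (\<lambda>x. \<phi> (us @ x # vs))"
  by (simp add: slot_additive_def)

lemma slot_additive_Cons:
  assumes "slot_additive \<phi>"
  shows "slot_additive (\<lambda>ys. \<phi> (y # ys))"
  unfolding slot_additive_def
proof (intro allI)
  show "additive (\<lambda>x. \<phi> (y # us @ x # vs))" for us vs
    using slot_additiveD[OF assms, of "y # us" vs] by simp
qed

lemma additive_cut_sum: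
  "additive f \<Longrightarrow> f (cut_sum K xs) = cut_sum (\<lambda>u v. f (K u v)) xs"
  by (simp add: cut_sum_def additive.sum)

text \<open>
  The bookkeeping of the induction step of the next lemma: \<open>k\<close> and \<open>k'\<close> are the terms with two
  disjoint insertions, which occur in both composites.
\<close>

lemma commutator_cancel:
  fixes p :: "'w::ab_group_add"
  assumes "p = h + k' + r + x" "q = h' + k + r' + y" "h + r = c + k" "h' + r' = c' + k'"
  shows "p - q = c - c' + (x - y)"
proof -
  have h: "h = c + k - r" "h' = c' + k' - r'" using assms(3,4) by (simp_all add: algebra_simps)
  show ?thesis unfolding assms(1,2) h by (simp add: algebra_simps)
qed

text \<open>
  Applying two coderivations one after the other produces disjoint insertions and nested ones. The
  disjoint ones occur in both orders, with the same signs because \<open>g\<close> is even, and cancel; the nested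
  ones are the insertions of the composites.
\<close>

lemma coder_act_commutator:
  fixes g m :: "'x::ab_group_add list \<Rightarrow> 'x" and \<phi> :: "'x list \<Rightarrow> 'w::ab_group_add"
  assumes even: "\<And>u. u \<noteq> [] \<Longrightarrow> g (map \<sigma> u) = \<sigma> (g u)" and \<phi>: "slot_additive \<phi>"
  shows "coder_act id g (coder_act \<sigma> m \<phi>) xs - coder_act \<sigma> m (coder_act id g \<phi>) xs
     = coder_act \<sigma> (\<lambda>u. coder_act id g m u - coder_act \<sigma> m g u) \<phi> xs"
  using \<phi>
proof (induction xs arbitrary: \<phi>)
  case (Cons x xs)
  let ?H = "\<lambda>E \<psi>. cut_sum (\<lambda>u v. \<psi> (E u # v))"
  let ?a = "coder_act id g" and ?b = "coder_act \<sigma> m"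
  let ?c = "\<lambda>u. ?a m u - ?b g u"
  have head: "additive (\<lambda>y. \<phi> (y # v))" for v
    using slot_additiveD[OF Cons.prems, of "[]"] by simp
  \<comment> \<open>Expand both composites with the recursion: the outer operation meets the first letter or not.\<close>
  have ab: "?a (?b \<phi>) (x # xs)
      = ?H g (?H m \<phi>) (x # xs) + cut_sum (\<lambda>u v. ?b (\<lambda>ys. \<phi> (\<sigma> (g u) # ys)) v) (x # xs)
        + ?a (\<lambda>ys. ?H m \<phi> (x # ys)) xs + ?a (?b (\<lambda>ys. \<phi> (\<sigma> x # ys))) xs"
    by (simp add: coder_act_Cons[of id] coder_act_Cons[of \<sigma> m \<phi>] coder_act_add cut_sum_add algebra_simps)
  have ba: "?b (?a \<phi>) (x # xs)
      = ?H m (?H g \<phi>) (x # xs) + cut_sum (\<lambda>u v. ?a (\<lambda>ys. \<phi> (m u # ys)) v) (x # xs)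
        + ?b (\<lambda>ys. ?H g \<phi> (\<sigma> x # ys)) xs + ?b (?a (\<lambda>ys. \<phi> (\<sigma> x # ys))) xs"
    by (simp add: coder_act_Cons[of \<sigma>] coder_act_Cons[of id g \<phi>] coder_act_add cut_sum_add algebra_simps)
  have "?H g (?H m \<phi>) (x # xs) + ?a (\<lambda>ys. ?H m \<phi> (x # ys)) xs = ?a (?H m \<phi>) (x # xs)"
    by (simp add: coder_act_Cons)
  also have "\<dots> = cut_sum (\<lambda>u v. ?a (\<lambda>w. \<phi> (m w # v)) u + ?a (\<lambda>ys. \<phi> (m u # ys)) v) (x # xs)"
    by (simp add: coder_act_cut_sum)
  finally have aH: "?H g (?H m \<phi>) (x # xs) + ?a (\<lambda>ys. ?H m \<phi> (x # ys)) xs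
      = cut_sum (\<lambda>u v. \<phi> (?a m u # v)) (x # xs) + cut_sum (\<lambda>u v. ?a (\<lambda>ys. \<phi> (m u # ys)) v) (x # xs)"
    by (simp add: cut_sum_add coder_act_def[of id g m] additive.sum[OF head] coder_act_def[of id g "\<lambda>w. \<phi> (m w # _)"] case_prod_unfold)
  have "?H m (?H g \<phi>) (x # xs) + ?b (\<lambda>ys. ?H g \<phi> (\<sigma> x # ys)) xs = ?b (?H g \<phi>) (x # xs)"
    by (simp add: coder_act_Cons)
  also have "\<dots> = cut_sum (\<lambda>u v. ?b (\<lambda>w. \<phi> (g w # v)) u + ?b (\<lambda>ys. \<phi> (g (map \<sigma> u) # ys)) v) (x # xs)"
    by (simp add: coder_act_cut_sum)
  also have "\<dots> = cut_sum (\<lambda>u v. ?b (\<lambda>w. \<phi> (g w # v)) u + ?b (\<lambda>ys. \<phi> (\<sigma> (g u) # ys)) v) (x # xs)"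
    by (rule cut_sum_cong) (simp add: even)
  finally have bH: "?H m (?H g \<phi>) (x # xs) + ?b (\<lambda>ys. ?H g \<phi> (\<sigma> x # ys)) xs
      = cut_sum (\<lambda>u v. \<phi> (?b g u # v)) (x # xs) + cut_sum (\<lambda>u v. ?b (\<lambda>ys. \<phi> (\<sigma> (g u) # ys)) v) (x # xs)"
    by (simp add: cut_sum_add coder_act_def[of \<sigma> m g] additive.sum[OF head] coder_act_def[of \<sigma> m "\<lambda>w. \<phi> (g w # _)"] case_prod_unfold)
  have c: "coder_act \<sigma> ?c \<phi> (x # xs) = cut_sum (\<lambda>u v. \<phi> (?a m u # v)) (x # xs)
      - cut_sum (\<lambda>u v. \<phi> (?b g u # v)) (x # xs) + coder_act \<sigma> ?c (\<lambda>ys. \<phi> (\<sigma> x # ys)) xs"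
    by (simp add: coder_act_Cons additive.diff[OF head] cut_sum_def sum_subtractf)
  have IH: "?a (?b (\<lambda>ys. \<phi> (\<sigma> x # ys))) xs - ?b (?a (\<lambda>ys. \<phi> (\<sigma> x # ys))) xs
      = coder_act \<sigma> ?c (\<lambda>ys. \<phi> (\<sigma> x # ys)) xs"
    by (rule Cons.IH) (rule slot_additive_Cons[OF Cons.prems])
  show ?case
    unfolding c IH[symmetric] by (rule commutator_cancel[OF ab ba aH bH])
qed simp

text \<open>
  If \<open>F' = F\<close> and \<open>\<mu>\<close> is quadratic, this is the composite of \<open>\<mu>\<close> with the coalgebra map that
  has the components \<open>F\<close>. Cuts with an empty second factor are discarded.
\<close>

definition bilin_op ::
  "('x list \<Rightarrow> 'w::ab_group_add) \<Rightarrow> ('x list \<Rightarrow> 'x) \<Rightarrow> ('x list \<Rightarrow> 'x) \<Rightarrow> 'x list \<Rightarrow> 'w" where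
  "bilin_op \<mu> F F' = cut_sum (\<lambda>u v. if v = [] then 0 else \<mu> [F u, F' v])"

lemma coder_act_bilin_op:
  fixes \<mu> :: "'x::ab_group_add list \<Rightarrow> 'w::ab_group_add"
  assumes \<mu>: "slot_additive \<mu>"
  shows "coder_act id g (bilin_op \<mu> F F') xs
     = bilin_op \<mu> (coder_act id g F) F' xs + bilin_op \<mu> F (coder_act id g F') xs"
proof -
  have l: "additive (\<lambda>x. \<mu> [x, y])" and r: "additive (\<lambda>x. \<mu> [y, x])" for y
    using slot_additiveD[OF \<mu>, of "[]" "[y]"] slot_additiveD[OF \<mu>, of "[y]" "[]"] by simp_all
  have "coder_act id g (\<lambda>w. if v = [] then 0 else \<mu> [F w, F' v]) u
      = (if v = [] then 0 else \<mu> [coder_act id g F u, F' v])" for u v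
    by (simp add: coder_act_def additive.sum[OF l] case_prod_unfold)
  moreover have "coder_act id g (\<lambda>v. if v = [] then 0 else \<mu> [F u, F' v]) v
      = (if v = [] then 0 else \<mu> [F u, coder_act id g F' v])" for u v
    by (simp add: coder_act_def additive.sum[OF r] case_prod_unfold insert_at_def)
  ultimately show ?thesis
    by (simp add: bilin_op_def coder_act_cut_sum cut_sum_add[symmetric] if_distrib cong: if_cong)
      (rule cut_sum_cong, simp)
qed

section \<open>Graded spaces and homogeneous multilinear maps\<close>

text \<open>
  Multiples by natural numbers. Divisibility in a module of characteristic zero is expressed by them,
  since the type of values carries no scalars.
\<close>

primrec nat_times :: "nat \<Rightarrow> 'w::ab_group_add \<Rightarrow> 'w" where
  "nat_times 0 x = 0"
| "nat_times (Suc n) x = x + nat_times n x"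

lemma nat_times_add: "nat_times (a + b) x = nat_times a x + nat_times b x"
  by (induction a) (simp_all add: algebra_simps)

lemma additive_nat_times: "additive (nat_times n)"
proof
  show "nat_times n (x + y) = nat_times n x + nat_times n y" for x y :: 'a
    by (induction n) (simp_all add: algebra_simps)
qed

lemma additive_nat_times_commute: "additive k \<Longrightarrow> k (nat_times n x) = nat_times n (k x)"
  by (induction n) (simp_all add: additive.zero additive.add)

lemma nat_times_0_right [simp]: "nat_times n 0 = 0"
  by (simp add: additive.zero[OF additive_nat_times])

definition parity_sign :: "int \<Rightarrow> 'w::ab_group_add \<Rightarrow> 'w" where
  "parity_sign p x = (if even p then x else - x)"

lemma parity_sign_parity_sign [simp]: "parity_sign p (parity_sign q x) = parity_sign (p + q) x"
  by (simp add: parity_sign_def)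

lemma parity_sign_0_right [simp]: "parity_sign p 0 = 0"
  by (simp add: parity_sign_def)

lemma parity_sign_cong: "even (p - q) \<Longrightarrow> parity_sign p x = parity_sign q x"
  by (auto simp: parity_sign_def)

lemma parity_sign_additive: "additive k \<Longrightarrow> k (parity_sign p x) = parity_sign p (k x)"
  by (simp add: parity_sign_def additive.minus)

lemma additive_parity_sign: "additive (parity_sign p)"
  by unfold_locales (simp add: parity_sign_def)

lemma additive_compose: "additive k \<Longrightarrow> additive k' \<Longrightarrow> additive (\<lambda>x. k (k' x))"
  by (simp add: additive_def)

lemma additive_diff: "additive k \<Longrightarrow> additive k' \<Longrightarrow> additive (\<lambda>x. k x - k' x)"
  by (simp add: additive_def)

text \<open>
  A graded module over a ring of scalars, placed inside a larger abelian group \<open>'v\<close>. The set \<open>G n\<close> is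
  the part of degree \<open>n\<close>, \<open>\<tau> p\<close> multiplies degree \<open>n\<close> with $(-1)^{pn}$, and \<open>S\<close> contains the
  multiplications with scalars. All these operators are defined on the whole type but factor through
  a projection onto the graded module, which is \<open>\<tau> 0\<close>.
\<close>

locale graded_space =
  fixes G :: "int \<Rightarrow> 'v::ab_group_add set" and \<tau> :: "int \<Rightarrow> 'v \<Rightarrow> 'v" and S :: "('v \<Rightarrow> 'v) set"
  assumes G_zero: "0 \<in> G n"
    and G_add: "x \<in> G n \<Longrightarrow> y \<in> G n \<Longrightarrow> x + y \<in> G n"
    and G_minus: "x \<in> G n \<Longrightarrow> - x \<in> G n"
    and \<tau>_additive: "additive (\<tau> p)"
    and \<tau>_G: "x \<in> G n \<Longrightarrow> \<tau> p x = parity_sign (p * n) x"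
    and \<tau>_absorb: "\<tau> p (\<tau> 0 x) = \<tau> p x"
    and G_span: "additive k \<Longrightarrow> (\<And>n x. x \<in> G n \<Longrightarrow> k x = 0) \<Longrightarrow> k (\<tau> 0 x) = (0::'v)"
    and S_additive: "\<rho> \<in> S \<Longrightarrow> additive \<rho>"
    and S_G: "\<rho> \<in> S \<Longrightarrow> x \<in> G n \<Longrightarrow> \<rho> x \<in> G n"
    and S_absorb: "\<rho> \<in> S \<Longrightarrow> \<rho> (\<tau> 0 x) = \<rho> x" "\<rho> \<in> S \<Longrightarrow> \<tau> 0 (\<rho> x) = \<rho> x"
begin

lemma G_sum: "(\<And>i. i \<in> I \<Longrightarrow> f i \<in> G n) \<Longrightarrow> sum f I \<in> G n"
  by (induction I rule: infinite_finite_induct) (auto simp: G_zero G_add)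

lemma G_parity_sign: "x \<in> G n \<Longrightarrow> parity_sign p x \<in> G n"
  by (simp add: parity_sign_def G_minus)

lemma homogeneous_ext:
  assumes "additive k" "additive k'" "\<And>n x. x \<in> G n \<Longrightarrow> k x = k' x"
  shows "k (\<tau> 0 x) = (k' (\<tau> 0 x) :: 'v)"
proof -
  from G_span[OF additive_diff[OF assms(1,2)], of x] assms(3) show ?thesis by simp
qed

lemma \<tau>_\<tau> [simp]: "\<tau> p (\<tau> q x) = \<tau> (p + q) x"
proof -
  have "\<tau> p (\<tau> q (\<tau> 0 x)) = \<tau> (p + q) (\<tau> 0 x)"
    by (rule homogeneous_ext[where k = "\<lambda>x. \<tau> p (\<tau> q x)"])
      (auto intro: additive_compose \<tau>_additive
        simp: \<tau>_G parity_sign_additive[OF \<tau>_additive] algebra_simps)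
  then show ?thesis by (simp add: \<tau>_absorb)
qed

lemma \<tau>_S: "\<rho> \<in> S \<Longrightarrow> \<tau> p (\<rho> x) = \<rho> (\<tau> p x)"
proof -
  assume \<rho>: "\<rho> \<in> S"
  have "\<tau> p (\<rho> (\<tau> 0 x)) = \<rho> (\<tau> p (\<tau> 0 x))"
    by (rule homogeneous_ext[where k = "\<lambda>x. \<tau> p (\<rho> x)" and k' = "\<lambda>x. \<rho> (\<tau> p x)"])
      (auto intro: additive_compose \<tau>_additive S_additive[OF \<rho>]
        simp: \<tau>_G S_G[OF \<rho>] parity_sign_additive[OF S_additive[OF \<rho>]])
  then show ?thesis by (simp add: S_absorb[OF \<rho>])
qed

text \<open>
  The operators that a slot of a multilinear map may define. They form a ring, so that multilinearity
  of a composite is the closure of \<open>K\<close> under sums and composition.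
\<close>

definition K :: "('v \<Rightarrow> 'v) set" where
  "K = {k. additive k \<and> (\<forall>\<rho>\<in>S. \<forall>x. k (\<rho> x) = \<rho> (k x)) \<and> (\<forall>x. k (\<tau> 0 x) = \<tau> 0 (k x))}"

lemma K_additive: "k \<in> K \<Longrightarrow> additive k"
  by (simp add: K_def)

lemma K_\<tau>0: "k \<in> K \<Longrightarrow> k (\<tau> 0 x) = \<tau> 0 (k x)"
  by (simp add: K_def)

lemma K_\<tau>: "\<tau> p \<in> K"
  by (simp add: K_def \<tau>_additive \<tau>_S)

lemma K_comp: "k \<in> K \<Longrightarrow> k' \<in> K \<Longrightarrow> (\<lambda>x. k (k' x)) \<in> K"
  by (auto simp: K_def intro: additive_compose)

lemma K_zero: "(\<lambda>x. 0) \<in> K"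
  by (simp add: K_def additive_def additive.zero[OF S_additive] additive.zero[OF \<tau>_additive])

lemma K_id: "id \<in> K" "(\<lambda>x. x) \<in> K"
  by (simp_all add: K_def additive_def)

lemma K_add: "k \<in> K \<Longrightarrow> k' \<in> K \<Longrightarrow> (\<lambda>x. k x + k' x) \<in> K"
  by (auto simp: K_def additive_def additive.add[OF S_additive] additive.add[OF \<tau>_additive])

lemma K_minus: "k \<in> K \<Longrightarrow> (\<lambda>x. - k x) \<in> K"
  by (auto simp: K_def additive_def additive.minus[OF S_additive] additive.minus[OF \<tau>_additive])

lemma K_sum: "(\<And>i. i \<in> I \<Longrightarrow> k i \<in> K) \<Longrightarrow> (\<lambda>x. \<Sum>i\<in>I. k i x) \<in> K"
  by (induction I rule: infinite_finite_induct) (auto simp: K_zero K_add)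

definition slot_linear :: "('v list \<Rightarrow> 'v) \<Rightarrow> bool" where
  "slot_linear f \<longleftrightarrow> (\<forall>us vs. (\<lambda>x. f (us @ x # vs)) \<in> K)"

lemma slot_linearD: "slot_linear f \<Longrightarrow> (\<lambda>x. f (us @ x # vs)) \<in> K"
  by (simp add: slot_linear_def)

lemma slot_linear_head: "slot_linear f \<Longrightarrow> (\<lambda>x. f (x # vs)) \<in> K"
  using slot_linearD[of f "[]" vs] by simp

lemma slot_linear_Cons: "slot_linear f \<Longrightarrow> slot_linear (\<lambda>ys. f (y # ys))"
  unfolding slot_linear_def
proof (intro allI)
  fix us vs assume "\<forall>us vs. (\<lambda>x. f (us @ x # vs)) \<in> K"
  from this[THEN spec, THEN spec, of "y # us" vs] show "(\<lambda>x. f (y # us @ x # vs)) \<in> K" by simp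
qed

lemma slot_linear_slot_additive: "slot_linear f \<Longrightarrow> slot_additive f"
  by (auto simp: slot_linear_def slot_additive_def intro: K_additive)

lemma slot_zero: "slot_linear f \<Longrightarrow> f (us @ 0 # vs) = 0"
  by (rule additive.zero[OF K_additive[OF slot_linearD]])

lemma K_cut_sum:
  assumes "\<And>us vs v. (\<lambda>x. L (us @ x # vs) v) \<in> K" "\<And>u us vs. (\<lambda>x. L u (us @ x # vs)) \<in> K"
  shows "(\<lambda>x. cut_sum L (us @ x # vs)) \<in> K"
  using assms
proof (induction us arbitrary: L)
  case Nil
  have 1: "(\<lambda>x. L (x # u) v) \<in> K" for u v
    using Nil.prems(1)[of "[]"] by simp
  show ?case
    unfolding append_Nil cut_sum_Cons cut_sum_def[of "\<lambda>u. L (_ # u)"]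
    by (intro K_add K_sum 1)
next
  case (Cons y us)
  have 1: "(\<lambda>x. L (y # us @ x # vs) v) \<in> K" for us vs v
    using Cons.prems(1)[of "y # us"] by simp
  show ?case
    unfolding append_Cons cut_sum_Cons
    by (intro K_add Cons.IH[of "\<lambda>u. L (y # u)"] Cons.prems(2) 1)
qed

text \<open>
  The slot in question lies before, inside or behind the argument of the inserted operation; the
  recursion of \<open>coder_act\<close> over the letters before the slot separates these cases.
\<close>

lemma slot_linear_coder_act:
  assumes E: "slot_linear E" and \<phi>: "slot_linear \<phi>" and \<sigma>: "\<sigma> \<in> K"
  shows "slot_linear (coder_act \<sigma> E \<phi>)"
proof -
  have cut: "(\<lambda>x. cut_sum (\<lambda>u v. \<phi> (E u # v)) (us @ x # vs)) \<in> K"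
    if \<phi>: "slot_linear \<phi>" for \<phi> us vs
    using K_comp[OF slot_linear_head[OF \<phi>] slot_linearD[OF E]]
      slot_linearD[OF slot_linear_Cons[OF \<phi>]]
    by (intro K_cut_sum) auto
  have "(\<lambda>x. coder_act \<sigma> E \<phi> (us @ x # vs)) \<in> K" for us vs
    using \<phi>
  proof (induction us arbitrary: \<phi>)
    case Nil
    show ?case
      unfolding append_Nil coder_act_Cons coder_act_def[of _ _ "\<lambda>ys. \<phi> (\<sigma> _ # ys)"] case_prod_unfold
      using cut[OF Nil, of "[]"] by (intro K_add K_sum K_comp[OF slot_linear_head[OF Nil] \<sigma>]) simp
  next
    case (Cons y us)
    show ?case
      unfolding append_Cons coder_act_Cons
      using cut[OF Cons.prems, of "y # us"] by (intro K_add Cons.IH[OF slot_linear_Cons[OF Cons.prems]]) simp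
  qed
  then show ?thesis by (simp add: slot_linear_def)
qed

lemma slot_linear_bilin_op:
  assumes \<mu>: "slot_linear \<mu>" and F: "slot_linear F" "slot_linear F'"
  shows "slot_linear (bilin_op \<mu> F F')"
proof -
  have l: "(\<lambda>x. \<mu> [x, y]) \<in> K" and r: "(\<lambda>x. \<mu> [y, x]) \<in> K" for y
    using slot_linearD[OF \<mu>, of "[]" "[y]"] slot_linearD[OF \<mu>, of "[y]" "[]"] by simp_all
  have "(\<lambda>x. if v = [] then 0 else \<mu> [F (us @ x # vs), F' v]) \<in> K" for us vs v
    using K_comp[OF l slot_linearD[OF F(1)]] K_zero by (cases "v = []") simp_all
  moreover have "(\<lambda>x. if us @ x # vs = [] then 0 else \<mu> [F u, F' (us @ x # vs)]) \<in> K" for u us vs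
    using K_comp[OF r slot_linearD[OF F(2)]] by simp
  ultimately show ?thesis
    unfolding slot_linear_def bilin_op_def by (intro allI K_cut_sum)
qed

definition homogeneous :: "'v list \<Rightarrow> int list \<Rightarrow> bool" where
  "homogeneous xs ds \<longleftrightarrow> list_all2 (\<lambda>x d. x \<in> G d) xs ds"

text \<open>
  Homogeneous multilinear maps, the map of arity \<open>i\<close> having degree \<open>p i\<close>. They take values in the
  graded module inside \<open>'v\<close>. The value at the empty word is fixed to be zero, which turns identities
  on nonempty words into equations of functions.
\<close>

definition mmap :: "(nat \<Rightarrow> int) \<Rightarrow> ('v list \<Rightarrow> 'v) \<Rightarrow> bool" where
  "mmap p f \<longleftrightarrow> f [] = 0 \<and> slot_linear f \<and> (\<forall>xs. \<tau> 0 (f xs) = f xs) \<and>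
     (\<forall>xs ds. xs \<noteq> [] \<longrightarrow> homogeneous xs ds \<longrightarrow> f xs \<in> G (sum_list ds + p (length xs)))"

text \<open>
  In the grading of $A[1]$ all components of a coderivation of degree \<open>q\<close> have degree \<open>q\<close>; this is
  degree \<open>q + 1 - i\<close> in arity \<open>i\<close> for the grading of \<open>A\<close>.
\<close>

abbreviation cochain :: "int \<Rightarrow> ('v list \<Rightarrow> 'v) \<Rightarrow> bool" where
  "cochain q \<equiv> mmap (\<lambda>i. q + 1 - int i)"

lemma mmap_slot_linear: "mmap p f \<Longrightarrow> slot_linear f"
  and mmap_Nil: "mmap p f \<Longrightarrow> f [] = 0"
  and mmap_\<tau>0: "mmap p f \<Longrightarrow> \<tau> 0 (f xs) = f xs"
  and mmap_G: "mmap p f \<Longrightarrow> xs \<noteq> [] \<Longrightarrow> homogeneous xs ds \<Longrightarrow> f xs \<in> G (sum_list ds + p (length xs))"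
  by (simp_all add: mmap_def)

lemma mmap_slot_additive: "mmap p f \<Longrightarrow> slot_additive f"
  by (simp add: mmap_slot_linear slot_linear_slot_additive)

lemma mmap_absorb:
  assumes "mmap p f"
  shows "f (us @ map (\<tau> 0) xs @ vs) = f (us @ xs @ vs)"
proof (induction xs arbitrary: us)
  case (Cons x xs)
  have "f (us @ \<tau> 0 x # map (\<tau> 0) xs @ vs) = f (us @ x # map (\<tau> 0) xs @ vs)"
    using K_\<tau>0[OF slot_linearD[OF mmap_slot_linear[OF assms], of us "map (\<tau> 0) xs @ vs"]]
    by (simp add: mmap_\<tau>0[OF assms])
  also have "\<dots> = f (us @ x # xs @ vs)" using Cons.IH[of "us @ [x]"] by simp
  finally show ?case by simp
qed simp

lemma mmap_absorb_map: "mmap p f \<Longrightarrow> f (map (\<tau> 0) xs) = f xs"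
  using mmap_absorb[of p f "[]" xs "[]"] by simp

lemma mmap_add: "mmap p f \<Longrightarrow> mmap p f' \<Longrightarrow> mmap p (\<lambda>xs. f xs + f' xs)"
  by (auto simp: mmap_def slot_linear_def K_add additive.add[OF \<tau>_additive] G_add)

lemma mmap_minus: "mmap p f \<Longrightarrow> mmap p (\<lambda>xs. - f xs)"
  by (auto simp: mmap_def slot_linear_def K_minus additive.minus[OF \<tau>_additive] G_minus)

lemma mmap_diff: "mmap p f \<Longrightarrow> mmap p f' \<Longrightarrow> mmap p (\<lambda>xs. f xs - f' xs)"
  using mmap_add[of p f "\<lambda>xs. - f' xs"] mmap_minus[of p f'] by simp

lemma mmap_zero: "mmap p (\<lambda>xs. 0)"
  by (simp add: mmap_def slot_linear_def K_zero additive.zero[OF \<tau>_additive] G_zero)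

lemma mmap_sum: "(\<And>i. i \<in> I \<Longrightarrow> mmap p (f i)) \<Longrightarrow> mmap p (\<lambda>xs. \<Sum>i\<in>I. f i xs)"
  by (induction I rule: infinite_finite_induct) (auto simp: mmap_zero mmap_add)

lemma mmap_nat_times: "mmap p f \<Longrightarrow> mmap p (\<lambda>xs. nat_times j (f xs))"
  by (induction j) (simp_all add: mmap_zero mmap_add)

lemma mmap_comp:
  assumes "mmap p f" "k \<in> K" "\<And>n x. x \<in> G n \<Longrightarrow> k x \<in> G n"
  shows "mmap p (\<lambda>xs. k (f xs))"
  using assms by (auto simp: mmap_def slot_linear_def K_comp[OF assms(2)] additive.zero[OF K_additive] K_\<tau>0[symmetric])

lemma homogeneous_append: "homogeneous xs ds \<Longrightarrow> homogeneous ys es \<Longrightarrow> homogeneous (xs @ ys) (ds @ es)"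
  by (simp add: homogeneous_def list_all2_appendI)

lemma homogeneous_Cons [simp]: "homogeneous (x # xs) (d # ds) \<longleftrightarrow> x \<in> G d \<and> homogeneous xs ds"
  by (simp add: homogeneous_def)

lemma homogeneous_Nil [simp]: "homogeneous [] []"
  by (simp add: homogeneous_def)

lemma mmap_coder_act:
  assumes \<phi>: "cochain a \<phi>" and E: "cochain b E" and \<sigma>: "\<sigma> \<in> K" "\<And>n x. x \<in> G n \<Longrightarrow> \<sigma> x \<in> G n"
  shows "cochain (a + b) (coder_act \<sigma> E \<phi>)"
  unfolding mmap_def
proof (intro conjI allI impI)
  show "slot_linear (coder_act \<sigma> E \<phi>)"
    by (intro slot_linear_coder_act mmap_slot_linear[OF \<phi>] mmap_slot_linear[OF E] \<sigma>)
  show "\<tau> 0 (coder_act \<sigma> E \<phi> xs) = coder_act \<sigma> E \<phi> xs" for xs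
    by (simp add: coder_act_def additive.sum[OF \<tau>_additive] mmap_\<tau>0[OF \<phi>] case_prod_unfold)
  show "coder_act \<sigma> E \<phi> xs \<in> G (sum_list ds + (a + b + 1 - int (length xs)))"
    if ne: "xs \<noteq> []" and hom: "homogeneous xs ds" for xs ds
    unfolding coder_act_def case_prod_unfold
  proof (rule G_sum)
    fix rs assume "rs \<in> splits (length xs)"
    then obtain r s where rs: "rs = (r, s)" "1 \<le> s" "r + s \<le> length xs" by (auto simp: splits_def)
    let ?mid = "take s (drop r xs)" and ?dmid = "take s (drop r ds)"
    have "homogeneous ?mid ?dmid" "homogeneous (take r xs) (take r ds)"
      "homogeneous (drop (r + s) xs) (drop (r + s) ds)"
      using hom unfolding homogeneous_def by (auto intro: list_all2_takeI list_all2_dropI)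
    moreover have "homogeneous (map \<sigma> (take r xs)) (take r ds)"
      using \<open>homogeneous (take r xs) (take r ds)\<close> unfolding homogeneous_def list_all2_map1
      by (rule list_all2_mono) (simp add: \<sigma>(2))
    moreover have "E ?mid \<in> G (sum_list ?dmid + (b + 1 - int s))"
      using mmap_G[OF E _ \<open>homogeneous ?mid ?dmid\<close>] rs by simp
    ultimately have "homogeneous (insert_at \<sigma> r s E xs)
        (take r ds @ (sum_list ?dmid + (b + 1 - int s)) # drop (r + s) ds)"
      unfolding insert_at_def by (intro homogeneous_append) simp_all
    from mmap_G[OF \<phi> _ this]
    have "\<phi> (insert_at \<sigma> r s E xs) \<in> G (sum_list (take r ds) + (sum_list ?dmid + (b + 1 - int s))
        + sum_list (drop (r + s) ds) + (a + 1 - int (length (insert_at \<sigma> r s E xs))))"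
      by (simp add: insert_at_def add.assoc)
    moreover have "sum_list (take r ds) + sum_list ?dmid + sum_list (drop (r + s) ds) = sum_list ds"
      by (metis append_take_drop_id drop_drop add.commute sum_list_append add.assoc)
    moreover have "length (insert_at \<sigma> r s E xs) = length xs - s + 1"
      using rs by (simp add: insert_at_def)
    ultimately show "\<phi> (insert_at \<sigma> (fst rs) (snd rs) E xs) \<in> G (sum_list ds + (a + b + 1 - int (length xs)))"
      using rs by (simp add: algebra_simps of_nat_diff)
  qed
qed simp

text \<open>
  The letters of a word are replaced by homogeneous ones from left to right; each step is an instance
  of \<open>G_span\<close> in one slot.
\<close>

lemma homogeneous_words_span:
  assumes "slot_additive f" "\<And>xs ds. xs \<noteq> [] \<Longrightarrow> homogeneous xs ds \<Longrightarrow> f xs = (0::'v)" "xs \<noteq> []"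
  shows "f (map (\<tau> 0) xs) = 0"
proof -
  have "f (hs @ map (\<tau> 0) xs) = 0" if "homogeneous hs ds" "hs @ xs \<noteq> []" for hs ds
    using that
  proof (induction xs arbitrary: hs ds)
    case Nil then show ?case using assms(2) by simp
  next
    case (Cons x xs)
    have "f (hs @ y # map (\<tau> 0) xs) = 0" if "y \<in> G n" for y n
      using Cons.IH[of "hs @ [y]" "ds @ [n]"] Cons.prems(1) that by (simp add: homogeneous_append)
    then show ?case
      using G_span[OF slot_additiveD[OF assms(1), of hs "map (\<tau> 0) xs"]] by simp
  qed
  from this[of "[]" "[]"] show ?thesis using assms(3) by simp
qed

lemma slot_additive_map:
  assumes "slot_additive f" "additive k"
  shows "slot_additive (\<lambda>xs. f (map k xs))"
  unfolding slot_additive_def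
  using additive_compose[OF slot_additiveD[OF assms(1)] assms(2)] by simp

text \<open>
  On homogeneous words both sides multiply the value with signs given by the degrees; multilinearity
  extends the equation to all words.
\<close>

lemma mmap_map_\<tau>:
  assumes f: "mmap p f"
  shows "f (map (\<tau> a) xs) = parity_sign (a * p (length xs)) (\<tau> a (f xs))"
proof (cases "xs = []")
  case False
  let ?\<delta> = "\<lambda>xs. f (map (\<tau> a) xs) - parity_sign (a * p (length xs)) (\<tau> a (f xs))"
  have 1: "f (us @ map (\<tau> a) xs) = parity_sign (a * sum_list ds) (f (us @ xs))"
    if "homogeneous xs ds" for us xs ds
    using that
  proof (induction xs arbitrary: us ds)
    case Nil then show ?case by (simp add: homogeneous_def parity_sign_def)
  next
    case (Cons x xs)
    then obtain d ds' where ds: "ds = d # ds'" "x \<in> G d" "homogeneous xs ds'"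
      by (cases ds) (auto simp: homogeneous_def)
    have "f (us @ \<tau> a x # map (\<tau> a) xs) = parity_sign (a * d) (f (us @ x # map (\<tau> a) xs))"
      by (simp add: \<tau>_G[OF ds(2)] parity_sign_additive[OF slot_additiveD[OF mmap_slot_additive[OF f]]])
    also have "\<dots> = parity_sign (a * d) (parity_sign (a * sum_list ds') (f (us @ x # xs)))"
      using Cons.IH[OF ds(3), of "us @ [x]"] by simp
    finally show ?case by (simp add: ds algebra_simps)
  qed
  have hom: "?\<delta> xs = 0" if "xs \<noteq> []" "homogeneous xs ds" for xs ds
    using 1[OF that(2), of "[]"] mmap_G[OF f that] by (simp add: \<tau>_G algebra_simps parity_sign_def)
  have add: "slot_additive ?\<delta>"
    unfolding slot_additive_def
  proof (intro allI additive_diff)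
    fix us vs
    show "additive (\<lambda>x. f (map (\<tau> a) (us @ x # vs)))"
      by (rule slot_additiveD[OF slot_additive_map[OF mmap_slot_additive[OF f] \<tau>_additive]])
    show "additive (\<lambda>x. parity_sign (a * p (length (us @ x # vs))) (\<tau> a (f (us @ x # vs))))"
      by (simp add: additive_compose[OF additive_parity_sign additive_compose[OF \<tau>_additive]]
          slot_additiveD[OF mmap_slot_additive[OF f]])
  qed
  have "?\<delta> (map (\<tau> 0) xs) = 0" by (rule homogeneous_words_span[OF add hom False])
  moreover have "map (\<tau> a) (map (\<tau> 0) xs) = map (\<tau> a) xs" by simp
  ultimately show ?thesis by (simp add: mmap_absorb_map[OF f] del: map_map)
qed (simp add: mmap_Nil[OF f] additive.zero[OF \<tau>_additive])

text \<open>
  The Koszul sign for passing an operation of degree one in $A[1]$, where degrees are lower by one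
  than in \<open>A\<close>.
\<close>

definition \<sigma> :: "'v \<Rightarrow> 'v" where "\<sigma> x = - \<tau> 1 x"

lemma \<sigma>_K: "\<sigma> \<in> K"
  unfolding \<sigma>_def[abs_def] by (intro K_minus K_\<tau>)

lemma \<sigma>_G: "x \<in> G n \<Longrightarrow> \<sigma> x \<in> G n"
  by (simp add: \<sigma>_def \<tau>_G G_minus G_parity_sign)

lemma slot_additive_map_minus:
  assumes "slot_additive f"
  shows "f (us @ map (\<lambda>x. - k x) xs @ vs) = parity_sign (int (length xs)) (f (us @ map k xs @ vs))"
proof (induction xs arbitrary: us)
  case Nil show ?case by (simp add: parity_sign_def)
next
  case (Cons x xs)
  show ?case
    using Cons.IH[of "us @ [- k x]"]
    by (simp add: additive.minus[OF slot_additiveD[OF assms], of us "k x"] parity_sign_def)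
qed

lemma cochain_0_even:
  assumes "cochain 0 g"
  shows "g (map \<sigma> u) = \<sigma> (g u)"
proof -
  have "g (map \<sigma> u) = parity_sign (int (length u)) (g (map (\<tau> 1) u))"
    using slot_additive_map_minus[OF mmap_slot_additive[OF assms], of "[]" "\<tau> 1" u "[]"]
    by (simp add: \<sigma>_def[abs_def])
  then show ?thesis
    by (simp add: mmap_map_\<tau>[OF assms] \<sigma>_def) (simp add: parity_sign_def)
qed

text \<open>
  The projection of the tensor coalgebra to its generators, that is, the identity morphism.
\<close>

definition unit_map :: "'v list \<Rightarrow> 'v" where
  "unit_map xs = (case xs of [x] \<Rightarrow> \<tau> 0 x | _ \<Rightarrow> 0)"

lemma unit_map_simps [simp]:
  "unit_map [] = 0" "unit_map [x] = \<tau> 0 x" "unit_map (x # y # zs) = 0"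
  by (simp_all add: unit_map_def)

lemma unit_map_eq_0: "length xs \<noteq> 1 \<Longrightarrow> unit_map xs = 0"
  by (auto simp: unit_map_def split: list.splits)

lemma unit_map_\<tau>0: "\<tau> 0 (unit_map xs) = unit_map xs"
  by (auto simp: unit_map_def additive.zero[OF \<tau>_additive] split: list.splits)

lemma cochain_unit_map: "cochain 0 unit_map"
  unfolding mmap_def
proof (intro conjI allI impI)
  have "(\<lambda>x. unit_map (us @ x # vs)) \<in> K" for us vs
  proof (cases "us = [] \<and> vs = []")
    case True then show ?thesis by (simp add: K_\<tau>)
  next
    case False then show ?thesis by (subst unit_map_eq_0) (auto simp: K_zero)
  qed
  then show "slot_linear unit_map" by (simp add: slot_linear_def)
  show "unit_map xs \<in> G (sum_list ds + (0 + 1 - int (length xs)))"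
    if "xs \<noteq> []" "homogeneous xs ds" for xs ds
  proof (cases "length xs = 1")
    case True
    then obtain x where "xs = [x]" by (auto simp: length_Suc_conv)
    moreover from this that obtain d where "ds = [d]" "x \<in> G d" by (auto simp: homogeneous_def list_all2_Cons1)
    ultimately show ?thesis by (simp add: \<tau>_G G_parity_sign)
  qed (simp add: unit_map_eq_0 G_zero)
qed (simp_all add: unit_map_\<tau>0)

lemma coder_act_unit_map: "coder_act \<theta> E unit_map xs = (if xs = [] then 0 else \<tau> 0 (E xs))"
proof (cases xs)
  case (Cons x ys)
  have "unit_map (\<theta> x # insert_at \<theta> r s E zs) = 0" for r s zs
    by (rule unit_map_eq_0) (simp add: insert_at_def)
  then have "coder_act \<theta> E (\<lambda>ys. unit_map (\<theta> x # ys)) ys = 0"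
    by (simp add: coder_act_def case_prod_unfold)
  moreover have "cut_sum (\<lambda>u v. unit_map (E u # v)) xs = \<tau> 0 (E xs)"
  proof -
    have "cut_sum (\<lambda>u v. unit_map (E u # v)) xs
        = (\<Sum>s=1..length xs. if s = length xs then \<tau> 0 (E xs) else 0)"
      unfolding cut_sum_def by (rule sum.cong) (auto intro!: unit_map_eq_0)
    then show ?thesis using Cons by (simp add: Suc_le_eq)
  qed
  ultimately show ?thesis using Cons by (simp add: coder_act_Cons)
qed simp

lemma bilin_op_unit_map:
  assumes \<mu>: "mmap p \<mu>" and quad: "\<And>xs. length xs \<noteq> 2 \<Longrightarrow> \<mu> xs = 0"
  shows "bilin_op \<mu> unit_map unit_map = \<mu>"
proof
  fix xs :: "'v list"
  have z: "\<mu> [0, y] = 0" "\<mu> [y, 0] = 0" for y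
    using slot_zero[OF mmap_slot_linear[OF \<mu>], of "[]"] slot_zero[OF mmap_slot_linear[OF \<mu>], of "[y]" "[]"]
    by simp_all
  consider "xs = []" | x where "xs = [x]" | x y where "xs = [x, y]" | "length xs \<ge> 3"
    by (cases xs rule: remdups_adj.cases) (auto simp: Suc_le_eq)
  then show "bilin_op \<mu> unit_map unit_map xs = \<mu> xs"
  proof cases
    case (3 x y)
    then show ?thesis
      using mmap_absorb_map[OF \<mu>, of "[x, y]"] by (simp add: bilin_op_def cut_sum_Cons z)
  next
    case 4
    have "bilin_op \<mu> unit_map unit_map xs = cut_sum (\<lambda>u v. 0) xs"
      unfolding bilin_op_def
    proof (rule cut_sum_cong)
      fix u v assume "u \<noteq> []" "xs = u @ v"
      show "(if v = [] then 0 else \<mu> [unit_map u, unit_map v]) = 0"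
      proof (cases "length u = 1")
        case True
        then have "unit_map v = 0" using 4 \<open>xs = u @ v\<close> by (intro unit_map_eq_0) auto
        then show ?thesis by (simp add: z)
      qed (simp add: unit_map_eq_0 z)
    qed
    then show ?thesis using 4 quad by (simp add: cut_sum_def)
  qed (simp_all add: bilin_op_def cut_sum_Cons quad mmap_Nil[OF \<mu>])
qed

end

section \<open>The differential equation for formality\<close>

lemma nat_times_Cauchy:
  fixes T :: "nat \<Rightarrow> nat \<Rightarrow> 'w::ab_group_add"
  shows "nat_times (Suc j) (\<Sum>a\<le>Suc j. T a (Suc j - a))
     = (\<Sum>a\<le>j. nat_times (Suc a) (T (Suc a) (j - a))) + (\<Sum>a\<le>j. nat_times (Suc (j - a)) (T a (Suc (j - a))))"
proof -
  have "nat_times (Suc j) (\<Sum>a\<le>Suc j. T a (Suc j - a))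
      = (\<Sum>a\<le>Suc j. nat_times a (T a (Suc j - a)) + nat_times (Suc j - a) (T a (Suc j - a)))"
    unfolding additive.sum[OF additive_nat_times]
    by (rule sum.cong) (auto simp: nat_times_add[symmetric] simp del: nat_times.simps)
  also have "\<dots> = (\<Sum>a\<le>Suc j. nat_times a (T a (Suc j - a))) + (\<Sum>a\<le>Suc j. nat_times (Suc j - a) (T a (Suc j - a)))"
    by (rule sum.distrib)
  also have "(\<Sum>a\<le>Suc j. nat_times a (T a (Suc j - a))) = (\<Sum>a\<le>j. nat_times (Suc a) (T (Suc a) (j - a)))"
    by (subst sum.atMost_Suc_shift) simp
  also have "(\<Sum>a\<le>Suc j. nat_times (Suc j - a) (T a (Suc j - a))) = (\<Sum>a\<le>j. nat_times (Suc (j - a)) (T a (Suc (j - a))))"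
    unfolding sum.atMost_Suc by (simp add: Suc_diff_le del: nat_times.simps(2) cong: sum.cong_simp)
  finally show ?thesis .
qed

text \<open>
  The two iterated sums run over the triples \<open>(b, c, d)\<close> with \<open>b + c + d = j\<close>. The products of three
  power series are compared with this lemma and the next one.
\<close>

lemma sum_triples_left:
  fixes f :: "nat \<Rightarrow> nat \<Rightarrow> nat \<Rightarrow> 'w::comm_monoid_add"
  shows "(\<Sum>a\<le>j. \<Sum>b\<le>a. f b (a - b) (j - a)) = (\<Sum>b\<le>j. \<Sum>c\<le>j - b. f b c (j - b - c))"
  unfolding sum.Sigma[OF finite_atMost ballI[OF finite_atMost]]
  by (rule sum.reindex_bij_witness[where j = "\<lambda>(a, b). (b, a - b)" and i = "\<lambda>(b, c). (b + c, b)"]) auto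

lemma sum_triples_right:
  fixes f :: "nat \<Rightarrow> nat \<Rightarrow> nat \<Rightarrow> 'w::comm_monoid_add"
  shows "(\<Sum>a\<le>j. \<Sum>b\<le>j - a. f b a (j - a - b)) = (\<Sum>b\<le>j. \<Sum>c\<le>j - b. f b c (j - b - c))"
  unfolding sum.Sigma[OF finite_atMost ballI[OF finite_atMost]]
  by (rule sum.reindex_bij_witness[where j = "\<lambda>(a, b). (b, a)" and i = "\<lambda>(b, c). (c, b)"])
    (auto simp: add.commute)

lemma slot_additive_insert_at:
  "slot_additive \<phi> \<Longrightarrow> additive (\<lambda>y. \<phi> (map \<sigma> (take r xs) @ y # drop (r + s) xs))"
  by (rule slot_additiveD)

lemma coder_act_op_sum:
  "slot_additive \<phi> \<Longrightarrow> coder_act \<sigma> (\<lambda>u. \<Sum>i\<in>I. E i u) \<phi> xs = (\<Sum>i\<in>I. coder_act \<sigma> (E i) \<phi> xs)"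
  by (simp add: coder_act_def insert_at_def case_prod_unfold sum.swap[of _ I]
      additive.sum[OF slot_additive_insert_at])

lemma coder_act_op_add:
  "slot_additive \<phi> \<Longrightarrow> coder_act \<sigma> (\<lambda>u. E u + E' u) \<phi> xs = coder_act \<sigma> E \<phi> xs + coder_act \<sigma> E' \<phi> xs"
  by (simp add: coder_act_def insert_at_def case_prod_unfold sum.distrib
      additive.add[OF slot_additive_insert_at])

lemma coder_act_op_diff:
  "slot_additive \<phi> \<Longrightarrow> coder_act \<sigma> (\<lambda>u. E u - E' u) \<phi> xs = coder_act \<sigma> E \<phi> xs - coder_act \<sigma> E' \<phi> xs"
  by (simp add: coder_act_def insert_at_def case_prod_unfold sum_subtractf
      additive.diff[OF slot_additive_insert_at])

lemma coder_act_op_zero: "slot_additive \<phi> \<Longrightarrow> coder_act \<sigma> (\<lambda>u. 0) \<phi> xs = 0"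
  by (simp add: coder_act_def insert_at_def case_prod_unfold
      additive.zero[OF slot_additive_insert_at])

lemma coder_act_op_nat_times:
  "slot_additive \<phi> \<Longrightarrow> coder_act \<sigma> (\<lambda>u. nat_times k (E u)) \<phi> xs = nat_times k (coder_act \<sigma> E \<phi> xs)"
  by (induction k) (simp_all add: coder_act_op_zero coder_act_op_add)

lemma coder_act_nat_times:
  "coder_act \<sigma> E (\<lambda>u. nat_times k (\<phi> u)) xs = nat_times k (coder_act \<sigma> E \<phi> xs)"
  by (simp add: coder_act_def case_prod_unfold additive.sum[OF additive_nat_times])

lemma bilin_op_map:
  assumes "additive k" "\<And>x y. \<mu>' [k' x, k'' y] = k (\<mu> [x, y])"
  shows "bilin_op \<mu>' (\<lambda>u. k' (F u)) (\<lambda>v. k'' (F' v)) xs = k (bilin_op \<mu> F F' xs)"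
  by (auto simp: bilin_op_def additive_cut_sum[OF assms(1)] assms(2) additive.zero[OF assms(1)]
      intro!: cut_sum_cong)

lemma bilin_op_nat_times_left:
  assumes "slot_additive \<mu>"
  shows "bilin_op \<mu> (\<lambda>u. nat_times k (F u)) F' xs = nat_times k (bilin_op \<mu> F F' xs)"
  using bilin_op_map[OF additive_nat_times, of \<mu> "nat_times k" "\<lambda>y. y" k \<mu>]
    additive_nat_times_commute[OF slot_additiveD[OF assms, of "[]" "[_]"]] by simp

lemma bilin_op_nat_times_right:
  assumes "slot_additive \<mu>"
  shows "bilin_op \<mu> F (\<lambda>u. nat_times k (F' u)) xs = nat_times k (bilin_op \<mu> F F' xs)"
  using bilin_op_map[OF additive_nat_times, of \<mu> "\<lambda>y. y" "nat_times k" k \<mu>]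
    additive_nat_times_commute[OF slot_additiveD[OF assms, of "[_]" "[]"]] by simp

lemma bilin_op_sum_left:
  assumes "slot_additive \<mu>"
  shows "bilin_op \<mu> (\<lambda>u. \<Sum>i\<in>I. F i u) F' xs = (\<Sum>i\<in>I. bilin_op \<mu> (F i) F' xs)"
proof -
  have "additive (\<lambda>x. \<mu> [x, y])" for y
    using slot_additiveD[OF assms, of "[]" "[y]"] by simp
  from additive.sum[OF this] show ?thesis
    unfolding bilin_op_def cut_sum_def by (subst sum.swap) (auto intro!: sum.cong)
qed

lemma bilin_op_sum_right:
  assumes "slot_additive \<mu>"
  shows "bilin_op \<mu> F (\<lambda>u. \<Sum>i\<in>I. F' i u) xs = (\<Sum>i\<in>I. bilin_op \<mu> F (F' i) xs)"
proof -
  have "additive (\<lambda>x. \<mu> [y, x])" for y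
    using slot_additiveD[OF assms, of "[y]" "[]"] by simp
  from additive.sum[OF this] show ?thesis
    unfolding bilin_op_def cut_sum_def by (subst sum.swap) (auto intro!: sum.cong)
qed

context graded_space
begin

text \<open>
  The coefficient of $h^j$ in $F \cdot M - M_0(F, F)$.
\<close>

definition formality_defect ::
  "(nat \<Rightarrow> 'v list \<Rightarrow> 'v) \<Rightarrow> (nat \<Rightarrow> 'v list \<Rightarrow> 'v) \<Rightarrow> nat \<Rightarrow> 'v list \<Rightarrow> 'v" where
  "formality_defect M F j = (\<lambda>xs. (\<Sum>a\<le>j. coder_act \<sigma> (M a) (F (j - a)) xs)
     - (\<Sum>a\<le>j. bilin_op (M 0) (F a) (F (j - a)) xs))"

definition bracket :: "('v list \<Rightarrow> 'v) \<Rightarrow> ('v list \<Rightarrow> 'v) \<Rightarrow> 'v list \<Rightarrow> 'v" where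
  "bracket m g xs = coder_act id g m xs - coder_act \<sigma> m g xs"

text \<open>
  The coefficient of $h^j$ in $\partial_h M - [M, g]$.
\<close>

definition kaledin_defect ::
  "(nat \<Rightarrow> 'v list \<Rightarrow> 'v) \<Rightarrow> (nat \<Rightarrow> 'v list \<Rightarrow> 'v) \<Rightarrow> nat \<Rightarrow> 'v list \<Rightarrow> 'v" where
  "kaledin_defect M g j = (\<lambda>xs. nat_times (Suc j) (M (Suc j) xs) - (\<Sum>a\<le>j. bracket (M (j - a)) (g a) xs))"

text \<open>
  By the product rule, $X' = F' \cdot M + F \cdot M' - M_0(F', F) - M_0(F, F')$. Substitute
  $F' = F \cdot g$ and $M' = Y + [M, g]$. The commutator formula turns $F \cdot [M, g]$ into
  $(F \cdot M) \cdot g - (F \cdot g) \cdot M$, and by the Leibniz rule the last two terms are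
  $M_0(F, F) \cdot g$.
\<close>

lemma formality_defect_derivative:
  assumes M: "\<And>a. cochain 1 (M a)" and F: "\<And>a. cochain 0 (F a)" and g: "\<And>a. cochain 0 (g a)"
    and ode: "\<And>j xs. nat_times (Suc j) (F (Suc j) xs) = (\<Sum>a\<le>j. coder_act id (g a) (F (j - a)) xs)"
  shows "nat_times (Suc j) (formality_defect M F (Suc j) xs)
     = (\<Sum>a\<le>j. coder_act id (g a) (formality_defect M F (j - a)) xs)
       + (\<Sum>a\<le>j. coder_act \<sigma> (kaledin_defect M g a) (F (j - a)) xs)"
proof -
  note F_add = mmap_slot_additive[OF F] and \<mu>_add = mmap_slot_additive[OF M[of 0]]
  define P where "P b c d = coder_act id (g b) (coder_act \<sigma> (M c) (F d)) xs" for b c d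
  define Q where "Q b c d = coder_act \<sigma> (M c) (coder_act id (g b) (F d)) xs" for b c d
  define L where "L b c d = bilin_op (M 0) (coder_act id (g b) (F c)) (F d) xs" for b c d
  define R where "R b c d = bilin_op (M 0) (F c) (coder_act id (g b) (F d)) xs" for b c d
  let ?Y = "\<Sum>a\<le>j. coder_act \<sigma> (kaledin_defect M g a) (F (j - a)) xs"
  have bracket_act: "coder_act \<sigma> (bracket (M c) (g b)) (F d) xs = P b c d - Q b c d" for b c d
    unfolding bracket_def[abs_def] P_def Q_def
    by (rule coder_act_commutator[symmetric]) (auto intro: cochain_0_even[OF g] F_add)
  have M_ode: "nat_times (Suc a) (coder_act \<sigma> (M (Suc a)) (F d) xs)
      = coder_act \<sigma> (kaledin_defect M g a) (F d) xs + (\<Sum>b\<le>a. P b (a - b) d - Q b (a - b) d)" for a d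
  proof -
    have "nat_times (Suc a) (coder_act \<sigma> (M (Suc a)) (F d) xs)
        = coder_act \<sigma> (\<lambda>u. nat_times (Suc a) (M (Suc a) u)) (F d) xs"
      by (simp only: coder_act_op_nat_times[OF F_add])
    also have "(\<lambda>u. nat_times (Suc a) (M (Suc a) u))
        = (\<lambda>u. kaledin_defect M g a u + (\<Sum>b\<le>a. bracket (M (a - b)) (g b) u))"
      by (simp add: kaledin_defect_def del: nat_times.simps)
    also have "coder_act \<sigma> \<dots> (F d) xs = coder_act \<sigma> (kaledin_defect M g a) (F d) xs
        + (\<Sum>b\<le>a. coder_act \<sigma> (bracket (M (a - b)) (g b)) (F d) xs)"
      by (simp only: coder_act_op_add[OF F_add] coder_act_op_sum[OF F_add])
    finally show ?thesis unfolding bracket_act .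
  qed
  have F_ode: "nat_times (Suc d) (coder_act \<sigma> (M a) (F (Suc d)) xs) = (\<Sum>b\<le>d. Q b a (d - b))" for a d
    unfolding coder_act_nat_times[symmetric] ode coder_act_sum Q_def ..
  have L_ode: "nat_times (Suc a) (bilin_op (M 0) (F (Suc a)) (F d) xs) = (\<Sum>b\<le>a. L b (a - b) d)" for a d
    unfolding bilin_op_nat_times_left[OF \<mu>_add, symmetric] ode bilin_op_sum_left[OF \<mu>_add] L_def ..
  have R_ode: "nat_times (Suc d) (bilin_op (M 0) (F a) (F (Suc d)) xs) = (\<Sum>b\<le>d. R b a (d - b))" for a d
    unfolding bilin_op_nat_times_right[OF \<mu>_add, symmetric] ode bilin_op_sum_right[OF \<mu>_add] R_def ..
  have LR: "L b c d + R b c d = coder_act id (g b) (bilin_op (M 0) (F c) (F d)) xs" for b c d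
    unfolding L_def R_def by (rule coder_act_bilin_op[OF \<mu>_add, symmetric])
  have "nat_times (Suc j) (formality_defect M F (Suc j) xs)
      = (?Y + (\<Sum>a\<le>j. \<Sum>b\<le>a. P b (a - b) (j - a) - Q b (a - b) (j - a))
          + (\<Sum>a\<le>j. \<Sum>b\<le>j - a. Q b a (j - a - b)))
        - ((\<Sum>a\<le>j. \<Sum>b\<le>a. L b (a - b) (j - a)) + (\<Sum>a\<le>j. \<Sum>b\<le>j - a. R b a (j - a - b)))"
    unfolding formality_defect_def additive.diff[OF additive_nat_times]
      nat_times_Cauchy[where T = "\<lambda>a d. coder_act \<sigma> (M a) (F d) xs"]
      nat_times_Cauchy[where T = "\<lambda>a d. bilin_op (M 0) (F a) (F d) xs"]
      M_ode F_ode L_ode R_ode by (simp only: sum.distrib)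
  also have "\<dots> = ?Y + (\<Sum>b\<le>j. \<Sum>c\<le>j - b. P b c (j - b - c))
      - (\<Sum>b\<le>j. \<Sum>c\<le>j - b. L b c (j - b - c) + R b c (j - b - c))"
    unfolding sum_triples_right[where f = Q] sum_triples_right[where f = R] sum_triples_left[where f = L]
      sum_triples_left[where f = "\<lambda>b c d. P b c d - Q b c d"]
    by (simp add: sum.distrib sum_subtractf)
  finally show ?thesis
    unfolding LR formality_defect_def P_def
    by (simp add: coder_act_diff coder_act_sum sum_subtractf)
qed

lemma cochain_coder_act_id:
  "cochain 0 g \<Longrightarrow> cochain a f \<Longrightarrow> cochain a (coder_act id g f)"
  using mmap_coder_act[of a f 0 g id] by (simp add: K_id)

lemma cochain_coder_act_\<sigma>:
  "cochain 1 m \<Longrightarrow> cochain a f \<Longrightarrow> cochain (a + 1) (coder_act \<sigma> m f)"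
  by (rule mmap_coder_act) (auto intro: \<sigma>_K \<sigma>_G)

lemma cochain_bracket: "cochain 1 m \<Longrightarrow> cochain 0 g \<Longrightarrow> cochain 1 (bracket m g)"
  unfolding bracket_def[abs_def]
  using cochain_coder_act_id[of g 1 m] cochain_coder_act_\<sigma>[of m 0 g] by (intro mmap_diff) simp_all

lemma mmap_bilin_op_\<tau>0:
  "mmap p \<mu> \<Longrightarrow> \<tau> 0 (bilin_op \<mu> F F' xs) = bilin_op \<mu> F F' xs"
  by (auto simp: bilin_op_def additive_cut_sum[OF \<tau>_additive] mmap_\<tau>0 additive.zero[OF \<tau>_additive]
      intro!: cut_sum_cong)

text \<open>
  The solution of $F' = F \cdot g$ with $F(0) = 1$, where \<open>\<rho> j\<close> divides by \<open>j + 1\<close>.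
\<close>

fun flow ::
  "(nat \<Rightarrow> 'v \<Rightarrow> 'v) \<Rightarrow> (nat \<Rightarrow> 'v list \<Rightarrow> 'v) \<Rightarrow> nat \<Rightarrow> 'v list \<Rightarrow> 'v" where
  "flow \<rho> g 0 = unit_map"
| "flow \<rho> g (Suc j) = (\<lambda>xs. \<rho> j (\<Sum>a\<le>j. coder_act id (g a) (flow \<rho> g (j - a)) xs))"

text \<open>
  The solution of $F' = F \cdot g$ for \<open>g\<close>, if $F(0) = 1$: the summand with index \<open>j\<close> in the
  coefficient of $h^j$ is \<open>g j\<close> itself.
\<close>

fun flow_field ::
  "(nat \<Rightarrow> 'v list \<Rightarrow> 'v) \<Rightarrow> nat \<Rightarrow> 'v list \<Rightarrow> 'v" where
  "flow_field F j = (\<lambda>xs. nat_times (Suc j) (F (Suc j) xs)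
     - (\<Sum>a<j. coder_act id (flow_field F a) (F (j - a)) xs))"

lemma flow_exists:
  assumes div: "\<And>j. \<exists>\<rho>\<in>K. (\<forall>n. \<forall>x\<in>G n. \<rho> x \<in> G n) \<and> (\<forall>x. nat_times (Suc j) (\<rho> x) = \<tau> 0 x)"
    and g: "\<And>a. cochain 0 (g a)"
  shows "\<exists>F. F 0 = unit_map \<and> (\<forall>a. cochain 0 (F a)) \<and>
    (\<forall>j xs. nat_times (Suc j) (F (Suc j) xs) = (\<Sum>a\<le>j. coder_act id (g a) (F (j - a)) xs))"
proof -
  obtain \<rho> where \<rho>: "\<And>j. \<rho> j \<in> K" "\<And>j n x. x \<in> G n \<Longrightarrow> \<rho> j x \<in> G n"
    "\<And>j x. nat_times (Suc j) (\<rho> j x) = \<tau> 0 x"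
    using div by metis
  have F: "cochain 0 (flow \<rho> g a)" for a
  proof (induction a rule: less_induct)
    case (less a)
    show ?case
    proof (cases a)
      case (Suc j)
      show ?thesis
        unfolding Suc flow.simps
      proof (rule mmap_comp[OF _ \<rho>(1,2)])
        show "cochain 0 (\<lambda>xs. \<Sum>a\<le>j. coder_act id (g a) (flow \<rho> g (j - a)) xs)"
          by (intro mmap_sum cochain_coder_act_id[OF g] less.IH) (simp add: Suc)
      qed
    next
      case 0
      show ?thesis unfolding 0 flow.simps by (rule cochain_unit_map)
    qed
  qed
  have "nat_times (Suc j) (flow \<rho> g (Suc j) xs) = (\<Sum>a\<le>j. coder_act id (g a) (flow \<rho> g (j - a)) xs)" for j xs
    unfolding flow.simps \<rho>(3) additive.sum[OF \<tau>_additive]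
    by (intro sum.cong refl mmap_\<tau>0[OF cochain_coder_act_id[OF g F]])
  then show ?thesis using F by (intro exI[of _ "flow \<rho> g"]) simp
qed

lemma flow_field_exists:
  assumes F: "\<And>a. cochain 0 (F a)" "F 0 = unit_map"
  shows "\<exists>g. (\<forall>a. cochain 0 (g a)) \<and>
    (\<forall>j xs. nat_times (Suc j) (F (Suc j) xs) = (\<Sum>a\<le>j. coder_act id (g a) (F (j - a)) xs))"
proof (intro exI[of _ "flow_field F"] conjI allI)
  show g: "cochain 0 (flow_field F j)" for j
  proof (induction j rule: less_induct)
    case (less j)
    show ?case
      unfolding flow_field.simps[of F j]
      by (intro mmap_diff mmap_nat_times mmap_sum F cochain_coder_act_id less.IH) simp
  qed
  show "nat_times (Suc j) (F (Suc j) xs) = (\<Sum>a\<le>j. coder_act id (flow_field F a) (F (j - a)) xs)" for j xs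
  proof -
    have "coder_act id (flow_field F j) (F (j - j)) xs = flow_field F j xs"
      by (simp add: F coder_act_unit_map mmap_\<tau>0[OF g] mmap_Nil[OF g] del: flow_field.simps)
    then show ?thesis
      by (simp add: lessThan_Suc_atMost[symmetric] flow_field.simps[of F j] del: flow_field.simps nat_times.simps)
  qed
qed

text \<open>
  Both implications are inductions on the coefficients of $X' = X \cdot g + F \cdot Y$. If \<open>Y\<close>
  vanishes, then the coefficient of $h^j$ on the right involves only the coefficients of \<open>X\<close> up to
  \<open>j\<close>, and the next coefficient of \<open>X\<close> is obtained from it by division. If \<open>X\<close> vanishes, then the
  lowest coefficient of \<open>Y\<close> is the lowest coefficient of $F \cdot Y = 0$.
\<close>

theorem formality_defect_zero_iff:
  assumes M: "\<And>a. cochain 1 (M a)" and quad: "\<And>xs. length xs \<noteq> 2 \<Longrightarrow> M 0 xs = 0"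
    and F: "\<And>a. cochain 0 (F a)" "F 0 = unit_map" and g: "\<And>a. cochain 0 (g a)"
    and ode: "\<And>j xs. nat_times (Suc j) (F (Suc j) xs) = (\<Sum>a\<le>j. coder_act id (g a) (F (j - a)) xs)"
    and div: "\<And>j. \<exists>\<rho>\<in>K. (\<forall>n. \<forall>x\<in>G n. \<rho> x \<in> G n) \<and> (\<forall>x. nat_times (Suc j) (\<rho> x) = \<tau> 0 x)"
  shows "(\<forall>j\<le>n. formality_defect M F j = (\<lambda>_. 0)) \<longleftrightarrow> (\<forall>j<n. kaledin_defect M g j = (\<lambda>_. 0))"
proof -
  note deriv = formality_defect_derivative[where M = M and F = F and g = g, OF M F(1) g ode]
  have Y: "cochain 1 (kaledin_defect M g j)" for j
    unfolding kaledin_defect_def by (intro mmap_diff mmap_nat_times mmap_sum M cochain_bracket g)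
  have X\<tau>: "\<tau> 0 (formality_defect M F j xs) = formality_defect M F j xs" for j xs
    using cochain_coder_act_\<sigma>[OF M F(1), THEN mmap_\<tau>0]
    by (simp add: formality_defect_def additive.diff[OF \<tau>_additive] additive.sum[OF \<tau>_additive]
        mmap_bilin_op_\<tau>0[OF M])
  have X0: "formality_defect M F 0 = (\<lambda>_. 0)"
    by (simp add: formality_defect_def F(2) coder_act_unit_map bilin_op_unit_map[OF M quad]
        mmap_\<tau>0[OF M] mmap_Nil[OF M] fun_eq_iff)
  show ?thesis
  proof (intro iffI allI impI)
    fix j assume Y0: "\<forall>j<n. kaledin_defect M g j = (\<lambda>_. 0)" and "j \<le> n"
    from \<open>j \<le> n\<close> show "formality_defect M F j = (\<lambda>_. 0)"
    proof (induction j rule: less_induct)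
      case (less j)
      show ?case
      proof (cases j)
        case 0
        then show ?thesis by (simp add: X0)
      next
        case (Suc i)
        have z: "nat_times (Suc i) (formality_defect M F (Suc i) xs) = 0" for xs
        proof -
          have "coder_act id (g a) (formality_defect M F (i - a)) xs = 0" for a
            using less.IH[of "i - a"] less.prems Suc by (simp add: coder_act_def)
          moreover have "coder_act \<sigma> (kaledin_defect M g a) (F (i - a)) xs = 0" if "a \<le> i" for a
            using Y0 less.prems Suc that by (simp add: coder_act_op_zero[OF mmap_slot_additive[OF F(1)]])
          ultimately show ?thesis unfolding deriv by simp
        qed
        obtain \<rho> where \<rho>: "\<rho> \<in> K" "\<And>x. nat_times (Suc i) (\<rho> x) = \<tau> 0 x" using div by metis
        have "formality_defect M F (Suc i) xs = 0" for xs
        proof -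
          have "formality_defect M F (Suc i) xs = nat_times (Suc i) (\<rho> (formality_defect M F (Suc i) xs))"
            by (simp only: \<rho>(2) X\<tau>)
          also have "\<dots> = \<rho> (nat_times (Suc i) (formality_defect M F (Suc i) xs))"
            by (simp only: additive_nat_times_commute[OF K_additive[OF \<rho>(1)]])
          finally show ?thesis by (simp only: z additive.zero[OF K_additive[OF \<rho>(1)]])
        qed
        then show ?thesis by (simp add: Suc fun_eq_iff)
      qed
    qed
  next
    fix j assume X0: "\<forall>j\<le>n. formality_defect M F j = (\<lambda>_. 0)" and "j < n"
    from \<open>j < n\<close> show "kaledin_defect M g j = (\<lambda>_. 0)"
    proof (induction j rule: less_induct)
      case (less j)
      have "kaledin_defect M g j xs = 0" for xs
      proof -
        have "coder_act id (g a) (formality_defect M F (j - a)) xs = 0" for a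
          using X0 less.prems by (simp add: coder_act_def)
        moreover have "formality_defect M F (Suc j) xs = 0"
          using X0 less.prems by simp
        ultimately have "(\<Sum>a\<le>j. coder_act \<sigma> (kaledin_defect M g a) (F (j - a)) xs) = 0"
          using deriv[where j = j and xs = xs] by (simp del: nat_times.simps)
        moreover have "coder_act \<sigma> (kaledin_defect M g a) (F (j - a)) xs = 0" if "a < j" for a
          using less.IH[OF that] less.prems that by (simp add: coder_act_op_zero[OF mmap_slot_additive[OF F(1)]])
        ultimately have "coder_act \<sigma> (kaledin_defect M g j) (F 0) xs = 0"
          by (simp add: lessThan_Suc_atMost[symmetric])
        then show ?thesis
          by (cases "xs = []") (simp_all add: F(2) coder_act_unit_map mmap_\<tau>0[OF Y] mmap_Nil[OF Y])
      qed
      then show ?case by (simp add: fun_eq_iff)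
    qed
  qed
qed

corollary formality_iff_kaledin:
  assumes M: "\<And>a. cochain 1 (M a)" and quad: "\<And>xs. length xs \<noteq> 2 \<Longrightarrow> M 0 xs = 0"
    and div: "\<And>j. \<exists>\<rho>\<in>K. (\<forall>n. \<forall>x\<in>G n. \<rho> x \<in> G n) \<and> (\<forall>x. nat_times (Suc j) (\<rho> x) = \<tau> 0 x)"
  shows "(\<exists>F. F 0 = unit_map \<and> (\<forall>a. cochain 0 (F a)) \<and> (\<forall>j\<le>n. formality_defect M F j = (\<lambda>_. 0)))
     \<longleftrightarrow> (\<exists>g. (\<forall>a. cochain 0 (g a)) \<and> (\<forall>j<n. kaledin_defect M g j = (\<lambda>_. 0)))"
proof (intro iffI; elim exE conjE)
  fix F assume F: "F 0 = unit_map" "\<forall>a. cochain 0 (F a)" "\<forall>j\<le>n. formality_defect M F j = (\<lambda>_. 0)"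
  obtain g where g: "\<And>a. cochain 0 (g a)"
    "\<And>j xs. nat_times (Suc j) (F (Suc j) xs) = (\<Sum>a\<le>j. coder_act id (g a) (F (j - a)) xs)"
    using flow_field_exists[of F] F by blast
  have F': "cochain 0 (F a)" for a using F(2) by blast
  have "(\<forall>j\<le>n. formality_defect M F j = (\<lambda>_. 0)) \<longleftrightarrow> (\<forall>j<n. kaledin_defect M g j = (\<lambda>_. 0))"
    by (rule formality_defect_zero_iff; fact M quad F' F(1) g div)
  then show "\<exists>g. (\<forall>a. cochain 0 (g a)) \<and> (\<forall>j<n. kaledin_defect M g j = (\<lambda>_. 0))"
    using F(3) g(1) by blast
next
  fix g assume g: "\<forall>a. cochain 0 (g a)" "\<forall>j<n. kaledin_defect M g j = (\<lambda>_. 0)"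
  obtain F where F: "F 0 = unit_map" "\<And>a. cochain 0 (F a)"
    "\<And>j xs. nat_times (Suc j) (F (Suc j) xs) = (\<Sum>a\<le>j. coder_act id (g a) (F (j - a)) xs)"
    using flow_exists[OF div, of g] g(1) by blast
  have g': "cochain 0 (g a)" for a using g(1) by blast
  have "(\<forall>j\<le>n. formality_defect M F j = (\<lambda>_. 0)) \<longleftrightarrow> (\<forall>j<n. kaledin_defect M g j = (\<lambda>_. 0))"
    by (rule formality_defect_zero_iff; fact M quad F g' div)
  then show "\<exists>F. F 0 = unit_map \<and> (\<forall>a. cochain 0 (F a)) \<and> (\<forall>j\<le>n. formality_defect M F j = (\<lambda>_. 0))"
    using F(1,2) g(2) by blast
qed

lemma bracket_zero_left: "cochain 0 g \<Longrightarrow> bracket (\<lambda>_. 0) g xs = 0"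
  by (simp add: bracket_def coder_act_op_zero[OF mmap_slot_additive]) (simp add: coder_act_def)

lemma bracket_nat_times:
  assumes "mmap p B"
  shows "bracket B (\<lambda>xs. nat_times k (g xs)) xs = nat_times k (bracket B g xs)"
  by (simp add: bracket_def coder_act_op_nat_times[OF mmap_slot_additive[OF assms]] coder_act_nat_times
      additive.diff[OF additive_nat_times])

lemma bracket_scale:
  assumes B: "mmap p B" and \<rho>: "\<rho> \<in> S"
  shows "bracket B (\<lambda>xs. \<rho> (g xs)) xs = \<rho> (bracket B g xs)"
proof -
  have "B (us @ \<rho> x # vs) = \<rho> (B (us @ x # vs))" for us x vs
    using slot_linearD[OF mmap_slot_linear[OF B], of us vs] \<rho> by (simp add: K_def)
  then show ?thesis
    by (simp add: bracket_def coder_act_def insert_at_def additive.diff[OF S_additive[OF \<rho>]]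
        additive.sum[OF S_additive[OF \<rho>]] case_prod_unfold)
qed

lemma kaledin_defect_single:
  assumes M: "\<And>a. cochain 1 (M a)" and gap: "\<And>a. 1 \<le> a \<Longrightarrow> a < n \<Longrightarrow> M a = (\<lambda>_. 0)"
    and g: "\<And>a. cochain 0 (g a)" and j: "j < n"
  shows "kaledin_defect M g j xs = nat_times (Suc j) (M (Suc j) xs) - bracket (M 0) (g j) xs"
proof -
  have "(\<Sum>a\<le>j. bracket (M (j - a)) (g a) xs) = (\<Sum>a\<le>j. if a = j then bracket (M 0) (g j) xs else 0)"
  proof (rule sum.cong[OF refl])
    fix a assume a: "a \<in> {..j}"
    show "bracket (M (j - a)) (g a) xs = (if a = j then bracket (M 0) (g j) xs else 0)"
    proof (cases "a = j")
      case False
      then have "M (j - a) = (\<lambda>_. 0)" using a j by (intro gap) auto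
      then show ?thesis using False by (simp add: bracket_zero_left[OF g])
    qed simp
  qed
  then show ?thesis by (simp add: kaledin_defect_def del: nat_times.simps)
qed

text \<open>
  If \<open>M 1\<close>, ..., \<open>M (n - 1)\<close> vanish, then the conditions for different powers of \<open>h\<close> decouple, and the
  only one with a nonzero left hand side is $n M_n = [M_0, g_{n-1}]$. Division by \<open>n\<close> commutes with
  the bracket.
\<close>

lemma kaledin_single_term:
  assumes M: "\<And>a. cochain 1 (M a)" and gap: "\<And>a. 1 \<le> a \<Longrightarrow> a < n \<Longrightarrow> M a = (\<lambda>_. 0)" and n: "1 \<le> n"
    and div: "\<And>j. \<exists>\<rho>\<in>S \<inter> K. \<forall>x. nat_times (Suc j) (\<rho> x) = \<tau> 0 x"
  shows "(\<exists>g. (\<forall>a. cochain 0 (g a)) \<and> (\<forall>j<n. kaledin_defect M g j = (\<lambda>_. 0)))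
     \<longleftrightarrow> (\<exists>d. cochain 0 d \<and> M n = bracket (M 0) d)"
proof (intro iffI; elim exE conjE)
  fix g assume g: "\<forall>a. cochain 0 (g a)" and Y: "\<forall>j<n. kaledin_defect M g j = (\<lambda>_. 0)"
  obtain i where i: "n = Suc i" using n by (cases n) auto
  obtain \<rho> where \<rho>: "\<rho> \<in> S" "\<rho> \<in> K" "\<And>x. nat_times n (\<rho> x) = \<tau> 0 x" using div[of i] i by blast
  have g': "cochain 0 (g a)" for a using g by blast
  have eq: "nat_times n (M n xs) = bracket (M 0) (g i) xs" for xs
    using kaledin_defect_single[where M = M and g = g and n = n and j = i and xs = xs, OF M gap g'] Y i by (simp del: nat_times.simps)
  have "M n xs = bracket (M 0) (\<lambda>xs. \<rho> (g i xs)) xs" for xs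
  proof -
    have "M n xs = nat_times n (\<rho> (M n xs))" by (simp only: \<rho>(3) mmap_\<tau>0[OF M])
    also have "\<dots> = \<rho> (nat_times n (M n xs))"
      by (simp only: additive_nat_times_commute[OF S_additive[OF \<rho>(1)]])
    also have "\<dots> = bracket (M 0) (\<lambda>xs. \<rho> (g i xs)) xs"
      by (simp only: eq bracket_scale[OF M \<rho>(1)])
    finally show ?thesis .
  qed
  moreover have "cochain 0 (\<lambda>xs. \<rho> (g i xs))"
    by (rule mmap_comp[OF g' \<rho>(2)]) (rule S_G[OF \<rho>(1)])
  ultimately show "\<exists>d. cochain 0 d \<and> M n = bracket (M 0) d" by (auto simp: fun_eq_iff)
next
  fix d assume d: "cochain 0 d" "M n = bracket (M 0) d"
  obtain i where i: "n = Suc i" using n by (cases n) auto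
  define g where "g = (\<lambda>a xs. if a = i then nat_times n (d xs) else 0)"
  have g: "cochain 0 (g a)" for a
    using mmap_nat_times[OF d(1), of n] mmap_zero by (cases "a = i") (simp_all add: g_def del: nat_times.simps)
  have "kaledin_defect M g j xs = 0" if "j < n" for j xs
  proof (cases "j = i")
    case True
    then show ?thesis
      using kaledin_defect_single[where M = M and g = g and n = n and j = j and xs = xs, OF M gap g that] bracket_nat_times[OF M[of 0], of n d xs] i d(2)
      by (simp add: g_def del: nat_times.simps)
  next
    case False
    then have "M (Suc j) = (\<lambda>_. 0)" using that i by (intro gap) auto
    moreover have "bracket (M 0) (g j) xs = 0"
      using bracket_nat_times[OF M[of 0], of 0 d xs] False by (simp add: g_def)
    ultimately show ?thesis
      using kaledin_defect_single[where M = M and g = g and n = n and j = j and xs = xs, OF M gap g that] by (simp del: nat_times.simps)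
  qed
  then show "\<exists>g. (\<forall>a. cochain 0 (g a)) \<and> (\<forall>j<n. kaledin_defect M g j = (\<lambda>_. 0))"
    using g by (intro exI[of _ g]) (auto simp: fun_eq_iff)
qed

end

section \<open>A common home for all abelian groups on a type\<close>

text \<open>
  The product of all abelian groups whose carrier is a set of elements of type \<open>'a\<close>. It is an abelian
  group on a whole type and contains each of the factors as a direct summand, so finite sums in a
  factor can be computed with the sum operator of the class \<open>ab_group_add\<close>.
\<close>

typedef 'a ab_universe = "PiE {H::'a monoid. comm_group H} carrier"
proof
  show "(\<lambda>H\<in>{H. comm_group H}. \<one>\<^bsub>H\<^esub>) \<in> PiE {H::'a monoid. comm_group H} carrier"
    by (auto simp: comm_group_def group_def intro: monoid.one_closed)
qed

setup_lifting type_definition_ab_universe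

instantiation ab_universe :: (type) ab_group_add
begin

lift_definition zero_ab_universe :: "'a ab_universe" is "\<lambda>H\<in>{H. comm_group H}. \<one>\<^bsub>H\<^esub>"
  by (auto simp: comm_group_def group_def intro: monoid.one_closed)

lift_definition plus_ab_universe :: "'a ab_universe \<Rightarrow> 'a ab_universe \<Rightarrow> 'a ab_universe"
  is "\<lambda>u v. \<lambda>H\<in>{H. comm_group H}. u H \<otimes>\<^bsub>H\<^esub> v H"
  by (auto simp: comm_group_def group_def PiE_iff intro!: monoid.m_closed)

lift_definition uminus_ab_universe :: "'a ab_universe \<Rightarrow> 'a ab_universe"
  is "\<lambda>u. \<lambda>H\<in>{H. comm_group H}. inv\<^bsub>H\<^esub> u H"
  by (auto simp: comm_group_def PiE_iff intro!: group.inv_closed)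

definition minus_ab_universe :: "'a ab_universe \<Rightarrow> 'a ab_universe \<Rightarrow> 'a ab_universe" where
  "minus_ab_universe u v = u + - v"

instance
proof
  fix a b c :: "'a ab_universe"
  show "a + b + c = a + (b + c)"
    by transfer (auto simp: fun_eq_iff PiE_iff comm_group_def group_def intro!: monoid.m_assoc)
  show "a + b = b + a"
    by transfer (auto simp: fun_eq_iff PiE_iff comm_group_def intro!: comm_monoid.m_comm)
  show "0 + a = a"
    by transfer (auto simp: fun_eq_iff PiE_iff extensional_def comm_group_def group_def intro!: monoid.l_one)
  show "- a + a = 0"
    by transfer (auto simp: fun_eq_iff PiE_iff comm_group_def intro!: group.l_inv)
  show "a - b = a + - b" by (rule minus_ab_universe_def)
qed

end

text \<open>
  The additive group of a ring or module record as a plain group record; this record is the index of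
  its factor in the product.
\<close>

definition additive_part :: "('a, 'z) ring_scheme \<Rightarrow> 'a monoid" where
  "additive_part M = \<lparr>carrier = carrier M, monoid.mult = ring.add M, one = \<zero>\<^bsub>M\<^esub>\<rparr>"

definition prj :: "('a, 'z) ring_scheme \<Rightarrow> 'a ab_universe \<Rightarrow> 'a" where
  "prj M u = Rep_ab_universe u (additive_part M)"

definition emb :: "('a, 'z) ring_scheme \<Rightarrow> 'a \<Rightarrow> 'a ab_universe" where
  "emb M x = Abs_ab_universe (\<lambda>H\<in>{H. comm_group H}. if H = additive_part M \<and> x \<in> carrier M then x else \<one>\<^bsub>H\<^esub>)"

context abelian_group
begin

lemma comm_group_additive_part: "comm_group (additive_part G)"
proof (rule comm_groupI)
  fix x assume "x \<in> carrier (additive_part G)"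
  then show "\<exists>y\<in>carrier (additive_part G). y \<otimes>\<^bsub>additive_part G\<^esub> x = \<one>\<^bsub>additive_part G\<^esub>"
    by (auto simp: additive_part_def intro!: bexI[of _ "\<ominus> x"] l_neg)
qed (auto simp: additive_part_def a_assoc intro: a_comm)

lemma prj_closed [simp]: "prj G u \<in> carrier G"
  using Rep_ab_universe[of u] comm_group_additive_part
  by (auto simp: prj_def PiE_iff) (auto simp: additive_part_def)

lemma Rep_emb:
  "Rep_ab_universe (emb G x) = (\<lambda>H\<in>{H. comm_group H}. if H = additive_part G \<and> x \<in> carrier G then x else \<one>\<^bsub>H\<^esub>)"
  unfolding emb_def
  by (rule Abs_ab_universe_inverse, subst restrict_PiE_iff)
    (auto simp: comm_group_def group_def additive_part_def intro: monoid.one_closed)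

lemma prj_emb [simp]: "x \<in> carrier G \<Longrightarrow> prj G (emb G x) = x"
  by (simp add: prj_def Rep_emb comm_group_additive_part)

lemma prj_add: "prj G (u + v) = prj G u \<oplus> prj G v"
  by (simp add: prj_def plus_ab_universe.rep_eq comm_group_additive_part) (simp add: additive_part_def)

lemma emb_add: "x \<in> carrier G \<Longrightarrow> y \<in> carrier G \<Longrightarrow> emb G (x \<oplus> y) = emb G x + emb G y"
  by (rule Rep_ab_universe_inject[THEN iffD1])
    (auto simp: Rep_emb plus_ab_universe.rep_eq fun_eq_iff comm_group_def group_def monoid.r_one
      additive_part_def monoid.one_closed)

lemma emb_inj: "x \<in> carrier G \<Longrightarrow> y \<in> carrier G \<Longrightarrow> emb G x = emb G y \<longleftrightarrow> x = y"
  by (metis prj_emb)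

lemma emb_zero [simp]: "emb G \<zero> = 0"
  using emb_add[of \<zero> \<zero>] by simp

lemma prj_zero [simp]: "prj G 0 = \<zero>"
  using prj_emb[of \<zero>] by simp

lemma emb_minus: "x \<in> carrier G \<Longrightarrow> emb G (\<ominus> x) = - emb G x"
  using emb_add[of "\<ominus> x" x] by (simp add: l_neg eq_neg_iff_add_eq_0)

lemma emb_diff: "x \<in> carrier G \<Longrightarrow> y \<in> carrier G \<Longrightarrow> emb G (x \<ominus> y) = emb G x - emb G y"
  by (simp add: a_minus_def emb_add emb_minus)

lemma emb_finsum: "f \<in> I \<rightarrow> carrier G \<Longrightarrow> emb G (finsum G f I) = (\<Sum>i\<in>I. emb G (f i))"
proof (induction I rule: infinite_finite_induct)
  case (infinite I)
  then show ?case by (simp add: finsum_infinite)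
next
  case (insert i I)
  then show ?case by (simp add: emb_add)
qed simp

lemma emb_add_pow: "x \<in> carrier G \<Longrightarrow> emb G (add_pow G (k::nat) x) = nat_times k (emb G x)"
  by (induction k) (simp_all add: add.nat_pow_Suc emb_add add.nat_pow_closed add.commute)

end

section \<open>Graded modules as graded spaces\<close>

text \<open>
  The part of the structure of a graded module that multilinear maps refer to: an abelian group, its
  decomposition into homogeneous components, and the additive operators given by scalars. It is
  inherited by shifts and by truncated polynomials.
\<close>

locale graded_action = abelian_group M
  for M :: "('r, 'a, 'z) gmodule_scheme" (structure) +
  fixes R :: "('r, 'y) ring_scheme"
  assumes smult_closed: "a \<in> carrier R \<Longrightarrow> x \<in> carrier M \<Longrightarrow> a \<odot> x \<in> carrier M"
    and smult_add: "a \<in> carrier R \<Longrightarrow> x \<in> carrier M \<Longrightarrow> y \<in> carrier M \<Longrightarrow> a \<odot> (x \<oplus> y) = a \<odot> x \<oplus> a \<odot> y"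
    and gr_carrier: "x \<in> gr M n \<Longrightarrow> x \<in> carrier M"
    and gr_zero: "\<zero> \<in> gr M n"
    and gr_add: "x \<in> gr M n \<Longrightarrow> y \<in> gr M n \<Longrightarrow> x \<oplus> y \<in> gr M n"
    and gr_minus: "x \<in> gr M n \<Longrightarrow> \<ominus> x \<in> gr M n"
    and gr_smult: "a \<in> carrier R \<Longrightarrow> x \<in> gr M n \<Longrightarrow> a \<odot> x \<in> gr M n"
    and ex1_hcomps: "x \<in> carrier M \<Longrightarrow> \<exists>!c. hcomps M x c"
begin

definition hcomp :: "'a \<Rightarrow> int \<Rightarrow> 'a" where "hcomp x = (THE c. hcomps M x c)"

lemma hcomps_hcomp: "x \<in> carrier M \<Longrightarrow> hcomps M x (hcomp x)"
  unfolding hcomp_def by (rule theI'[OF ex1_hcomps])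

lemma hcomp_eq: "x \<in> carrier M \<Longrightarrow> hcomps M x c \<Longrightarrow> hcomp x = c"
  using ex1_hcomps hcomps_hcomp by blast

lemma hcomp_gr: "x \<in> carrier M \<Longrightarrow> hcomp x n \<in> gr M n"
  and hcomp_carrier [simp]: "x \<in> carrier M \<Longrightarrow> hcomp x n \<in> carrier M"
  and finite_hcomp: "x \<in> carrier M \<Longrightarrow> finite {n. hcomp x n \<noteq> \<zero>}"
  using hcomps_hcomp[of x] by (auto simp: hcomps_def intro: gr_carrier)

lemma emb_eq_sum_hcomp:
  assumes "x \<in> carrier M"
  shows "emb M x = (\<Sum>n\<in>{n. hcomp x n \<noteq> \<zero>}. emb M (hcomp x n))"
proof -
  have "x = (\<Oplus>n\<in>{n. hcomp x n \<noteq> \<zero>}. hcomp x n)"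
    using hcomps_hcomp[OF assms] by (simp add: hcomps_def)
  then have "emb M x = emb M (\<Oplus>n\<in>{n. hcomp x n \<noteq> \<zero>}. hcomp x n)" by simp
  also have "\<dots> = (\<Sum>n\<in>{n. hcomp x n \<noteq> \<zero>}. emb M (hcomp x n))"
    by (rule emb_finsum) (simp add: assms)
  finally show ?thesis .
qed

text \<open>
  The summation in a decomposition into homogeneous components may run over any finite set that
  contains the support.
\<close>

lemma hcompsI:
  assumes x: "x \<in> carrier M" and c: "\<And>n. c n \<in> gr M n"
    and T: "finite T" "\<And>n. n \<notin> T \<Longrightarrow> c n = \<zero>" and eq: "emb M x = (\<Sum>n\<in>T. emb M (c n))"
  shows "hcomps M x c"
proof -
  have sub: "{n. c n \<noteq> \<zero>} \<subseteq> T" using T by auto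
  have cc: "c n \<in> carrier M" for n by (rule gr_carrier[OF c])
  have "emb M x = (\<Sum>n\<in>{n. c n \<noteq> \<zero>}. emb M (c n))"
    unfolding eq by (rule sum.mono_neutral_right[OF T(1) sub]) auto
  also have "\<dots> = emb M (\<Oplus>n\<in>{n. c n \<noteq> \<zero>}. c n)"
    by (rule emb_finsum[symmetric]) (simp add: cc)
  finally have "x = (\<Oplus>n\<in>{n. c n \<noteq> \<zero>}. c n)"
    by (subst (asm) emb_inj) (auto intro!: x finsum_closed cc)
  then show ?thesis
    using c finite_subset[OF sub T(1)] by (simp add: hcomps_def)
qed

lemma sgn_mult_closed: "x \<in> carrier M \<Longrightarrow> sgn_mult M e x \<in> carrier M"
  by (simp add: sgn_mult_def)

lemma emb_sgn_mult: "x \<in> carrier M \<Longrightarrow> emb M (sgn_mult M e x) = parity_sign e (emb M x)"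
  by (simp add: sgn_mult_def parity_sign_def emb_minus)

lemma koszul_closed [simp]: "x \<in> carrier M \<Longrightarrow> koszul M p x \<in> carrier M"
  unfolding koszul_def Let_def hcomp_def[symmetric] by (auto intro!: finsum_closed sgn_mult_closed)

lemma emb_koszul:
  assumes x: "x \<in> carrier M" and T: "finite T" "\<And>n. n \<notin> T \<Longrightarrow> hcomp x n = \<zero>"
  shows "emb M (koszul M p x) = (\<Sum>n\<in>T. parity_sign (p * n) (emb M (hcomp x n)))"
proof -
  have "emb M (koszul M p x) = (\<Sum>n\<in>{n. hcomp x n \<noteq> \<zero>}. emb M (sgn_mult M (p * n) (hcomp x n)))"
    unfolding koszul_def Let_def hcomp_def[symmetric]
    by (rule emb_finsum) (auto intro!: sgn_mult_closed simp: x)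
  also have "\<dots> = (\<Sum>n\<in>T. parity_sign (p * n) (emb M (hcomp x n)))"
    by (rule sum.mono_neutral_cong_left) (use T x in \<open>auto simp: emb_sgn_mult\<close>)
  finally show ?thesis .
qed

lemma hcomp_add:
  assumes x: "x \<in> carrier M" and y: "y \<in> carrier M"
  shows "hcomp (x \<oplus> y) = (\<lambda>n. hcomp x n \<oplus> hcomp y n)"
proof (rule hcomp_eq[OF a_closed[OF x y]])
  let ?T = "{n. hcomp x n \<noteq> \<zero>} \<union> {n. hcomp y n \<noteq> \<zero>}"
  have T: "finite ?T" by (simp add: finite_hcomp x y)
  have "emb M x = (\<Sum>n\<in>?T. emb M (hcomp x n))"
    unfolding emb_eq_sum_hcomp[OF x] by (rule sum.mono_neutral_left[OF T]) auto
  moreover have "emb M y = (\<Sum>n\<in>?T. emb M (hcomp y n))"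
    unfolding emb_eq_sum_hcomp[OF y] by (rule sum.mono_neutral_left[OF T]) auto
  ultimately show "hcomps M (x \<oplus> y) (\<lambda>n. hcomp x n \<oplus> hcomp y n)"
    by (intro hcompsI[OF _ _ T]) (auto simp: x y emb_add sum.distrib intro!: gr_add hcomp_gr)
qed

lemma hcomp_homogeneous:
  assumes x: "x \<in> gr M n"
  shows "hcomp x = (\<lambda>j. if j = n then x else \<zero>)"
  by (rule hcomp_eq[OF gr_carrier[OF x]], rule hcompsI[of _ _ "{n}"]) (auto simp: x gr_zero gr_carrier[OF x])

text \<open>
  The supports of the components of \<open>x\<close>, \<open>y\<close> and \<open>x \<oplus> y\<close> differ, so all three are summed over the
  union of the supports of \<open>x\<close> and \<open>y\<close>.
\<close>

lemma emb_koszul_add: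
  assumes x: "x \<in> carrier M" and y: "y \<in> carrier M"
  shows "emb M (koszul M p (x \<oplus> y)) = emb M (koszul M p x) + emb M (koszul M p y)"
proof -
  let ?T = "{n. hcomp x n \<noteq> \<zero>} \<union> {n. hcomp y n \<noteq> \<zero>}"
  have T: "finite ?T" by (simp add: finite_hcomp x y)
  have "emb M (koszul M p (x \<oplus> y)) = (\<Sum>n\<in>?T. parity_sign (p * n) (emb M (hcomp (x \<oplus> y) n)))"
    by (rule emb_koszul[OF _ T]) (auto simp: x y hcomp_add)
  also have "\<dots> = (\<Sum>n\<in>?T. parity_sign (p * n) (emb M (hcomp x n))) + (\<Sum>n\<in>?T. parity_sign (p * n) (emb M (hcomp y n)))"
    by (simp add: hcomp_add x y emb_add additive.add[OF additive_parity_sign] sum.distrib)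
  finally show ?thesis
    using emb_koszul[OF x T, of p] emb_koszul[OF y T, of p] by simp
qed

definition u_gr :: "int \<Rightarrow> 'a ab_universe set" where "u_gr n = emb M ` gr M n"

definition u_koszul :: "int \<Rightarrow> 'a ab_universe \<Rightarrow> 'a ab_universe" where
  "u_koszul p u = emb M (koszul M p (prj M u))"

definition u_smult :: "'r \<Rightarrow> 'a ab_universe \<Rightarrow> 'a ab_universe" where
  "u_smult a u = emb M (a \<odot> prj M u)"

lemma koszul_0:
  assumes x: "x \<in> carrier M"
  shows "koszul M 0 x = x"
proof -
  have "emb M (koszul M 0 x) = (\<Sum>n\<in>{n. hcomp x n \<noteq> \<zero>}. parity_sign (0 * n) (emb M (hcomp x n)))"
    by (rule emb_koszul[OF x finite_hcomp[OF x]]) simp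
  also have "\<dots> = emb M x"
    unfolding emb_eq_sum_hcomp[OF x] by (simp add: parity_sign_def)
  finally show ?thesis by (simp add: emb_inj x)
qed

lemma u_koszul_0: "u_koszul 0 u = emb M (prj M u)"
  by (simp add: u_koszul_def koszul_0)

lemma u_gr_iff: "u \<in> u_gr n \<longleftrightarrow> prj M u \<in> gr M n \<and> emb M (prj M u) = u"
proof
  assume "u \<in> u_gr n"
  then obtain x where "x \<in> gr M n" "u = emb M x" by (auto simp: u_gr_def)
  then show "prj M u \<in> gr M n \<and> emb M (prj M u) = u" using gr_carrier[of x n] by simp
next
  assume "prj M u \<in> gr M n \<and> emb M (prj M u) = u"
  then show "u \<in> u_gr n" unfolding u_gr_def by (intro image_eqI[of _ _ "prj M u"]) simp_all
qed

lemma emb_gr: "x \<in> gr M n \<Longrightarrow> emb M x \<in> u_gr n"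
  by (simp add: u_gr_def)

lemma prj_gr: "u \<in> u_gr n \<Longrightarrow> prj M u \<in> gr M n"
  by (simp add: u_gr_iff)

lemma additive_u_smult: "a \<in> carrier R \<Longrightarrow> additive (u_smult a)"
  by unfold_locales (simp add: u_smult_def prj_add smult_add smult_closed emb_add)

sublocale graded_space u_gr u_koszul "u_smult ` carrier R"
proof
  show "0 \<in> u_gr n" for n using emb_gr[OF gr_zero, of n] by simp
  show "x + y \<in> u_gr n" if xy: "x \<in> u_gr n" "y \<in> u_gr n" for x y n
  proof -
    obtain a b where "a \<in> gr M n" "x = emb M a" "b \<in> gr M n" "y = emb M b"
      using xy by (auto simp: u_gr_def)
    then show ?thesis
      using emb_gr[OF gr_add[of a n b]] emb_add[of a b] gr_carrier[of a n] gr_carrier[of b n] by simp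
  qed
  show "- x \<in> u_gr n" if x: "x \<in> u_gr n" for x n
  proof -
    obtain a where "a \<in> gr M n" "x = emb M a"
      using x by (auto simp: u_gr_def)
    then show ?thesis using emb_gr[OF gr_minus[of a n]] emb_minus[of a] gr_carrier[of a n] by simp
  qed
  show "u_koszul p (x + y) = u_koszul p x + u_koszul p y" for p x y
    by (simp add: u_koszul_def prj_add emb_koszul_add)
  show "u_koszul p x = parity_sign (p * n) x" if x: "x \<in> u_gr n" for p n x
  proof -
    obtain y where y: "y \<in> gr M n" "x = emb M y" using x by (auto simp: u_gr_def)
    have "emb M (koszul M p y) = (\<Sum>j\<in>{n}. parity_sign (p * j) (emb M (hcomp y j)))"
      by (rule emb_koszul) (auto simp: gr_carrier[OF y(1)] hcomp_homogeneous[OF y(1)])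
    then show ?thesis by (simp add: y gr_carrier[OF y(1)] u_koszul_def hcomp_homogeneous[OF y(1)])
  qed
  show "u_koszul p (u_koszul 0 x) = u_koszul p x" for p x
    by (simp only: u_koszul_0) (simp add: u_koszul_def)
  show "k (u_koszul 0 x) = 0" if k: "additive k" and z: "\<And>n x. x \<in> u_gr n \<Longrightarrow> k x = 0" for k x
    unfolding u_koszul_0 emb_eq_sum_hcomp[OF prj_closed] additive.sum[OF k]
    by (rule sum.neutral) (auto intro!: z emb_gr hcomp_gr)
  fix \<rho> assume "\<rho> \<in> u_smult ` carrier R"
  then obtain a where a: "a \<in> carrier R" "\<rho> = u_smult a" by auto
  show "\<rho> (x + y) = \<rho> x + \<rho> y" for x y
    using additive_u_smult[OF a(1)] by (simp add: a(2) additive.add)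
  show "\<rho> x \<in> u_gr n" if "x \<in> u_gr n" for x n
    using that by (simp add: a u_smult_def emb_gr gr_smult prj_gr)
  show "\<rho> (u_koszul 0 x) = \<rho> x" "u_koszul 0 (\<rho> x) = \<rho> x" for x
    by (simp_all add: u_koszul_0 a u_smult_def smult_closed)
qed

text \<open>
  Precomposition with the projection makes a map defined on the words over \<open>M\<close> total, and
  multilinearity on the carrier becomes multilinearity without side conditions.
\<close>

definition lift_map :: "('a list \<Rightarrow> 'a) \<Rightarrow> 'a ab_universe list \<Rightarrow> 'a ab_universe" where
  "lift_map f xs = (if xs = [] then 0 else emb M (f (map (prj M) xs)))"

definition lower_map :: "('a ab_universe list \<Rightarrow> 'a ab_universe) \<Rightarrow> 'a list \<Rightarrow> 'a" where
  "lower_map F = (\<lambda>xs\<in>words M. prj M (F (map (emb M) xs)))"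

lemma lift_map_Nil [simp]: "lift_map f [] = 0"
  by (simp add: lift_map_def)

lemma prj_words: "us \<noteq> [] \<Longrightarrow> map (prj M) us \<in> words M"
  by (auto simp: words_def)

lemma lift_map_eq_iff:
  assumes "\<And>xs. xs \<in> words M \<Longrightarrow> f xs \<in> carrier M" "\<And>xs. xs \<in> words M \<Longrightarrow> f' xs \<in> carrier M"
  shows "lift_map f = lift_map f' \<longleftrightarrow> (\<forall>xs\<in>words M. f xs = f' xs)"
proof
  assume eq: "lift_map f = lift_map f'"
  show "\<forall>xs\<in>words M. f xs = f' xs"
  proof
    fix xs assume xs: "xs \<in> words M"
    then have "map (prj M) (map (emb M) xs) = xs"
      by (auto simp: words_def intro!: map_idI)
    then show "f xs = f' xs"
      using fun_cong[OF eq, of "map (emb M) xs"] xs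
      by (auto simp: lift_map_def words_def assms emb_inj simp del: map_map)
  qed
next
  assume "\<forall>xs\<in>words M. f xs = f' xs"
  then show "lift_map f = lift_map f'" by (auto simp: lift_map_def fun_eq_iff prj_words)
qed

lemma multimapsD:
  assumes "multimaps R M M p f"
  shows multimaps_closed: "\<And>xs. xs \<in> words M \<Longrightarrow> f xs \<in> carrier M"
    and multimaps_add: "\<And>xs ys x y. x \<in> carrier M \<Longrightarrow> y \<in> carrier M \<Longrightarrow> set xs \<subseteq> carrier M \<Longrightarrow>
      set ys \<subseteq> carrier M \<Longrightarrow> f (xs @ (x \<oplus> y) # ys) = f (xs @ x # ys) \<oplus> f (xs @ y # ys)"
    and multimaps_smult: "\<And>xs ys a x. a \<in> carrier R \<Longrightarrow> x \<in> carrier M \<Longrightarrow> set xs \<subseteq> carrier M \<Longrightarrow>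
      set ys \<subseteq> carrier M \<Longrightarrow> f (xs @ (a \<odot> x) # ys) = a \<odot> f (xs @ x # ys)"
    and multimaps_gr: "\<And>xs ds. xs \<noteq> [] \<Longrightarrow> length ds = length xs \<Longrightarrow>
      (\<And>j. j < length xs \<Longrightarrow> xs ! j \<in> gr M (ds ! j)) \<Longrightarrow> f xs \<in> gr M (sum_list ds + p (length xs))"
  using assms unfolding multimaps_def by blast+

lemma mmap_lift_map:
  assumes f: "multimaps R M M p f"
  shows "mmap p (lift_map f)"
  unfolding mmap_def slot_linear_def K_def
proof (intro conjI allI impI CollectI ballI)
  fix us vs
  let ?us = "map (prj M) us" and ?vs = "map (prj M) vs"
  have w: "set ?us \<subseteq> carrier M" "set ?vs \<subseteq> carrier M" by auto
  have c: "f (?us @ x # ?vs) \<in> carrier M" if "x \<in> carrier M" for x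
    by (rule multimaps_closed[OF f]) (use that in \<open>auto simp: words_def\<close>)
  show "additive (\<lambda>x. lift_map f (us @ x # vs))"
    by unfold_locales (simp add: lift_map_def prj_add multimaps_add[OF f _ _ w] emb_add c)
  show "lift_map f (us @ \<rho> x # vs) = \<rho> (lift_map f (us @ x # vs))" if \<rho>: "\<rho> \<in> u_smult ` carrier R" for \<rho> x
  proof -
    obtain a where a: "a \<in> carrier R" "\<rho> = u_smult a" using \<rho> by auto
    show ?thesis by (simp add: a lift_map_def u_smult_def smult_closed multimaps_smult[OF f _ _ w] c)
  qed
  show "lift_map f (us @ u_koszul 0 x # vs) = u_koszul 0 (lift_map f (us @ x # vs))" for x
    by (simp add: lift_map_def u_koszul_0 c)
next
  show "u_koszul 0 (lift_map f xs) = lift_map f xs" for xs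
    using multimaps_closed[OF f, OF prj_words, of xs] by (auto simp: lift_map_def u_koszul_0)
  show "lift_map f xs \<in> u_gr (sum_list ds + p (length xs))" if "xs \<noteq> []" "homogeneous xs ds" for xs ds
  proof -
    have "f (map (prj M) xs) \<in> gr M (sum_list ds + p (length (map (prj M) xs)))"
      by (rule multimaps_gr[OF f])
        (use that in \<open>auto simp: homogeneous_def list_all2_conv_all_nth intro: prj_gr\<close>)
    then show ?thesis using that by (simp add: lift_map_def emb_gr)
  qed
qed simp

lemma emb_smult: "a \<in> carrier R \<Longrightarrow> x \<in> carrier M \<Longrightarrow> emb M (a \<odot> x) = u_smult a (emb M x)"
  by (simp add: u_smult_def)

lemma prj_smult: "a \<in> carrier R \<Longrightarrow> prj M (u_smult a u) = a \<odot> prj M u"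
  by (simp add: u_smult_def smult_closed)

text \<open>
  A multilinear map absorbs the projection in every slot, hence is determined by its values on the
  embedded module.
\<close>

lemma lift_map_lower:
  assumes F: "mmap p F"
  shows "lift_map (lower_map F) = F"
proof
  fix xs
  show "lift_map (lower_map F) xs = F xs"
  proof (cases "xs = []")
    case False
    have "lift_map (lower_map F) xs = u_koszul 0 (F (map (u_koszul 0) xs))"
      using False by (simp add: lift_map_def lower_map_def prj_words fun_eq_iff[THEN iffD2, OF allI, OF u_koszul_0] comp_def)
    then show ?thesis by (simp add: mmap_absorb_map[OF F] mmap_\<tau>0[OF F])
  qed (simp add: mmap_Nil[OF F])
qed

lemma map_prj_emb: "xs \<in> words M \<Longrightarrow> map (prj M) (map (emb M) xs) = xs"
  by (auto simp: words_def intro!: map_idI)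

lemma multimapsI:
  assumes closed: "\<And>xs. xs \<in> words M \<Longrightarrow> f xs \<in> carrier M" and F: "mmap p (lift_map f)"
  shows "multimaps R M M p f"
proof -
  have L: "lift_map f (map (emb M) xs) = emb M (f xs)" if "xs \<in> words M" for xs
    using map_prj_emb[OF that] that by (auto simp: lift_map_def words_def simp del: map_map)
  have w: "xs @ x # ys \<in> words M" if "set xs \<subseteq> carrier M" "set ys \<subseteq> carrier M" "x \<in> carrier M" for xs ys x
    using that by (auto simp: words_def)
  note k = slot_linearD[OF mmap_slot_linear[OF F]]
  show ?thesis
    unfolding multimaps_def
  proof (intro conjI ballI allI impI; (elim conjE)?)
    show "f xs \<in> carrier M" if "xs \<in> words M" for xs by (rule closed[OF that])
    fix xs ys x assume xs: "x \<in> carrier M" "set xs \<subseteq> carrier M" "set ys \<subseteq> carrier M"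
    note Lx = L[OF w[OF xs(2,3)]] and fx = closed[OF w[OF xs(2,3)]]
    show "f (xs @ (x \<oplus> y) # ys) = f (xs @ x # ys) \<oplus> f (xs @ y # ys)" if y: "y \<in> carrier M" for y
    proof -
      have "emb M (f (xs @ (x \<oplus> y) # ys)) = emb M (f (xs @ x # ys) \<oplus> f (xs @ y # ys))"
        using additive.add[OF K_additive[OF k], of "map (emb M) xs" "emb M x" "emb M y" "map (emb M) ys"]
          Lx[of x] Lx[of y] Lx[of "x \<oplus> y"] xs(1) y by (simp add: emb_add fx)
      then show ?thesis using xs(1) y by (simp add: emb_inj fx)
    qed
    show "f (xs @ (a \<odot> x) # ys) = a \<odot> f (xs @ x # ys)" if a: "a \<in> carrier R" for a
    proof -
      have "lift_map f (us @ u_smult a z # vs) = u_smult a (lift_map f (us @ z # vs))" for us vs z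
        using k[of us vs] a by (simp add: K_def)
      then have "emb M (f (xs @ (a \<odot> x) # ys)) = emb M (a \<odot> f (xs @ x # ys))"
        using Lx[of x] Lx[of "a \<odot> x"] xs(1) a by (simp add: emb_smult smult_closed fx)
      then show ?thesis using xs(1) a by (simp add: emb_inj fx smult_closed)
    qed
  next
    fix xs ds assume "xs \<noteq> []" and len: "length ds = length xs" and gr: "\<forall>j<length xs. xs ! j \<in> gr M (ds ! j)"
    then have xs: "xs \<in> words M"
      by (auto simp: words_def in_set_conv_nth) (metis gr_carrier)
    have "homogeneous (map (emb M) xs) ds"
      using len gr by (auto simp: homogeneous_def list_all2_conv_all_nth intro: emb_gr)
    from mmap_G[OF F _ this] have "emb M (f xs) \<in> u_gr (sum_list ds + p (length xs))"
      using \<open>xs \<noteq> []\<close> by (simp add: L[OF xs])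
    then show "f xs \<in> gr M (sum_list ds + p (length xs))"
      using prj_gr closed[OF xs] by fastforce
  qed
qed

lemma multimaps_lower_map:
  assumes F: "mmap p F"
  shows "multimaps R M M p (lower_map F)"
  by (rule multimapsI) (simp_all add: lower_map_def lift_map_lower[OF F, unfolded lower_map_def] F)

lemma lower_map_lift: "xs \<in> words M \<Longrightarrow> f xs \<in> carrier M \<Longrightarrow> lower_map (lift_map f) xs = f xs"
proof -
  assume xs: "xs \<in> words M" "f xs \<in> carrier M"
  have "map (prj M) (map (emb M) xs) = xs" using xs by (auto simp: words_def intro!: map_idI)
  then show ?thesis using xs by (simp add: lower_map_def lift_map_def words_def del: map_map)
qed

end

section \<open>Suspension signs\<close>

context graded_space
begin

lemma \<tau>_cong:
  assumes "even (p - q)"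
  shows "\<tau> p x = \<tau> q x"
proof -
  have "\<tau> p (\<tau> 0 x) = \<tau> q (\<tau> 0 x)"
    by (rule homogeneous_ext[OF \<tau>_additive \<tau>_additive])
      (use assms in \<open>simp add: \<tau>_G; intro parity_sign_cong; simp add: left_diff_distrib[symmetric]\<close>)
  then show ?thesis by (simp add: \<tau>_absorb)
qed

text \<open>
  The signs of the suspension $s^{\otimes i}$: the letter at position \<open>j\<close> is passed by the
  \<open>i - 1 - j\<close> suspensions behind it.
\<close>

primrec koszul_twist :: "'v list \<Rightarrow> 'v list" where
  "koszul_twist [] = []"
| "koszul_twist (x # xs) = \<tau> (int (length xs)) x # koszul_twist xs"

lemma length_koszul_twist [simp]: "length (koszul_twist xs) = length xs"
  by (induction xs) simp_all

lemma koszul_twist_eq_Nil [simp]: "koszul_twist xs = [] \<longleftrightarrow> xs = []"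
  by (cases xs) simp_all

lemma koszul_twist_append:
  "koszul_twist (us @ vs) = map (\<tau> (int (length vs))) (koszul_twist us) @ koszul_twist vs"
  by (induction us) (simp_all add: algebra_simps)

lemma koszul_twist_nth:
  "j < length xs \<Longrightarrow> koszul_twist xs ! j = \<tau> (int (length xs) - 1 - int j) (xs ! j)"
  by (induction xs arbitrary: j) (auto simp: nth_Cons algebra_simps split: nat.split)

lemma koszul_twist_map:
  assumes "\<And>p x. \<tau> p (k x) = k (\<tau> p x)"
  shows "koszul_twist (map k xs) = map k (koszul_twist xs)"
  by (induction xs) (simp_all add: assms)

lemma koszul_twist_koszul_twist: "koszul_twist (koszul_twist xs) = map (\<tau> 0) xs"
proof (induction xs)
  case (Cons x xs)
  then show ?case by (simp add: \<tau>_cong[of "2 * int (length xs)" 0])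
qed simp

lemma homogeneous_koszul_twist: "homogeneous xs ds \<Longrightarrow> homogeneous (koszul_twist xs) ds"
proof (induction xs arbitrary: ds)
  case (Cons x xs)
  then show ?case
    by (cases ds) (auto simp: homogeneous_def \<tau>_G G_parity_sign)
qed simp

definition twist :: "('v list \<Rightarrow> 'v) \<Rightarrow> 'v list \<Rightarrow> 'v" where
  "twist f xs = f (koszul_twist xs)"

lemma mmap_twist:
  assumes f: "mmap p f"
  shows "mmap p (twist f)"
  unfolding mmap_def slot_linear_def
proof (intro conjI allI impI)
  show "(\<lambda>x. twist f (us @ x # vs)) \<in> K" for us vs
    using K_comp[OF slot_linearD[OF mmap_slot_linear[OF f]] K_\<tau>]
    by (simp add: twist_def koszul_twist_append)
  show "twist f xs \<in> G (sum_list ds + p (length xs))" if "xs \<noteq> []" "homogeneous xs ds" for xs ds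
    using mmap_G[OF f _ homogeneous_koszul_twist[OF that(2)]] that by (simp add: twist_def)
qed (simp_all add: twist_def mmap_Nil[OF f] mmap_\<tau>0[OF f])

text \<open>
  Each letter receives the same sign twice. Hence a map is recovered from its suspension by suspending
  it again.
\<close>

lemma twist_twist: "mmap p f \<Longrightarrow> twist (twist f) = f"
  by (simp add: fun_eq_iff twist_def koszul_twist_koszul_twist mmap_absorb_map)

text \<open>
  The signs $(-1)^{r+st}$ of the A-infinity relations: \<open>m\<close> has degree \<open>2 - s\<close>, and the \<open>t\<close>
  suspensions behind it pass it, which gives \<open>s t\<close>; the operation of degree one on $A[1]$ passes the
  \<open>r\<close> suspensions before it, which gives \<open>r\<close>.
\<close>

lemma coder_act_twist:
  assumes m: "mmap (\<lambda>i. 2 - int i) m" and f: "mmap (\<lambda>i. 1 - int i) f"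
  shows "coder_act \<sigma> (twist m) (twist f) xs
    = (\<Sum>(r, s)\<in>splits (length xs). parity_sign (int (r + s * (length xs - r - s)))
        (f (insert_at (\<tau> (2 - int s)) r s m (koszul_twist xs))))"
  unfolding coder_act_def
proof (rule sum.cong[OF refl], clarify)
  fix r s assume rs: "(r, s) \<in> splits (length xs)"
  define us ws vs where "us = take r xs" and "ws = take s (drop r xs)" and "vs = drop (r + s) xs"
  define t where "t = int (length vs)"
  have xs: "xs = us @ ws @ vs"
    unfolding us_def ws_def vs_def by (metis append_take_drop_id drop_drop add.commute)
  have len: "length us = r" "length ws = s"
    using rs by (auto simp: us_def ws_def splits_def)
  then have t: "length xs - r - s = length vs" by (simp add: xs)
  have tw: "koszul_twist xs = map (\<tau> (int s + t)) (koszul_twist us) @ map (\<tau> t) (koszul_twist ws) @ koszul_twist vs"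
    unfolding xs koszul_twist_append by (simp add: len t_def)
  let ?w = "\<lambda>p. map (\<tau> p) (koszul_twist us) @ m (map (\<tau> t) (koszul_twist ws)) # koszul_twist vs"
  have "insert_at (\<tau> (2 - int s)) r s m (koszul_twist xs) = ?w (t + 2)"
    unfolding tw insert_at_def by (simp add: len comp_def algebra_simps)
  moreover have "twist f (insert_at \<sigma> r s (twist m) xs) = parity_sign (int (r + s * length vs)) (f (?w (t + 2)))"
  proof -
    \<comment> \<open>The three parts of the word after insertion are twisted by the number of letters behind them.\<close>
    have ins: "insert_at \<sigma> r s (twist m) xs = map \<sigma> us @ twist m ws # vs"
      unfolding insert_at_def us_def ws_def vs_def ..
    have \<sigma>us: "map (\<tau> (t + 1)) (koszul_twist (map \<sigma> us)) = map (\<lambda>x. - \<tau> (t + 2) x) (koszul_twist us)"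
      by (subst koszul_twist_map) (simp_all add: \<sigma>_def additive.minus[OF \<tau>_additive] add.commute comp_def)
    have \<tau>m: "\<tau> t (m (koszul_twist ws)) = parity_sign (t * (2 - int s)) (m (map (\<tau> t) (koszul_twist ws)))"
      by (simp add: mmap_map_\<tau>[OF m] len) (simp add: parity_sign_def)
    have "twist f (insert_at \<sigma> r s (twist m) xs)
        = f (map (\<lambda>x. - \<tau> (t + 2) x) (koszul_twist us) @ \<tau> t (m (koszul_twist ws)) # koszul_twist vs)"
      unfolding ins twist_def koszul_twist_append \<sigma>us[symmetric] by (simp add: t_def add.commute)
    also have "\<dots> = parity_sign (int r) (f (map (\<tau> (t + 2)) (koszul_twist us) @ \<tau> t (m (koszul_twist ws)) # koszul_twist vs))"
      using slot_additive_map_minus[OF mmap_slot_additive[OF f], of "[]" "\<tau> (t + 2)" "koszul_twist us"]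
      by (simp add: len)
    also have "\<dots> = parity_sign (int r) (parity_sign (t * (2 - int s)) (f (?w (t + 2))))"
      unfolding \<tau>m by (simp only: parity_sign_additive[OF slot_additiveD[OF mmap_slot_additive[OF f]]])
    also have "\<dots> = parity_sign (int (r + s * length vs)) (f (?w (t + 2)))"
      unfolding parity_sign_parity_sign by (rule parity_sign_cong) (simp add: t_def algebra_simps)
    finally show ?thesis .
  qed
  ultimately show "twist f (insert_at \<sigma> r s (twist m) xs) =
      parity_sign (int (r + s * (length xs - r - s))) (f (insert_at (\<tau> (2 - int s)) r s m (koszul_twist xs)))"
    unfolding t by simp
qed

text \<open>
  The sign $(-1)^{i-1}$ of a term with two blocks arises when the suspension of the second block passes
  \<open>f\<close> on the first block, a map of degree \<open>1 - i\<close>.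
\<close>

lemma bilin_op_twist:
  assumes \<mu>: "mmap p \<mu>" and f: "mmap (\<lambda>i. 1 - int i) f"
  shows "bilin_op (twist \<mu>) (twist f) (twist f) xs
    = (\<Sum>i\<in>{1..<length xs}. parity_sign (int i - 1)
        (\<mu> [f (map (\<tau> (1 - int (length xs - i))) (take i (koszul_twist xs))), f (drop i (koszul_twist xs))]))"
proof -
  have "bilin_op (twist \<mu>) (twist f) (twist f) xs
      = (\<Sum>i\<in>{1..<length xs}. twist \<mu> [twist f (take i xs), twist f (drop i xs)])"
    unfolding bilin_op_def cut_sum_def by (rule sum.mono_neutral_cong_right) auto
  also have "\<dots> = (\<Sum>i\<in>{1..<length xs}. parity_sign (int i - 1)
        (\<mu> [f (map (\<tau> (1 - int (length xs - i))) (take i (koszul_twist xs))), f (drop i (koszul_twist xs))]))"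
  proof (rule sum.cong[OF refl])
    fix i assume i: "i \<in> {1..<length xs}"
    define us vs where "us = take i xs" and "vs = drop i xs"
    have xs: "xs = us @ vs" and len: "length us = i" "length vs = length xs - i"
      using i by (simp_all add: us_def vs_def)
    have tw: "koszul_twist xs = map (\<tau> (int (length vs))) (koszul_twist us) @ koszul_twist vs"
      unfolding xs koszul_twist_append ..
    have "f (map (\<tau> (1 - int (length xs - i))) (take i (koszul_twist xs))) = f (map (\<tau> 1) (koszul_twist us))"
      unfolding tw by (simp add: len comp_def)
    also have "\<dots> = parity_sign (1 - int i) (\<tau> 1 (f (koszul_twist us)))"
      by (simp add: mmap_map_\<tau>[OF f] len)
    finally have l: "f (map (\<tau> (1 - int (length xs - i))) (take i (koszul_twist xs)))
        = parity_sign (1 - int i) (\<tau> 1 (f (koszul_twist us)))" .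
    have r: "f (drop i (koszul_twist xs)) = f (koszul_twist vs)"
      unfolding tw by (simp add: len)
    have "parity_sign (int i - 1) (\<mu> [parity_sign (1 - int i) y, z]) = \<mu> [y, z]" for y z
      using slot_additiveD[OF mmap_slot_additive[OF \<mu>], of "[]" "[z]"]
      by (simp add: parity_sign_additive[of "\<lambda>x. \<mu> [x, z]"]) (simp add: parity_sign_def)
    then show "twist \<mu> [twist f (take i xs), twist f (drop i xs)] = parity_sign (int i - 1)
        (\<mu> [f (map (\<tau> (1 - int (length xs - i))) (take i (koszul_twist xs))), f (drop i (koszul_twist xs))])"
      unfolding l r us_def[symmetric] vs_def[symmetric]
      by (simp add: twist_def mmap_\<tau>0[OF f])
  qed
  finally show ?thesis .
qed

lemma coder_act_\<tau>0:
  assumes "mmap p \<phi>"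
  shows "coder_act (\<tau> 0) E \<phi> = coder_act id E \<phi>"
  using mmap_absorb[OF assms, of "[]"]
  by (simp add: fun_eq_iff coder_act_def insert_at_def)

end

section \<open>Hochschild classes and A-infinity morphisms\<close>

lemma shift_simps [simp]:
  "carrier (shift M) = carrier M" "ring.add (shift M) = ring.add M" "ring.zero (shift M) = ring.zero M"
  "smult (shift M) = smult M" "gr (shift M) n = gr M (n + 1)"
  by (simp_all add: shift_def)

lemma add_monoid_shift: "add_monoid (shift M) = add_monoid M"
  by (simp add: shift_def)

lemma finsum_shift [simp]: "finsum (shift M) = finsum M"
  by (simp add: finsum_def add_monoid_shift fun_eq_iff)

lemma a_inv_shift [simp]: "a_inv (shift M) = a_inv M"
  by (simp add: a_inv_def add_monoid_shift)

lemma words_shift [simp]: "words (shift M) = words M"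
  by (simp add: words_def)

lemma additive_part_shift [simp]: "additive_part (shift M) = additive_part M"
  by (simp add: additive_part_def)

lemma emb_shift [simp]: "emb (shift M) = emb M"
  by (simp add: emb_def fun_eq_iff)

lemma prj_shift [simp]: "prj (shift M) = prj M"
  by (simp add: prj_def fun_eq_iff)

context graded_action
begin

lemma hcomps_iff:
  assumes "x \<in> carrier M" "\<And>n. c n \<in> carrier M"
  shows "x = (\<Oplus>n\<in>{n. c n \<noteq> \<zero>}. c n) \<longleftrightarrow> emb M x = (\<Sum>n\<in>{n. c n \<noteq> \<zero>}. emb M (c n))"
proof -
  have "emb M (\<Oplus>n\<in>{n. c n \<noteq> \<zero>}. c n) = (\<Sum>n\<in>{n. c n \<noteq> \<zero>}. emb M (c n))"
    by (rule emb_finsum) (simp add: assms(2))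
  then show ?thesis
    using emb_inj[OF assms(1), of "\<Oplus>n\<in>{n. c n \<noteq> \<zero>}. c n"] assms(2) by auto
qed

lemma hcomps_shift:
  assumes x: "x \<in> carrier M"
  shows "hcomps (shift M) x c \<longleftrightarrow> hcomps M x (\<lambda>n. c (n - 1))"
proof -
  have bij: "bij_betw (\<lambda>n. n - 1) {n. c (n - 1) \<noteq> \<zero>} {n. c n \<noteq> \<zero>}"
    by (rule bij_betw_byWitness[where f' = "\<lambda>n. n + 1"]) auto
  have gr: "(\<forall>n. c n \<in> gr M (n + 1)) \<longleftrightarrow> (\<forall>n. c (n - 1) \<in> gr M n)"
    by (metis add_diff_cancel_right' diff_add_cancel)
  have "x = (\<Oplus>n\<in>{n. c n \<noteq> \<zero>}. c n) \<longleftrightarrow> x = (\<Oplus>n\<in>{n. c (n - 1) \<noteq> \<zero>}. c (n - 1))"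
    if "\<forall>n. c n \<in> gr M (n + 1)"
  proof -
    have c: "c n \<in> carrier M" for n using that gr_carrier by blast
    show ?thesis
      using hcomps_iff[where c = c, OF x c] hcomps_iff[where c = "\<lambda>n. c (n - 1)", OF x c]
        sum.reindex_bij_betw[OF bij, of "\<lambda>n. emb M (c n)"] by simp
  qed
  then show ?thesis
    unfolding hcomps_def using gr bij_betw_finite[OF bij] by auto
qed

lemma graded_action_shift: "graded_action (shift M) R"
proof (intro graded_action.intro graded_action_axioms.intro)
  show "abelian_group (shift M)"
    by (rule abelian_groupI) (auto simp: a_assoc intro: a_comm l_neg intro!: bexI[of _ "\<ominus> _"])
  show "\<exists>!c. hcomps (shift M) x c" if "x \<in> carrier (shift M)" for x
  proof -
    have x: "x \<in> carrier M" using that by simp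
    show ?thesis
      unfolding hcomps_shift[OF x]
    proof (rule ex1I[of _ "\<lambda>n. hcomp x (n + 1)"])
      show "hcomps M x (\<lambda>n. hcomp x (n - 1 + 1))" using hcomps_hcomp[OF x] by simp
      show "c = (\<lambda>n. hcomp x (n + 1))" if "hcomps M x (\<lambda>n. c (n - 1))" for c
        unfolding hcomp_eq[OF x that] by simp
    qed
  qed
qed (auto intro: smult_closed smult_add gr_carrier gr_zero gr_add gr_minus gr_smult)

text \<open>
  Passing to $A[1]$ lowers degrees by one, which changes $(-1)^{pn}$ by the constant sign $(-1)^p$.
\<close>

lemma emb_koszul_shift: "emb M (koszul (shift M) p (prj M x)) = parity_sign p (u_koszul p x)"
proof -
  interpret S: graded_action "shift M" R by (rule graded_action_shift)
  have "S.u_koszul p (u_koszul 0 x) = parity_sign p (u_koszul p (u_koszul 0 x))"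
  proof (rule homogeneous_ext[OF S.\<tau>_additive additive_compose[OF additive_parity_sign \<tau>_additive]])
    fix n y assume y: "y \<in> u_gr n"
    then have "y \<in> S.u_gr (n - 1)" by (simp add: u_gr_def S.u_gr_def)
    then show "S.u_koszul p y = parity_sign p (u_koszul p y)"
      unfolding S.\<tau>_G[OF \<open>y \<in> S.u_gr (n - 1)\<close>] \<tau>_G[OF y] parity_sign_parity_sign
      by (intro parity_sign_cong) (simp add: algebra_simps)
  qed
  then show ?thesis
    by (simp only: \<tau>_absorb) (simp add: S.u_koszul_def u_koszul_0)
qed

lemma koszul_shift_closed: "x \<in> carrier M \<Longrightarrow> koszul (shift M) p x \<in> carrier M"
  using graded_action.koszul_closed[OF graded_action_shift, of x p] by simp

lemma emb_koszul_shift_1: "emb M (koszul (shift M) 1 (prj M x)) = \<sigma> x"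
  by (simp add: emb_koszul_shift parity_sign_def \<sigma>_def)

lemma emb_koszul_shift_0: "emb M (koszul (shift M) 0 (prj M x)) = u_koszul 0 x"
  by (simp add: emb_koszul_shift parity_sign_def)

text \<open>
  Shifting changes the sum of the degrees of \<open>i\<close> arguments by \<open>i\<close> and the degree of the value by one.
\<close>

lemma multimaps_shift:
  "multimaps R (shift M) (shift M) (\<lambda>_. q) d \<longleftrightarrow> multimaps R M M (\<lambda>i. q + 1 - int i) d"
proof -
  let ?L = "\<lambda>xs ds. xs \<noteq> [] \<and> length ds = length xs \<and> (\<forall>j<length xs. xs ! j \<in> gr M (ds ! j + 1)) \<longrightarrow>
    d xs \<in> gr M (sum_list ds + q + 1)"
  let ?R = "\<lambda>xs ds. xs \<noteq> [] \<and> length ds = length xs \<and> (\<forall>j<length xs. xs ! j \<in> gr M (ds ! j)) \<longrightarrow>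
    d xs \<in> gr M (sum_list ds + (q + 1 - int (length xs)))"
  have sum: "sum_list (map (\<lambda>d. d + a) ds) = sum_list ds + a * int (length ds)" for a :: int and ds
    by (induction ds) (simp_all add: algebra_simps)
  have "(\<forall>xs ds. ?L xs ds) \<longleftrightarrow> (\<forall>xs ds. ?R xs ds)"
  proof (intro iffI allI impI)
    fix xs ds assume L: "\<forall>xs ds. ?L xs ds"
      and "xs \<noteq> [] \<and> length ds = length xs \<and> (\<forall>j<length xs. xs ! j \<in> gr M (ds ! j))"
    then show "d xs \<in> gr M (sum_list ds + (q + 1 - int (length xs)))"
      using L[rule_format, of xs "map (\<lambda>d. d + (- 1)) ds"] unfolding sum by (simp add: algebra_simps)
  next
    fix xs ds assume R: "\<forall>xs ds. ?R xs ds"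
      and "xs \<noteq> [] \<and> length ds = length xs \<and> (\<forall>j<length xs. xs ! j \<in> gr M (ds ! j + 1))"
    then show "d xs \<in> gr M (sum_list ds + q + 1)"
      using R[rule_format, of xs "map (\<lambda>d. d + 1) ds"] unfolding sum by (simp add: algebra_simps)
  qed
  then show ?thesis
    unfolding multimaps_def by simp
qed

lemma map_prj_insert_at:
  assumes rs: "(r, s) \<in> splits (length us)" and E: "\<And>xs. xs \<in> words M \<Longrightarrow> E xs \<in> carrier M"
    and \<theta>: "\<And>x. prj M (\<theta> x) = koszul N p (prj M x)"
  shows "map (prj M) (insert_at \<theta> r s (lift_map E) us) = insert_op N p r s E (map (prj M) us)"
proof -
  have "take s (drop r us) \<noteq> []" using rs by (auto simp: splits_def)
  then have "prj M (lift_map E (take s (drop r us))) = E (map (prj M) (take s (drop r us)))"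
    using E[OF prj_words[of "take s (drop r us)"]] by (simp add: lift_map_def)
  then show ?thesis
    by (simp add: insert_at_def insert_op_def \<theta> take_map drop_map)
qed

lemma lift_map_coder_comp:
  assumes D: "\<And>xs. xs \<in> words M \<Longrightarrow> D xs \<in> carrier M" and E: "\<And>xs. xs \<in> words M \<Longrightarrow> E xs \<in> carrier M"
    and \<theta>: "\<And>x. \<theta> x = emb M (koszul (shift M) p (prj M x))"
  shows "lift_map (coder_comp (shift M) p D E) = coder_act \<theta> (lift_map E) (lift_map D)"
    and "xs \<in> words M \<Longrightarrow> coder_comp (shift M) p D E xs \<in> carrier M"
proof -
  have k: "prj M (\<theta> x) = koszul (shift M) p (prj M x)" for x
    by (simp add: \<theta> koszul_shift_closed)
  have ins: "D (insert_op (shift M) p r s E (map (prj M) us)) \<in> carrier M \<and>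
      emb M (D (insert_op (shift M) p r s E (map (prj M) us))) = lift_map D (insert_at \<theta> r s (lift_map E) us)"
    if "(r, s) \<in> splits (length us)" for r s us
  proof -
    have ne: "insert_at \<theta> r s (lift_map E) us \<noteq> []" by (simp add: insert_at_def)
    note eq = map_prj_insert_at[OF that E k]
    show ?thesis
      using D[OF prj_words[OF ne], unfolded eq] ne by (simp add: lift_map_def eq)
  qed
  show "lift_map (coder_comp (shift M) p D E) = coder_act \<theta> (lift_map E) (lift_map D)"
  proof
    fix us
    show "lift_map (coder_comp (shift M) p D E) us = coder_act \<theta> (lift_map E) (lift_map D) us"
    proof (cases "us = []")
      case False
      have "emb M (coder_comp (shift M) p D E (map (prj M) us))
          = (\<Sum>rs\<in>splits (length us). emb M (case rs of (r, s) \<Rightarrow> D (insert_op (shift M) p r s E (map (prj M) us))))"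
        unfolding coder_comp_def finsum_shift length_map by (rule emb_finsum) (use ins in auto)
      also have "\<dots> = coder_act \<theta> (lift_map E) (lift_map D) us"
        unfolding coder_act_def by (rule sum.cong) (use ins in auto)
      finally show ?thesis using False by (simp add: lift_map_def)
    qed simp
  qed
  show "coder_comp (shift M) p D E xs \<in> carrier M" if "xs \<in> words M"
  proof -
    have xs: "map (prj M) (map (emb M) xs) = xs" using that by (auto simp: words_def intro!: map_idI)
    show ?thesis
      unfolding coder_comp_def finsum_shift
      by (rule finsum_closed) (use ins[of _ _ "map (emb M) xs", unfolded xs] in auto)
  qed
qed

lemma prj_koszul_twist:
  "map (prj M) (koszul_twist us)
    = map (\<lambda>j. koszul M (int (length us) - 1 - int j) (map (prj M) us ! j)) [0..<length us]"
  by (rule nth_equalityI) (simp_all add: koszul_twist_nth u_koszul_def)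

lemma lift_map_bar: "lift_map (bar M f) = twist (lift_map f)"
proof
  show "lift_map (bar M f) us = twist (lift_map f) us" for us
    using prj_words[of us] prj_koszul_twist[of us] by (cases "us = []") (simp_all add: lift_map_def twist_def bar_def)
qed

lemma bar_closed:
  assumes "\<And>xs. xs \<in> words M \<Longrightarrow> f xs \<in> carrier M" "xs \<in> words M"
  shows "bar M f xs \<in> carrier M"
proof -
  have "map (\<lambda>j. koszul M (int (length xs) - 1 - int j) (xs ! j)) [0..<length xs] \<in> words M"
    using assms(2) by (auto simp: words_def intro!: koszul_closed subsetD[OF _ nth_mem])
  then show ?thesis using assms by (simp add: bar_def)
qed

lemma extensional_lift_map_inject:
  assumes "b \<in> extensional (words M)" "b' \<in> extensional (words M)"
    and "\<And>xs. xs \<in> words M \<Longrightarrow> b xs \<in> carrier M" "\<And>xs. xs \<in> words M \<Longrightarrow> b' xs \<in> carrier M"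
  shows "lift_map b = lift_map b' \<longleftrightarrow> b = b'"
  using lift_map_eq_iff[OF assms(3,4)] extensionalityI[OF assms(1,2)] by auto

lemma bar_extensional: "bar M f \<in> extensional (words M)"
  by (simp add: bar_def)

lemma lower_map_extensional: "lower_map F \<in> extensional (words M)"
  by (simp add: lower_map_def)

lemma bar_eq_lower_map:
  assumes "multimaps R M M p f"
  shows "bar M f = lower_map (twist (lift_map f))"
proof (rule extensionalityI[OF bar_extensional lower_map_extensional])
  fix xs assume xs: "xs \<in> words M"
  have "lower_map (lift_map (bar M f)) xs = bar M f xs"
    by (rule lower_map_lift[OF xs], rule bar_closed[OF multimaps_closed[OF assms] xs])
  then show "bar M f xs = lower_map (twist (lift_map f)) xs" by (simp add: lift_map_bar)
qed

lemma multimaps_bar: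
  assumes "multimaps R M M p f"
  shows "multimaps R M M p (bar M f)"
  unfolding bar_eq_lower_map[OF assms] by (rule multimaps_lower_map[OF mmap_twist[OF mmap_lift_map[OF assms]]])

lemma lift_map_hoch_diff:
  assumes m: "multimaps R M M (\<lambda>i. 2 - int i) m" and d: "multimaps R M M (\<lambda>i. 1 - int i) d"
  shows "lift_map (hoch_diff M m 0 d) = bracket (lift_map (bar M m)) (lift_map d)"
    and "xs \<in> words M \<Longrightarrow> hoch_diff M m 0 d xs \<in> carrier M"
proof -
  note bc = multimaps_closed[OF multimaps_bar[OF m]] and dc = multimaps_closed[OF d]
  note c1 = lift_map_coder_comp[OF bc dc emb_koszul_shift_0[symmetric]]
  note c2 = lift_map_coder_comp[OF dc bc emb_koszul_shift_1[symmetric]]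
  show closed: "hoch_diff M m 0 d xs \<in> carrier M" if "xs \<in> words M" for xs
    using that c1(2) c2(2) by (simp add: hoch_diff_def sgn_mult_def)
  show "lift_map (hoch_diff M m 0 d) = bracket (lift_map (bar M m)) (lift_map d)"
  proof
    fix us
    show "lift_map (hoch_diff M m 0 d) us = bracket (lift_map (bar M m)) (lift_map d) us"
    proof (cases "us = []")
      case False
      then have "lift_map (hoch_diff M m 0 d) us
          = lift_map (coder_comp (shift M) 0 (bar M m) d) us - lift_map (coder_comp (shift M) 1 d (bar M m)) us"
        using prj_words[OF False] c1(2) c2(2)
        by (simp add: lift_map_def hoch_diff_def sgn_mult_def emb_diff)
      then show ?thesis
        by (simp add: c1(1) c2(1) bracket_def coder_act_\<tau>0[OF mmap_lift_map[OF multimaps_bar[OF m]]])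
    qed (simp add: bracket_def)
  qed
qed

lemma coboundaries_hoch:
  assumes m: "multimaps R M M (\<lambda>i. 2 - int i) m"
  shows "b \<in> coboundaries (hoch_cochains R M) (hoch_diff M m) 1 \<longleftrightarrow>
    b \<in> extensional (words M) \<and> (\<forall>xs\<in>words M. b xs \<in> carrier M) \<and>
    (\<exists>g. cochain 0 g \<and> lift_map b = bracket (lift_map (bar M m)) g)" (is "?l \<longleftrightarrow> ?r")
proof
  assume ?l
  then obtain d where d: "multimaps R M M (\<lambda>i. 1 - int i) d" "b = hoch_diff M m 0 d"
    by (auto simp: coboundaries_def hoch_cochains_def multimaps_shift)
  then show ?r
    using lift_map_hoch_diff[OF m d(1)] mmap_lift_map[OF d(1)]
    by (auto simp: hoch_diff_def)
next
  assume ?r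
  then obtain g where b: "b \<in> extensional (words M)" "\<And>xs. xs \<in> words M \<Longrightarrow> b xs \<in> carrier M"
    and g: "cochain 0 g" "lift_map b = bracket (lift_map (bar M m)) g" by blast
  have d: "multimaps R M M (\<lambda>i. 1 - int i) (lower_map g)"
    using multimaps_lower_map[OF g(1)] by simp
  have "lift_map b = lift_map (hoch_diff M m 0 (lower_map g))"
    by (simp add: lift_map_hoch_diff(1)[OF m d] g lift_map_lower[OF g(1)])
  then have "b = hoch_diff M m 0 (lower_map g)"
    by (subst (asm) extensional_lift_map_inject)
      (auto simp: b lift_map_hoch_diff(2)[OF m d], simp add: hoch_diff_def)
  then show ?l
    using d lower_map_extensional by (auto simp: coboundaries_def hoch_cochains_def multimaps_shift)
qed

lemma bracket_add:
  assumes "mmap p B"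
  shows "bracket B (\<lambda>xs. g xs + g' xs) xs = bracket B g xs + bracket B g' xs"
  by (simp add: bracket_def coder_act_add coder_act_op_add[OF mmap_slot_additive[OF assms]])

lemma bracket_diff:
  assumes "mmap p B"
  shows "bracket B (\<lambda>xs. g xs - g' xs) xs = bracket B g xs - bracket B g' xs"
  by (simp add: bracket_def coder_act_diff coder_act_op_diff[OF mmap_slot_additive[OF assms]])

text \<open>
  A class is the unit of the cohomology group exactly when its representative is a coboundary, because
  the coboundaries contain zero and are closed under sums and differences. The coboundary equation is then read in
  \<open>ab_universe\<close>.
\<close>

lemma HH_class_eq_one_iff:
  assumes m: "multimaps R M M (\<lambda>i. 2 - int i) m"
    and z: "z \<in> extensional (words M)" "\<And>xs. xs \<in> words M \<Longrightarrow> z xs \<in> carrier M"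
  shows "HH_class R M m 2 z = \<one>\<^bsub>HH R M m 2\<^esub> \<longleftrightarrow>
    (\<exists>g. cochain 0 g \<and> lift_map z = bracket (lift_map (bar M m)) g)"
proof -
  let ?B = "coboundaries (hoch_cochains R M) (hoch_diff M m) 1"
  define pl where "pl = (\<lambda>b c. \<lambda>xs\<in>words M. b xs \<oplus> c xs)"
  note B = coboundaries_hoch[OF m]
  note bm = mmap_lift_map[OF multimaps_bar[OF m]]
  have lift_pl: "lift_map (pl b c) = (\<lambda>us. lift_map b us + lift_map c us)"
    if "\<And>xs. xs \<in> words M \<Longrightarrow> b xs \<in> carrier M" "\<And>xs. xs \<in> words M \<Longrightarrow> c xs \<in> carrier M" for b c
    using that by (auto simp: lift_map_def pl_def fun_eq_iff prj_words emb_add)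
  have cls: "HH_class R M m 2 z = (\<lambda>b. pl b z) ` ?B"
    by (auto simp: HH_class_def cohomology_class_def r_coset_def cocycles_def hoch_cochains_def pl_def)
  have one: "\<one>\<^bsub>HH R M m 2\<^esub> = ?B"
    by (simp add: HH_def cohomology_def FactGroup_def)
  have zB: "z \<in> ?B \<longleftrightarrow> (\<exists>g. cochain 0 g \<and> lift_map z = bracket (lift_map (bar M m)) g)"
    using z by (auto simp: B)
  have "(\<lambda>b. pl b z) ` ?B = ?B \<longleftrightarrow> z \<in> ?B"
  proof
    assume eq: "(\<lambda>b. pl b z) ` ?B = ?B"
    let ?zero = "\<lambda>xs\<in>words M. \<zero>"
    have "lift_map ?zero = (\<lambda>_. 0)" by (simp add: lift_map_def fun_eq_iff prj_words)
    moreover have "bracket (lift_map (bar M m)) (\<lambda>_. 0) = (\<lambda>_. 0)"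
      using bracket_diff[OF bm, of "\<lambda>_. 0" "\<lambda>_. 0"] by (simp add: fun_eq_iff)
    ultimately have "?zero \<in> ?B"
      using mmap_zero by (auto simp: B intro!: exI[of _ "\<lambda>_. 0"])
    moreover have "pl ?zero z = z"
      by (rule extensionalityI[of _ "words M"]) (auto simp: pl_def z)
    ultimately show "z \<in> ?B" using eq by (metis imageI)
  next
    assume "z \<in> ?B"
    then obtain g where g: "cochain 0 g" "lift_map z = bracket (lift_map (bar M m)) g"
      using zB by blast
    show "(\<lambda>b. pl b z) ` ?B = ?B"
    proof (intro equalityI subsetI)
      fix c assume "c \<in> (\<lambda>b. pl b z) ` ?B"
      then obtain b where "b \<in> ?B" "c = pl b z" by blast
      then obtain g' where b: "\<And>xs. xs \<in> words M \<Longrightarrow> b xs \<in> carrier M" "c = pl b z"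
        and g': "cochain 0 g'" "lift_map b = bracket (lift_map (bar M m)) g'" unfolding B by blast
      have "lift_map c = bracket (lift_map (bar M m)) (\<lambda>xs. g' xs + g xs)"
        by (simp add: b(2) lift_pl[OF b(1) z(2)] g g' fun_eq_iff bracket_add[OF bm])
      then show "c \<in> ?B"
        using mmap_add[OF g'(1) g(1)] b z(2) by (auto simp: B pl_def)
    next
      fix c assume "c \<in> ?B"
      then obtain g' where c: "c \<in> extensional (words M)" "\<And>xs. xs \<in> words M \<Longrightarrow> c xs \<in> carrier M"
        and g': "cochain 0 g'" "lift_map c = bracket (lift_map (bar M m)) g'" by (auto simp: B)
      define b where "b = (\<lambda>xs\<in>words M. c xs \<ominus> z xs)"
      have bc: "b xs \<in> carrier M" if "xs \<in> words M" for xs using that c z by (simp add: b_def)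
      have "lift_map b = (\<lambda>us. lift_map c us - lift_map z us)"
        using c z by (auto simp: lift_map_def b_def fun_eq_iff prj_words emb_diff)
      then have "lift_map b = bracket (lift_map (bar M m)) (\<lambda>xs. g' xs - g xs)"
        by (simp add: g g' fun_eq_iff bracket_diff[OF bm])
      then have "b \<in> ?B"
        using mmap_diff[OF g'(1) g(1)] bc by (auto simp: B b_def)
      moreover have "c = pl b z"
        by (rule extensionalityI[of _ "words M"])
          (auto simp: c pl_def b_def z a_minus_def a_assoc l_neg)
      ultimately show "c \<in> (\<lambda>b. pl b z) ` ?B" by blast
    qed
  qed
  then show ?thesis by (simp only: cls one zB)
qed

lemma compositions_finite: "finite (compositions n)"
proof (rule finite_subset)
  show "compositions n \<subseteq> {ls. set ls \<subseteq> {..n} \<and> length ls \<le> n}"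
  proof clarify
    fix ls assume ls: "ls \<in> compositions n"
    have "length ls \<le> sum_list ls" if "0 \<notin> set ls" for ls :: "nat list"
      using that by (induction ls) auto
    then show "set ls \<subseteq> {..n} \<and> length ls \<le> n"
      using ls member_le_sum_list[of _ ls] by (auto simp: compositions_def)
  qed
  show "finite {ls. set ls \<subseteq> {..n} \<and> length ls \<le> n}"
    by (rule finite_lists_length_le) simp
qed

lemma compositions_length_2: "{ls \<in> compositions n. length ls = 2} = (\<lambda>i. [i, n - i]) ` {1..<n}"
proof (intro equalityI subsetI)
  fix ls assume "ls \<in> {ls \<in> compositions n. length ls = 2}"
  then obtain a b where "ls = [a, b]" "a + b = n" "a \<noteq> 0" "b \<noteq> 0"
    by (auto simp: compositions_def numeral_2_eq_2 length_Suc_conv)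
  then show "ls \<in> (\<lambda>i. [i, n - i]) ` {1..<n}" by (auto simp: image_iff intro!: bexI[of _ a])
qed (auto simp: compositions_def)

lemma length_tensor_op [simp]: "length (tensor_op M f ls xs) = length ls"
  by (induction ls arbitrary: xs) simp_all

text \<open>
  After suspension the signs disappear. For a quadratic target only the compositions with two parts
  contribute to the right hand side of the morphism equation. The equation is evaluated at twisted
  words; these are all words, since the twist is invertible.
\<close>

lemma ainf_morphism_iff:
  assumes mA: "multimaps R M M (\<lambda>i. 2 - int i) mA" and mB: "multimaps R M M (\<lambda>i. 2 - int i) mB"
    and quad: "\<And>xs. length xs \<noteq> 2 \<Longrightarrow> mB xs = \<zero>"
  shows "ainf_morphism R M mA M mB f \<longleftrightarrow> multimaps R M M (\<lambda>i. 1 - int i) f \<and>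
    coder_act \<sigma> (lift_map (bar M mA)) (lift_map (bar M f))
      = bilin_op (lift_map (bar M mB)) (lift_map (bar M f)) (lift_map (bar M f))"
proof (cases "multimaps R M M (\<lambda>i. 1 - int i) f")
  case True
  note f = True
  note Ac = multimaps_closed[OF mA] and Bc = multimaps_closed[OF mB] and fc = multimaps_closed[OF f]
  note Fm = mmap_lift_map[OF f]
  \<comment> \<open>Both sides of the morphism equation, as functions of words over \<open>M\<close>.\<close>
  define lhs where "lhs = (\<lambda>xs. finsum M (\<lambda>(r, s). sgn_mult M (int (r + s * (length xs - r - s)))
           (f (insert_op M (2 - int s) r s mA xs))) (splits (length xs)))"
  define rhs where "rhs = (\<lambda>xs. \<Oplus>ls\<in>compositions (length xs). sgn_mult M (tensor_exp ls) (mB (tensor_op M f ls xs)))"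
  have ins: "f (insert_op M (2 - int s) r s mA (map (prj M) us)) \<in> carrier M \<and>
      emb M (f (insert_op M (2 - int s) r s mA (map (prj M) us)))
        = lift_map f (insert_at (u_koszul (2 - int s)) r s (lift_map mA) us)"
    if "(r, s) \<in> splits (length us)" for r s us
  proof -
    have ne: "insert_at (u_koszul (2 - int s)) r s (lift_map mA) us \<noteq> []" by (simp add: insert_at_def)
    have k: "prj M (u_koszul (2 - int s) x) = koszul M (2 - int s) (prj M x)" for x
      by (simp add: u_koszul_def)
    note eq = map_prj_insert_at[OF that Ac k]
    show ?thesis
      using fc[OF prj_words[OF ne], unfolded eq] ne by (simp add: lift_map_def eq)
  qed
  have lhs: "lhs (map (prj M) us) \<in> carrier M \<and> lift_map lhs us
      = (\<Sum>(r, s)\<in>splits (length us). parity_sign (int (r + s * (length us - r - s)))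
          (lift_map f (insert_at (u_koszul (2 - int s)) r s (lift_map mA) us)))" if "us \<noteq> []" for us
  proof -
    have c: "(\<lambda>(r, s). sgn_mult M (int (r + s * (length us - r - s)))
        (f (insert_op M (2 - int s) r s mA (map (prj M) us)))) \<in> splits (length us) \<rightarrow> carrier M"
      using ins by (auto intro!: sgn_mult_closed)
    have "emb M (lhs (map (prj M) us)) = (\<Sum>rs\<in>splits (length us). emb M (case rs of (r, s) \<Rightarrow>
        sgn_mult M (int (r + s * (length us - r - s))) (f (insert_op M (2 - int s) r s mA (map (prj M) us)))))"
      unfolding lhs_def length_map by (rule emb_finsum[OF c])
    also have "\<dots> = (\<Sum>(r, s)\<in>splits (length us). parity_sign (int (r + s * (length us - r - s)))
          (lift_map f (insert_at (u_koszul (2 - int s)) r s (lift_map mA) us)))"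
      by (rule sum.cong) (use ins in \<open>auto simp: emb_sgn_mult\<close>)
    finally show ?thesis
      using finsum_closed[OF c] that by (simp add: lhs_def lift_map_def)
  qed
  have rhs: "rhs (map (prj M) us) \<in> carrier M \<and> lift_map rhs us
      = (\<Sum>i\<in>{1..<length us}. parity_sign (int i - 1) (lift_map mB
          [lift_map f (map (u_koszul (1 - int (length us - i))) (take i us)), lift_map f (drop i us)]))"
    if "us \<noteq> []" for us
  proof -
    let ?n = "length us" and ?xs = "map (prj M) us"
    let ?t = "\<lambda>ls. sgn_mult M (tensor_exp ls) (mB (tensor_op M f ls ?xs))"
    have two: "?t [i, ?n - i] \<in> carrier M \<and> emb M (?t [i, ?n - i]) = parity_sign (int i - 1) (lift_map mB
          [lift_map f (map (u_koszul (1 - int (?n - i))) (take i us)), lift_map f (drop i us)])"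
      if i: "i \<in> {1..<?n}" for i
    proof -
      let ?u = "map (koszul M (1 - int (?n - i))) (take i ?xs)" and ?v = "drop i ?xs"
      have "map (koszul M 0) (take (?n - i) ?v) = ?v" using i by (auto simp: koszul_0 drop_map intro!: map_idI)
      then have op: "tensor_op M f [i, ?n - i] ?xs = [f ?u, f ?v]" by simp
      have w: "?u \<in> words M" "?v \<in> words M"
        using i by (auto simp: words_def take_map drop_map)
      have L: "lift_map f (map (u_koszul (1 - int (?n - i))) (take i us)) = emb M (f ?u)"
        "lift_map f (drop i us) = emb M (f ?v)"
        using i by (auto simp: lift_map_def take_map drop_map u_koszul_def comp_def)
      have "[f ?u, f ?v] \<in> words M" using fc[OF w(1)] fc[OF w(2)] by (simp add: words_def)
      from Bc[OF this] show ?thesis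
        unfolding op L by (simp add: sgn_mult_closed emb_sgn_mult lift_map_def fc w)
    qed
    have c: "?t \<in> compositions ?n \<rightarrow> carrier M"
    proof
      fix ls assume "ls \<in> compositions ?n"
      then show "?t ls \<in> carrier M"
      proof (cases "length ls = 2")
        case True
        then have "ls \<in> (\<lambda>i. [i, ?n - i]) ` {1..<?n}"
          using \<open>ls \<in> compositions ?n\<close> compositions_length_2[of ?n] by blast
        then show ?thesis using two by auto
      qed (simp add: quad sgn_mult_def)
    qed
    have "emb M (rhs ?xs) = (\<Sum>ls\<in>compositions ?n. emb M (?t ls))"
      unfolding rhs_def length_map by (rule emb_finsum[OF c])
    also have "\<dots> = (\<Sum>ls\<in>{ls \<in> compositions ?n. length ls = 2}. emb M (?t ls))"
      by (rule sum.mono_neutral_right[OF compositions_finite]) (auto simp: quad sgn_mult_def emb_minus)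
    also have "\<dots> = (\<Sum>i\<in>{1..<?n}. emb M (?t [i, ?n - i]))"
      unfolding compositions_length_2 by (subst sum.reindex) (auto simp: inj_on_def)
    also have "\<dots> = (\<Sum>i\<in>{1..<?n}. parity_sign (int i - 1) (lift_map mB
          [lift_map f (map (u_koszul (1 - int (?n - i))) (take i us)), lift_map f (drop i us)]))"
      by (rule sum.cong) (use two in auto)
    finally show ?thesis
      using finsum_closed[OF c] that by (simp add: rhs_def lift_map_def)
  qed
  have tw: "lift_map lhs (koszul_twist us) = coder_act \<sigma> (lift_map (bar M mA)) (lift_map (bar M f)) us"
    "lift_map rhs (koszul_twist us) = bilin_op (lift_map (bar M mB)) (lift_map (bar M f)) (lift_map (bar M f)) us"
    if "us \<noteq> []" for us
    unfolding lift_map_bar coder_act_twist[OF mmap_lift_map[OF mA] Fm] bilin_op_twist[OF mmap_lift_map[OF mB] Fm]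
    using lhs[of "koszul_twist us"] rhs[of "koszul_twist us"] that by simp_all
  have words: "xs \<in> words M \<longleftrightarrow> (\<exists>us. us \<noteq> [] \<and> xs = map (prj M) (koszul_twist us))" for xs
  proof
    assume xs: "xs \<in> words M"
    then have "map (prj M) (koszul_twist (koszul_twist (map (emb M) xs))) = xs"
      by (auto simp: koszul_twist_koszul_twist words_def u_koszul_0 intro!: map_idI)
    then show "\<exists>us. us \<noteq> [] \<and> xs = map (prj M) (koszul_twist us)"
      using xs by (intro exI[of _ "koszul_twist (map (emb M) xs)"]) (auto simp: words_def)
  qed (auto intro!: prj_words)
  have "ainf_morphism R M mA M mB f \<longleftrightarrow> (\<forall>xs\<in>words M. lhs xs = rhs xs)"
    unfolding ainf_morphism_def lhs_def rhs_def Let_def using f by simp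
  also have "\<dots> \<longleftrightarrow> (\<forall>us. us \<noteq> [] \<longrightarrow> lift_map lhs (koszul_twist us) = lift_map rhs (koszul_twist us))"
  proof -
    have "lhs (map (prj M) (koszul_twist us)) = rhs (map (prj M) (koszul_twist us)) \<longleftrightarrow>
        lift_map lhs (koszul_twist us) = lift_map rhs (koszul_twist us)" if "us \<noteq> []" for us
    proof -
      have "lift_map g (koszul_twist us) = emb M (g (map (prj M) (koszul_twist us)))" for g
        using that by (simp add: lift_map_def)
      moreover have "lhs (map (prj M) (koszul_twist us)) \<in> carrier M" "rhs (map (prj M) (koszul_twist us)) \<in> carrier M"
        using lhs[THEN conjunct1, of "koszul_twist us"] rhs[THEN conjunct1, of "koszul_twist us"] that by simp_all
      ultimately show ?thesis by (simp only: emb_inj)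
    qed
    then show ?thesis using words by (metis (no_types, lifting))
  qed
  also have "\<dots> \<longleftrightarrow> (\<forall>us. coder_act \<sigma> (lift_map (bar M mA)) (lift_map (bar M f)) us
      = bilin_op (lift_map (bar M mB)) (lift_map (bar M f)) (lift_map (bar M f)) us)"
  proof (rule all_cong1)
    fix us
    show "(us \<noteq> [] \<longrightarrow> lift_map lhs (koszul_twist us) = lift_map rhs (koszul_twist us)) \<longleftrightarrow>
      coder_act \<sigma> (lift_map (bar M mA)) (lift_map (bar M f)) us
        = bilin_op (lift_map (bar M mB)) (lift_map (bar M f)) (lift_map (bar M f)) us"
    proof (cases "us = []")
      case False
      then show ?thesis by (simp only: tw[OF False] simp_thms)
    qed (simp add: bilin_op_def)
  qed
  finally show ?thesis using f by (simp add: fun_eq_iff)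
qed (simp add: ainf_morphism_def)

lemma lift_map_\<tau>0:
  assumes "\<And>xs. xs \<in> words M \<Longrightarrow> f xs \<in> carrier M"
  shows "u_koszul 0 (lift_map f us) = lift_map f us"
  using assms[OF prj_words, of us] by (auto simp: lift_map_def u_koszul_0)

lemma lift_map_arity_part:
  "lift_map (arity_part M k f) us = (if length us = k then lift_map f us else 0)"
  by (simp add: lift_map_def arity_part_def)

lemma multimaps_arity_part:
  assumes f: "multimaps R M M p f"
  shows "multimaps R M M p (arity_part M k f)"
proof (rule multimapsI)
  show "arity_part M k f xs \<in> carrier M" if "xs \<in> words M" for xs
    using multimaps_closed[OF f that] by (simp add: arity_part_def)
  note m = mmap_lift_map[OF f]
  have "(\<lambda>x. lift_map (arity_part M k f) (us @ x # vs)) \<in> K" for us vs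
    using slot_linearD[OF mmap_slot_linear[OF m], of us vs] K_zero
    by (cases "length us + length vs + 1 = k") (simp_all add: lift_map_arity_part)
  then show "mmap p (lift_map (arity_part M k f))"
    using m by (auto simp: mmap_def slot_linear_def lift_map_arity_part G_zero additive.zero[OF \<tau>_additive])
qed

text \<open>
  The coefficient of $h^a$ in the structure of the deformation to the normal cone, as a coderivation.
\<close>

definition ainf_series :: "('a list \<Rightarrow> 'a) \<Rightarrow> nat \<Rightarrow> 'a ab_universe list \<Rightarrow> 'a ab_universe" where
  "ainf_series m a = lift_map (bar M (arity_part M (a + 2) m))"

lemma cochain_ainf_series:
  "multimaps R M M (\<lambda>i. 2 - int i) m \<Longrightarrow> cochain 1 (ainf_series m a)"
  unfolding ainf_series_def using mmap_lift_map[OF multimaps_bar[OF multimaps_arity_part]] by simp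

lemma ainf_series_twist: "ainf_series m a us = (if length us = a + 2 then twist (lift_map m) us else 0)"
  by (simp add: ainf_series_def lift_map_bar twist_def lift_map_arity_part)

lemma cohomology_zero_differential:
  assumes "\<And>x. m [x] = \<zero>"
  shows "carrier (cohomology (graded_groups M) (\<lambda>_ x. m [x]) d) = (\<lambda>x. {x}) ` gr M d"
    and "z \<in> carrier M \<Longrightarrow> cohomology_class (graded_groups M) (\<lambda>_ x. m [x]) d z = {z}"
proof -
  have B: "coboundaries (graded_groups M) (\<lambda>_ x. m [x]) d = {\<zero>}"
    using gr_zero by (auto simp: coboundaries_def graded_groups_def assms)
  have coset: "{\<zero>} #>\<^bsub>cocycles (graded_groups M) (\<lambda>_ x. m [x]) d\<^esub> z = {z}" if "z \<in> carrier M" for z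
    using that by (simp add: r_coset_def cocycles_def graded_groups_def)
  have "carrier (cohomology (graded_groups M) (\<lambda>_ x. m [x]) d)
      = (\<lambda>z. {\<zero>} #>\<^bsub>cocycles (graded_groups M) (\<lambda>_ x. m [x]) d\<^esub> z) ` gr M d"
    unfolding cohomology_def FactGroup_def RCOSETS_def B
    by (auto simp: cocycles_def graded_groups_def assms)
  also have "\<dots> = (\<lambda>x. {x}) ` gr M d"
    by (rule image_cong[OF refl]) (rule coset[OF gr_carrier])
  finally show "carrier (cohomology (graded_groups M) (\<lambda>_ x. m [x]) d) = (\<lambda>x. {x}) ` gr M d" .
  show "cohomology_class (graded_groups M) (\<lambda>_ x. m [x]) d z = {z}" if "z \<in> carrier M"
    unfolding cohomology_class_def B by (rule coset[OF that])
qed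

text \<open>
  With zero differentials, the cohomology classes are the singletons of homogeneous elements.
\<close>

lemma quasi_iso_zero_differential:
  assumes mA: "\<And>x. mA [x] = \<zero>" and mB: "\<And>x. mB [x] = \<zero>"
    and bij: "\<And>d. bij_betw (\<lambda>x. f [x]) (gr M d) (gr M d)"
  shows "bij_betw (\<lambda>c. \<Union>z\<in>c. cohomology_class (graded_groups M) (\<lambda>_ x. mB [x]) d (f [z]))
    (carrier (cohomology (graded_groups M) (\<lambda>_ x. mA [x]) d))
    (carrier (cohomology (graded_groups M) (\<lambda>_ x. mB [x]) d))"
  unfolding cohomology_zero_differential(1)[of mA, OF mA] cohomology_zero_differential(1)[of mB, OF mB]
proof (rule bij_betw_imageI)
  have cl: "(\<Union>z\<in>{x}. cohomology_class (graded_groups M) (\<lambda>_ x. mB [x]) d (f [z])) = {f [x]}" if "x \<in> gr M d" for x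
    using cohomology_zero_differential(2)[of mB, OF mB gr_carrier[OF bij_betwE[OF bij, rule_format, OF that]]] by simp
  show "inj_on (\<lambda>c. \<Union>z\<in>c. cohomology_class (graded_groups M) (\<lambda>_ x. mB [x]) d (f [z])) ((\<lambda>x. {x}) ` gr M d)"
    using bij_betw_imp_inj_on[OF bij[of d]] cl by (auto simp: inj_on_def)
  have "(\<lambda>c. \<Union>z\<in>c. cohomology_class (graded_groups M) (\<lambda>_ x. mB [x]) d (f [z])) ` (\<lambda>x. {x}) ` gr M d
      = (\<lambda>y. {y}) ` (\<lambda>x. f [x]) ` gr M d"
    unfolding image_image by (rule image_cong[OF refl]) (rule cl)
  then show "(\<lambda>c. \<Union>z\<in>c. cohomology_class (graded_groups M) (\<lambda>_ x. mB [x]) d (f [z])) ` (\<lambda>x. {x}) ` gr M d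
      = (\<lambda>x. {x}) ` gr M d"
    using bij_betw_imp_surj_on[OF bij[of d]] by simp
qed

end

section \<open>Truncated power series\<close>

text \<open>
  The convolution product: \<open>conv xs f j\<close> is the sum of $f_l(x_{1,j_1}, \dots, x_{i,j_i})$ over all
  $l + j_1 + \dots + j_i = j$, the coefficient of $h^j$ in the value of the series of multilinear maps
  \<open>f\<close> at the power series \<open>xs\<close>.
\<close>

primrec conv :: "(nat \<Rightarrow> 'v) list \<Rightarrow> (nat \<Rightarrow> 'v list \<Rightarrow> 'w::ab_group_add) \<Rightarrow> nat \<Rightarrow> 'w" where
  "conv [] f j = f j []"
| "conv (x # xs) f j = (\<Sum>i\<le>j. conv xs (\<lambda>l ys. f l (x i # ys)) (j - i))"

lemma conv_cong:
  fixes f :: "nat \<Rightarrow> 'v list \<Rightarrow> 'w::ab_group_add"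
  shows "list_all2 (\<lambda>x y. \<forall>i\<le>j. x i = y i) xs ys \<Longrightarrow> conv xs f j = conv ys f j"
proof (induction xs arbitrary: ys f j)
  case (Cons x xs)
  then obtain y ys' where ys: "ys = y # ys'" "\<forall>i\<le>j. x i = y i" "list_all2 (\<lambda>x y. \<forall>i\<le>j. x i = y i) xs ys'"
    by (auto simp: list_all2_Cons1)
  have "conv xs f' (j - i) = conv ys' f' (j - i)" if "i \<le> j" for i and f' :: "nat \<Rightarrow> 'v list \<Rightarrow> 'w"
    by (rule Cons.IH) (use ys(3) in \<open>auto elim!: list_all2_mono\<close>)
  then show ?case using ys(2) by (simp add: ys(1))
qed simp

lemma conv_additive: "additive k \<Longrightarrow> conv xs (\<lambda>l ys. k (f l ys)) j = k (conv xs f j)"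
  by (induction xs arbitrary: f j) (simp_all add: additive.sum)

lemma conv_add: "conv xs (\<lambda>l ys. f l ys + g l ys) j = conv xs f j + conv xs g j"
  by (induction xs arbitrary: f g j) (simp_all add: sum.distrib)

lemma conv_zero: "conv xs (\<lambda>l ys. 0) j = 0"
  by (induction xs arbitrary: j) simp_all

lemma conv_sum: "conv xs (\<lambda>l ys. \<Sum>a\<in>I. f a l ys) j = (\<Sum>a\<in>I. conv xs (f a) j)"
  by (induction I rule: infinite_finite_induct) (simp_all add: conv_zero conv_add)

lemma conv_0: "conv xs f 0 = f 0 (map (\<lambda>x. x 0) xs)"
  by (induction xs arbitrary: f) simp_all

lemma conv_slot_add:
  assumes "\<And>l. slot_additive (f l)"
  shows "conv (us @ (\<lambda>i. x i + y i) # vs) f j = conv (us @ x # vs) f j + conv (us @ y # vs) f j"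
  using assms
proof (induction us arbitrary: f j)
  case Nil
  have add: "additive (\<lambda>z. f l (z # ys))" for l ys
    using slot_additiveD[where us = "[]", OF Nil] by simp
  show ?case by (simp add: additive.add[OF add] conv_add sum.distrib)
next
  case (Cons u us)
  then show ?case by (simp add: slot_additive_Cons sum.distrib)
qed

text \<open>
  Convolution is linear over power series of scalars: \<open>r\<close> is such a series, and the argument is its
  product with \<open>x\<close>.
\<close>

lemma conv_slot_scale:
  fixes r :: "nat \<Rightarrow> 'v::ab_group_add \<Rightarrow> 'v" and f :: "nat \<Rightarrow> 'v list \<Rightarrow> 'v"
  assumes "\<And>l. slot_additive (f l)" "\<And>a. additive (r a)"
    and "\<And>l us y vs a. f l (us @ r a y # vs) = r a (f l (us @ y # vs))"
  shows "conv (us @ (\<lambda>i. \<Sum>a\<le>i. r a (x (i - a))) # vs) f j = (\<Sum>a\<le>j. r a (conv (us @ x # vs) f (j - a)))"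
  using assms(1,3)
proof (induction us arbitrary: f j)
  case Nil
  have add: "additive (\<lambda>z. f l (z # ys))" for l ys
    using slot_additiveD[where us = "[]", OF Nil(1)] by simp
  have r: "f l (r a z # ys) = r a (f l (z # ys))" for l a z ys
    using Nil(2)[of l "[]"] by simp
  have "conv ([] @ (\<lambda>i. \<Sum>a\<le>i. r a (x (i - a))) # vs) f j
      = (\<Sum>i\<le>j. \<Sum>a\<le>i. r a (conv vs (\<lambda>l ys. f l (x (i - a) # ys)) (j - i)))"
    by (simp add: additive.sum[OF add] r conv_sum conv_additive[OF assms(2)])
  also have "\<dots> = (\<Sum>a\<le>j. \<Sum>c\<le>j - a. r a (conv vs (\<lambda>l ys. f l (x c # ys)) (j - a - c)))"
    by (rule sum_triples_left[where f = "\<lambda>a c d. r a (conv vs (\<lambda>l ys. f l (x c # ys)) d)"])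
  finally show ?case by (simp add: additive.sum[OF assms(2)])
next
  case (Cons u us)
  have "conv (us @ (\<lambda>i. \<Sum>a\<le>i. r a (x (i - a))) # vs) (\<lambda>l ys. f l (u i # ys)) d
      = (\<Sum>a\<le>d. r a (conv (us @ x # vs) (\<lambda>l ys. f l (u i # ys)) (d - a)))" for i d
    by (rule Cons.IH) (auto intro: slot_additive_Cons[OF Cons.prems(1)] simp: Cons.prems(2)[of _ "_ # _", simplified])
  then have "conv ((u # us) @ (\<lambda>i. \<Sum>a\<le>i. r a (x (i - a))) # vs) f j
      = (\<Sum>i\<le>j. \<Sum>a\<le>j - i. r a (conv (us @ x # vs) (\<lambda>l ys. f l (u i # ys)) (j - i - a)))"
    by simp
  also have "\<dots> = (\<Sum>a\<le>j. \<Sum>c\<le>j - a. r a (conv (us @ x # vs) (\<lambda>l ys. f l (u c # ys)) (j - a - c)))"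
    by (rule sum_triples_right[where f = "\<lambda>a c d. r a (conv (us @ x # vs) (\<lambda>l ys. f l (u c # ys)) d)"])
  finally show ?case by (simp add: additive.sum[OF assms(2)])
qed

lemma conv_constants:
  assumes "\<And>l. slot_additive (f l)"
  shows "conv (map (\<lambda>x i. if i = 0 then x else 0) xs) f j = f j xs"
  using assms
proof (induction xs arbitrary: f j)
  case (Cons x xs)
  have add: "additive (\<lambda>z. f l (z # ys))" for l ys
    using slot_additiveD[where us = "[]", OF Cons.prems] by simp
  have "conv (map (\<lambda>x i. if i = 0 then x else 0) (x # xs)) f j
      = (\<Sum>i\<le>j. if i = 0 then f j (x # xs) else 0)"
    unfolding list.map conv.simps Cons.IH[OF slot_additive_Cons[OF Cons.prems]]
    by (rule sum.cong) (auto simp: additive.zero[OF add])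
  then show ?case by simp
qed simp

lemma conv_cong_length:
  assumes "\<And>l ys. length ys = length xs \<Longrightarrow> f l ys = g l ys"
  shows "conv xs f j = conv xs g j"
  using assms
proof (induction xs arbitrary: f g j)
  case (Cons x xs)
  have "conv xs (\<lambda>l ys. f l (x i # ys)) d = conv xs (\<lambda>l ys. g l (x i # ys)) d" for i d
    by (rule Cons.IH) (simp add: Cons.prems)
  then show ?case by simp
qed simp

lemma finite_sum_lists: "finite {js :: nat list. length js = n \<and> sum_list js = j}"
proof (rule finite_subset)
  show "{js. length js = n \<and> sum_list js = j} \<subseteq> {js. set js \<subseteq> {..j} \<and> length js = n}"
    using member_le_sum_list by fastforce
  show "finite {js. set js \<subseteq> {..j} \<and> length js = n}"
    by (rule finite_lists_length_eq) simp
qed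

lemma conv_eq_sum_lists:
  "conv xs (\<lambda>l ys. if l = 0 then g ys else 0) j
    = (\<Sum>js\<in>{js. length js = length xs \<and> sum_list js = j}. g (map2 (\<lambda>x l. x l) xs js))"
proof (induction xs arbitrary: g j)
  case Nil
  have "{js :: nat list. length js = length ([] :: (nat \<Rightarrow> 'x) list) \<and> sum_list js = j} = (if j = 0 then {[]} else {})"
    by auto
  then show ?case by simp
next
  case (Cons x xs)
  let ?L = "\<lambda>n j. {js :: nat list. length js = n \<and> sum_list js = j}"
  have L: "?L (Suc (length xs)) j = (\<lambda>(i, js). i # js) ` (SIGMA i:{..j}. ?L (length xs) (j - i))"
    by (auto simp: length_Suc_conv image_iff)
  have "conv (x # xs) (\<lambda>l ys. if l = 0 then g ys else 0) j
      = (\<Sum>i\<le>j. \<Sum>js\<in>?L (length xs) (j - i). g (x i # map2 (\<lambda>x l. x l) xs js))"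
    using Cons.IH by simp
  also have "\<dots> = (\<Sum>(i, js)\<in>(SIGMA i:{..j}. ?L (length xs) (j - i)). g (x i # map2 (\<lambda>x l. x l) xs js))"
    by (rule sum.Sigma) (auto intro: finite_sum_lists)
  also have "\<dots> = (\<Sum>js\<in>?L (Suc (length xs)) j. g (map2 (\<lambda>x l. x l) (x # xs) js))"
    unfolding L by (subst sum.reindex) (auto simp: inj_on_def intro!: sum.cong)
  finally show ?case by simp
qed

lemma conv_shift:
  "conv xs (\<lambda>l ys. if l = k then g ys else 0) j
    = (if k \<le> j then conv xs (\<lambda>l ys. if l = 0 then g ys else 0) (j - k) else 0)"
proof (induction xs arbitrary: g j)
  case (Cons x xs)
  have "conv (x # xs) (\<lambda>l ys. if l = k then g ys else 0) j
      = (\<Sum>i\<le>j. if k \<le> j - i then conv xs (\<lambda>l ys. if l = 0 then g (x i # ys) else 0) (j - i - k) else 0)"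
    using Cons.IH by simp
  also have "\<dots> = (if k \<le> j then \<Sum>i\<le>j - k. conv xs (\<lambda>l ys. if l = 0 then g (x i # ys) else 0) (j - k - i) else 0)"
  proof (cases "k \<le> j")
    case True
    have "j - i - k = j - k - i" for i by simp
    then show ?thesis
      using True by simp (rule sum.mono_neutral_cong_right, auto)
  next
    case False
    then have "\<not> k \<le> j - i" for i by linarith
    then show ?thesis using False by simp
  qed
  finally show ?case by simp
qed auto

lemma (in graded_space) conv_G:
  assumes "list_all2 (\<lambda>x d. \<forall>i. x i \<in> G d) xs ds"
    and "\<And>l ys. homogeneous ys ds \<Longrightarrow> f l ys \<in> G n"
  shows "conv xs f j \<in> G n"
  using assms
proof (induction xs arbitrary: ds f j)
  case Nil
  then show ?case by (simp add: homogeneous_def)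
next
  case (Cons x xs)
  then obtain d ds' where ds: "ds = d # ds'" "\<forall>i. x i \<in> G d" "list_all2 (\<lambda>x d. \<forall>i. x i \<in> G d) xs ds'"
    by (auto simp: list_all2_Cons1)
  show ?case
    unfolding conv.simps
    by (rule G_sum, rule Cons.IH[OF ds(3)], rule Cons.prems(2)) (simp add: ds)
qed

text \<open>
  The relation between a graded module \<open>V\<close> and \<open>W\<close> $= V[h]/h^N$: elements of \<open>W\<close> have coefficients
  \<open>cf\<close> and are assembled from them by \<open>mk\<close>, and \<open>H i\<close> is the multiplication with $h^i$. The scalars
  of \<open>W\<close> act by convolution with scalars of \<open>V\<close>, and each scalar of \<open>V\<close> is one of \<open>W\<close>.
\<close>

locale truncated_extension =
  V: graded_space G \<tau> S + W: graded_space G' \<tau>' S'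
  for G :: "int \<Rightarrow> 'v::ab_group_add set" and \<tau> S
    and G' :: "int \<Rightarrow> 'w::ab_group_add set" and \<tau>' S' +
  fixes cf :: "nat \<Rightarrow> 'w \<Rightarrow> 'v" and mk :: "(nat \<Rightarrow> 'v) \<Rightarrow> 'w" and H :: "nat \<Rightarrow> 'w \<Rightarrow> 'w" and N :: nat
  assumes N_pos: "0 < N"
    and cf_additive: "additive (cf j)"
    and cf_mk: "cf j (mk x) = (if j < N then \<tau> 0 (x j) else 0)"
    and mk_cf: "mk (\<lambda>j. cf j u) = \<tau>' 0 u"
    and \<tau>'_mk: "\<tau>' 0 (mk x) = mk x"
    and cf_absorb: "cf j (\<tau>' 0 u) = cf j u"
    and \<tau>_cf: "\<tau> 0 (cf j u) = cf j u"
    and cf_G: "u \<in> G' n \<Longrightarrow> cf j u \<in> G n"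
    and mk_G: "(\<And>j. x j \<in> G n) \<Longrightarrow> mk x \<in> G' n"
    and S'_cf: "\<rho> \<in> S' \<Longrightarrow> \<exists>r. (\<forall>a. r a \<in> S) \<and> (\<forall>j<N. \<forall>u. cf j (\<rho> u) = (\<Sum>a\<le>j. r a (cf (j - a) u)))"
    and H_S': "H i \<in> S'"
    and cf_H: "cf j (H i u) = (if i \<le> j \<and> j < N then cf (j - i) u else 0)"
    and S_S': "r \<in> S \<Longrightarrow> \<exists>\<rho>\<in>S'. \<forall>j u. cf j (\<rho> u) = r (cf j u)"
begin

lemma cf_ge: "N \<le> j \<Longrightarrow> cf j u = 0"
  using cf_mk[of j "\<lambda>j. cf j u"] by (simp add: mk_cf cf_absorb)

lemma cf_eqI:
  assumes "\<tau>' 0 u = u" "\<tau>' 0 v = v" "\<And>j. j < N \<Longrightarrow> cf j u = cf j v"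
  shows "u = v"
proof -
  have eq: "cf j u = cf j v" for j using assms(3) cf_ge by (cases "j < N") auto
  have "u = mk (\<lambda>j. cf j u)" by (simp only: mk_cf assms(1))
  also have "\<dots> = mk (\<lambda>j. cf j v)" by (simp only: eq)
  also have "\<dots> = v" by (simp only: mk_cf assms(2))
  finally show ?thesis .
qed

definition const :: "'v \<Rightarrow> 'w" where "const x = mk (\<lambda>i. if i = 0 then x else 0)"

lemma cf_const: "cf j (const x) = (if j = 0 then \<tau> 0 x else 0)"
  using N_pos by (simp add: const_def cf_mk additive.zero[OF V.\<tau>_additive])

lemma \<tau>'_const: "\<tau>' 0 (const x) = const x"
  by (simp add: const_def \<tau>'_mk)

lemma const_additive: "additive const"
proof
  show "const (x + y) = const x + const y" for x y
    by (rule cf_eqI) (simp_all add: \<tau>'_const additive.add[OF W.\<tau>_additive] additive.add[OF cf_additive]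
        cf_const additive.add[OF V.\<tau>_additive])
qed

lemma const_G: "x \<in> G n \<Longrightarrow> const x \<in> G' n"
  unfolding const_def by (rule mk_G) (simp add: V.G_zero)

lemma const_absorb: "const (\<tau> 0 x) = const x"
  by (rule cf_eqI) (simp_all add: \<tau>'_const cf_const)

lemma const_S:
  assumes r: "r \<in> S" and \<rho>: "\<rho> \<in> S'" "\<And>j u. cf j (\<rho> u) = r (cf j u)"
  shows "const (r x) = \<rho> (const x)"
  by (rule cf_eqI)
    (simp_all add: \<tau>'_const W.S_absorb[OF \<rho>(1)] \<rho>(2) cf_const V.S_absorb[OF r] additive.zero[OF V.S_additive[OF r]])

text \<open>
  Taking coefficients is a map between different types, while \<open>G_span\<close> speaks of endomorphisms;
  composing with \<open>const\<close> and afterwards taking the constant coefficient repairs this.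
\<close>

lemma cf_\<tau>: "cf j (\<tau>' p u) = \<tau> p (cf j u)"
proof -
  have "const (cf j (\<tau>' p (\<tau>' 0 u))) = const (\<tau> p (cf j (\<tau>' 0 u)))"
    by (rule W.homogeneous_ext[OF
          additive_compose[OF const_additive additive_compose[OF cf_additive W.\<tau>_additive]]
          additive_compose[OF const_additive additive_compose[OF V.\<tau>_additive cf_additive]]])
      (simp add: W.\<tau>_G V.\<tau>_G[OF cf_G] parity_sign_additive[OF cf_additive])
  then have "cf 0 (const (cf j (\<tau>' p u))) = cf 0 (const (\<tau> p (cf j u)))"
    by (simp add: cf_absorb)
  then show ?thesis by (simp add: cf_const \<tau>_cf)
qed

lemma const_\<tau>: "\<tau>' p (const x) = const (\<tau> p x)"
  by (rule cf_eqI) (simp_all add: \<tau>'_const cf_\<tau> cf_const additive.zero[OF V.\<tau>_additive])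

lemma const_\<sigma>: "W.\<sigma> (const x) = const (V.\<sigma> x)"
  by (simp add: W.\<sigma>_def V.\<sigma>_def const_\<tau> additive.minus[OF const_additive])

lemma koszul_twist_const: "W.koszul_twist (map const xs) = map const (V.koszul_twist xs)"
  by (induction xs) (simp_all add: const_\<tau>)

lemma expansion: "\<tau>' 0 u = (\<Sum>i<N. H i (const (cf i u)))"
proof (rule cf_eqI)
  show "\<tau>' 0 (\<Sum>i<N. H i (const (cf i u))) = (\<Sum>i<N. H i (const (cf i u)))"
    by (simp add: additive.sum[OF W.\<tau>_additive] W.S_absorb[OF H_S'])
  fix j assume j: "j < N"
  have "cf j (\<Sum>i<N. H i (const (cf i u))) = (\<Sum>i<N. if i = j then cf j u else 0)"
    unfolding additive.sum[OF cf_additive] cf_H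
    by (rule sum.cong) (auto simp: cf_const j \<tau>_cf)
  then show "cf j (\<tau>' 0 u) = cf j (\<Sum>i<N. H i (const (cf i u)))"
    using j by (simp add: cf_absorb)
qed simp

text \<open>
  The coefficients of a map over $R[h]/h^N$ on constant arguments.
\<close>

definition fam :: "('w list \<Rightarrow> 'w) \<Rightarrow> nat \<Rightarrow> 'v list \<Rightarrow> 'v" where
  "fam P j xs = cf j (P (map const xs))"

text \<open>
  Expand the argument as $\sum h^i u_i$ and pull the powers of \<open>h\<close> out of the slot.
\<close>

lemma cf_slot:
  assumes P: "W.slot_linear P" "\<And>xs. \<tau>' 0 (P xs) = P xs" and j: "j < N"
  shows "cf j (P (us @ u # vs)) = (\<Sum>i\<le>j. cf (j - i) (P (us @ const (cf i u) # vs)))"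
proof -
  note k = W.slot_linearD[OF P(1), of us vs]
  have H: "P (us @ H i x # vs) = H i (P (us @ x # vs))" for i x
    using k H_S'[of i] by (simp add: W.K_def)
  have "P (us @ u # vs) = P (us @ \<tau>' 0 u # vs)"
    using W.K_\<tau>0[OF k, of u] by (simp add: P(2))
  also have "\<dots> = (\<Sum>i<N. H i (P (us @ const (cf i u) # vs)))"
    unfolding expansion additive.sum[OF W.K_additive[OF k]] H ..
  finally have "cf j (P (us @ u # vs)) = (\<Sum>i<N. if i \<le> j then cf (j - i) (P (us @ const (cf i u) # vs)) else 0)"
    using j by (simp add: additive.sum[OF cf_additive] cf_H)
  also have "\<dots> = (\<Sum>i\<le>j. cf (j - i) (P (us @ const (cf i u) # vs)))"
    by (rule sum.mono_neutral_cong_right) (use j in auto)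
  finally show ?thesis .
qed

lemma mmap_fam:
  assumes P: "W.mmap p P"
  shows "V.mmap p (fam P j)"
  unfolding V.mmap_def V.slot_linear_def V.K_def
proof (intro conjI allI impI CollectI ballI)
  fix us vs
  note k = W.slot_linearD[OF W.mmap_slot_linear[OF P], of "map const us" "map const vs"]
  show "additive (\<lambda>x. fam P j (us @ x # vs))"
    using additive_compose[OF cf_additive additive_compose[OF W.K_additive[OF k] const_additive]]
    by (simp add: fam_def)
  show "fam P j (us @ r x # vs) = r (fam P j (us @ x # vs))" if r: "r \<in> S" for r x
  proof -
    obtain \<rho> where \<rho>: "\<rho> \<in> S'" "\<And>j u. cf j (\<rho> u) = r (cf j u)" using S_S'[OF r] by blast
    show ?thesis using k \<rho>(1) by (simp add: fam_def const_S[OF r \<rho>] W.K_def \<rho>(2))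
  qed
  show "fam P j (us @ \<tau> 0 x # vs) = \<tau> 0 (fam P j (us @ x # vs))" for x
    by (simp add: fam_def const_absorb \<tau>_cf)
next
  show "fam P j [] = 0"
    by (simp add: fam_def W.mmap_Nil[OF P] additive.zero[OF cf_additive])
  show "\<tau> 0 (fam P j xs) = fam P j xs" for xs
    by (simp add: fam_def \<tau>_cf)
  show "fam P j xs \<in> G (sum_list ds + p (length xs))" if "xs \<noteq> []" "V.homogeneous xs ds" for xs ds
  proof -
    have "W.homogeneous (map const xs) ds"
      using that(2) unfolding V.homogeneous_def W.homogeneous_def list_all2_map1
      by (rule list_all2_mono) (rule const_G)
    from W.mmap_G[OF P _ this] that(1) show ?thesis by (simp add: fam_def cf_G)
  qed
qed

text \<open>
  The letters of a word are replaced by constants from left to right, with \<open>cf_slot\<close> in each step.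
\<close>

lemma fam_unique:
  assumes P: "W.slot_linear P" "\<And>xs. \<tau>' 0 (P xs) = P xs" and Q: "W.slot_linear Q" "\<And>xs. \<tau>' 0 (Q xs) = Q xs"
    and eq: "\<And>j. j < N \<Longrightarrow> fam P j = fam Q j"
  shows "P = Q"
proof
  fix xs
  have "\<forall>j<N. cf j (P (map const ys @ xs)) = cf j (Q (map const ys @ xs))" for ys
  proof (induction xs arbitrary: ys)
    case Nil
    then show ?case using eq by (simp add: fam_def fun_eq_iff)
  next
    case (Cons x xs)
    show ?case
    proof (intro allI impI)
      fix j assume j: "j < N"
      have "cf (j - i) (P (map const ys @ const (cf i x) # xs)) = cf (j - i) (Q (map const ys @ const (cf i x) # xs))"
        for i
        using Cons.IH[of "ys @ [cf i x]"] j by simp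
      then show "cf j (P (map const ys @ x # xs)) = cf j (Q (map const ys @ x # xs))"
        by (simp add: cf_slot[OF P j] cf_slot[OF Q j])
    qed
  qed
  note * = this[of "[]"]
  show "P xs = Q xs"
    by (rule cf_eqI[OF P(2) Q(2)]) (use * in simp)
qed

lemma fam_coder_act:
  assumes P: "W.slot_linear P" "\<And>xs. \<tau>' 0 (P xs) = P xs" and j: "j < N"
    and \<theta>: "\<And>x. \<theta>' (const x) = const (\<theta> x)"
  shows "fam (coder_act \<theta>' E P) j xs = (\<Sum>i\<le>j. coder_act \<theta> (fam E i) (fam P (j - i)) xs)"
proof -
  have "cf j (P (insert_at \<theta>' r s E (map const xs))) = (\<Sum>i\<le>j. fam P (j - i) (insert_at \<theta> r s (fam E i) xs))" for r s
    by (simp add: insert_at_def fam_def cf_slot[OF P j] \<theta> take_map drop_map comp_def)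
  then show ?thesis
    by (simp add: fam_def[of "coder_act \<theta>' E P"] coder_act_def additive.sum[OF cf_additive] case_prod_unfold
        sum.swap[of _ "{..j}"])
qed

lemma fam_bilin_op:
  assumes \<mu>: "W.slot_linear \<mu>" "\<And>xs. \<tau>' 0 (\<mu> xs) = \<mu> xs" and j: "j < N"
    and \<mu>0: "\<And>i. 0 < i \<Longrightarrow> i < N \<Longrightarrow> fam \<mu> i = (\<lambda>_. 0)"
  shows "fam (bilin_op \<mu> F F') j xs = (\<Sum>a\<le>j. bilin_op (fam \<mu> 0) (fam F a) (fam F' (j - a)) xs)"
proof -
  have two: "cf j (\<mu> [u, v]) = (\<Sum>a\<le>j. fam \<mu> 0 [cf a u, cf (j - a) v])" for u v
  proof -
    have "cf j (\<mu> [u, v]) = (\<Sum>a\<le>j. cf (j - a) (\<mu> [const (cf a u), v]))"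
      using cf_slot[OF \<mu> j, of "[]"] by simp
    also have "\<dots> = (\<Sum>a\<le>j. \<Sum>b\<le>j - a. fam \<mu> (j - a - b) [cf a u, cf b v])"
      using cf_slot[OF \<mu>, of _ "[const _]" v "[]"] j by (simp add: fam_def)
    also have "\<dots> = (\<Sum>a\<le>j. \<Sum>b\<le>j - a. if b = j - a then fam \<mu> 0 [cf a u, cf (j - a) v] else 0)"
      using j by (intro sum.cong refl) (auto simp: \<mu>0)
    finally show ?thesis by simp
  qed
  have "fam (bilin_op \<mu> F F') j xs
      = cut_sum (\<lambda>u v. cf j (if map const v = [] then 0 else \<mu> [F (map const u), F' (map const v)])) xs"
    by (simp add: fam_def bilin_op_def cut_sum_def additive.sum[OF cf_additive] take_map drop_map cong: if_cong)
  also have "\<dots> = cut_sum (\<lambda>u v. \<Sum>a\<le>j. if v = [] then 0 else fam \<mu> 0 [fam F a u, fam F' (j - a) v]) xs"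
    by (rule cut_sum_cong) (auto simp: two fam_def[of F] fam_def[of F'] additive.zero[OF cf_additive])
  finally show ?thesis
    by (simp add: bilin_op_def cut_sum_def sum.swap[of _ "{..j}"])
qed

lemma fam_twist: "fam (W.twist P) j = V.twist (fam P j)"
  by (simp add: fun_eq_iff fam_def W.twist_def V.twist_def koszul_twist_const)

text \<open>
  The map over $R[h]/h^N$ with given coefficients.
\<close>

definition ext :: "(nat \<Rightarrow> 'v list \<Rightarrow> 'v) \<Rightarrow> 'w list \<Rightarrow> 'w" where
  "ext f xs = mk (conv (map (\<lambda>u i. cf i u) xs) f)"

lemma cf_ext:
  assumes "\<And>l xs. \<tau> 0 (f l xs) = f l xs"
  shows "cf j (ext f xs) = (if j < N then conv (map (\<lambda>u i. cf i u) xs) f j else 0)"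
proof -
  have "\<tau> 0 (conv us f j) = conv us f j" for us
    unfolding conv_additive[OF V.\<tau>_additive, symmetric] assms ..
  then show ?thesis by (simp add: ext_def cf_mk)
qed

lemma \<tau>'_ext: "\<tau>' 0 (ext f xs) = ext f xs"
  by (simp add: ext_def \<tau>'_mk)

lemma ext_eqI:
  assumes "\<And>l xs. \<tau> 0 (f l xs) = f l xs" "\<And>xs. \<tau>' 0 (Q xs) = Q xs"
    and "\<And>j xs. j < N \<Longrightarrow> cf j (Q xs) = conv (map (\<lambda>u i. cf i u) xs) f j"
  shows "Q = ext f"
proof
  show "Q xs = ext f xs" for xs
    by (rule cf_eqI) (simp_all add: assms \<tau>'_ext cf_ext[OF assms(1)])
qed

lemma mmap_ext:
  assumes f: "\<And>l. V.mmap p (f l)"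
  shows "W.mmap p (ext f)"
proof -
  note cf_ext = cf_ext[of f, OF V.mmap_\<tau>0[OF f]]
  note add = V.mmap_slot_additive[OF f]
  show ?thesis
    unfolding W.mmap_def W.slot_linear_def W.K_def
  proof (intro conjI allI impI CollectI ballI)
    fix us vs
    show "additive (\<lambda>u. ext f (us @ u # vs))"
    proof
      fix u v
      show "ext f (us @ (u + v) # vs) = ext f (us @ u # vs) + ext f (us @ v # vs)"
        by (rule cf_eqI)
          (simp_all add: \<tau>'_ext additive.add[OF W.\<tau>_additive] additive.add[OF cf_additive] cf_ext conv_slot_add[OF add])
    qed
    show "ext f (us @ \<rho> u # vs) = \<rho> (ext f (us @ u # vs))" if \<rho>: "\<rho> \<in> S'" for \<rho> u
    proof -
      obtain r where r: "\<And>a. r a \<in> S" "\<And>j u. j < N \<Longrightarrow> cf j (\<rho> u) = (\<Sum>a\<le>j. r a (cf (j - a) u))"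
        using S'_cf[OF \<rho>] by blast
      have fr: "f l (xs @ r a y # ys) = r a (f l (xs @ y # ys))" for l xs a y ys
        using V.slot_linearD[OF V.mmap_slot_linear[OF f[of l]], of xs ys] r(1) by (simp add: V.K_def)
      show ?thesis
      proof (rule cf_eqI)
        fix j assume j: "j < N"
        let ?us = "map (\<lambda>u i. cf i u) us" and ?vs = "map (\<lambda>u i. cf i u) vs"
        have "conv (?us @ (\<lambda>i. cf i (\<rho> u)) # ?vs) f j
            = conv (?us @ (\<lambda>i. \<Sum>a\<le>i. r a (cf (i - a) u)) # ?vs) f j"
          using j r(2) by (intro conv_cong list_all2_appendI list.rel_intros list_all2_refl) auto
        also have "\<dots> = (\<Sum>a\<le>j. r a (conv (?us @ (\<lambda>i. cf i u) # ?vs) f (j - a)))"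
          by (rule conv_slot_scale[OF add V.S_additive[OF r(1)] fr])
        finally show "cf j (ext f (us @ \<rho> u # vs)) = cf j (\<rho> (ext f (us @ u # vs)))"
          using j by (simp add: cf_ext r(2) less_imp_diff_less)
      qed (simp_all add: \<tau>'_ext W.S_absorb[OF \<rho>])
    qed
    show "ext f (us @ \<tau>' 0 u # vs) = \<tau>' 0 (ext f (us @ u # vs))" for u
      unfolding \<tau>'_ext by (simp add: ext_def cf_absorb)
  next
    show "ext f [] = 0"
      by (rule cf_eqI) (simp_all add: \<tau>'_ext cf_ext V.mmap_Nil[OF f] additive.zero[OF cf_additive]
          additive.zero[OF W.\<tau>_additive])
    show "\<tau>' 0 (ext f xs) = ext f xs" for xs by (rule \<tau>'_ext)
    show "ext f xs \<in> G' (sum_list ds + p (length xs))" if "xs \<noteq> []" "W.homogeneous xs ds" for xs ds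
      unfolding ext_def
    proof (rule mk_G, rule V.conv_G)
      show "list_all2 (\<lambda>x d. \<forall>i. x i \<in> G d) (map (\<lambda>u i. cf i u) xs) ds"
        using that(2) unfolding W.homogeneous_def list_all2_map1
        by (rule list_all2_mono) (auto intro: cf_G)
      fix l ys assume ys: "V.homogeneous ys ds"
      have len: "length ys = length xs"
        using ys that(2) unfolding V.homogeneous_def W.homogeneous_def by (metis list_all2_lengthD)
      then have "ys \<noteq> []" using that(1) by auto
      from V.mmap_G[OF f[of l] this ys] show "f l ys \<in> G (sum_list ds + p (length xs))"
        by (simp only: len)
    qed
  qed
qed

lemma fam_ext:
  assumes f: "\<And>l. V.mmap p (f l)" and j: "j < N"
  shows "fam (ext f) j = f j"
proof
  fix xs
  have "fam (ext f) j xs = conv (map (\<lambda>x i. if i = 0 then x else 0) (map (\<tau> 0) xs)) f j"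
    using j by (simp add: fam_def cf_ext[of f, OF V.mmap_\<tau>0[OF f]] cf_const comp_def)
  also have "\<dots> = f j xs"
    unfolding conv_constants[OF V.mmap_slot_additive[OF f]] by (rule V.mmap_absorb_map[OF f])
  finally show "fam (ext f) j xs = f j xs" .
qed

fun solve_triangular :: "(nat \<Rightarrow> 'v \<Rightarrow> 'v) \<Rightarrow> (nat \<Rightarrow> 'v) \<Rightarrow> nat \<Rightarrow> 'v" where
  "solve_triangular T y j = y j - (\<Sum>i<j. T (j - i) (solve_triangular T y i))"

declare solve_triangular.simps [simp del]

text \<open>
  The coefficient of $h^j$ in \<open>P [u]\<close> is that of \<open>u\<close> plus a term that depends only on lower
  coefficients of \<open>u\<close>. Such a triangular system has exactly one solution.
\<close>

lemma bij_betw_unipotent: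
  assumes P: "W.mmap (\<lambda>i. 1 - int i) P" and P0: "\<And>x. fam P 0 [x] = \<tau> 0 x"
  shows "bij_betw (\<lambda>u. P [u]) (G' d) (G' d)"
proof -
  have G\<tau>: "\<tau>' 0 u = u" if "u \<in> G' d" for u
    using W.\<tau>_G[OF that, of 0] by (simp add: parity_sign_def)
  have PG: "P [u] \<in> G' d" if "u \<in> G' d" for u
    using W.mmap_G[OF P, of "[u]" "[d]"] that by simp
  have FG: "fam P i [x] \<in> G d" if "x \<in> G d" for i x
    using V.mmap_G[OF mmap_fam[OF P], of "[x]" "[d]"] that by simp
  have Padd: "additive (\<lambda>u. P [u])"
    using W.K_additive[OF W.slot_linear_head[OF W.mmap_slot_linear[OF P], of "[]"]] .
  have cfP: "cf j (P [u]) = cf j u + (\<Sum>i<j. fam P (j - i) [cf i u])" if "j < N" for j u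
    using cf_slot[OF W.mmap_slot_linear[OF P] W.mmap_\<tau>0[OF P] that, of "[]" u "[]"]
    by (simp add: fam_def[symmetric] lessThan_Suc_atMost[symmetric] fam_def[of P _ "[_]", simplified, symmetric] P0 \<tau>_cf)
  show ?thesis
  proof (rule bij_betw_imageI)
    show "inj_on (\<lambda>u. P [u]) (G' d)"
    proof (rule inj_onI)
      fix u v assume uv: "u \<in> G' d" "v \<in> G' d" "P [u] = P [v]"
      have eq: "cf j u = cf j v" if "j < N" for j
        using that
      proof (induction j rule: less_induct)
        case (less j)
        have "(\<Sum>i<j. fam P (j - i) [cf i u]) = (\<Sum>i<j. fam P (j - i) [cf i v])"
          using less by (intro sum.cong) auto
        then show ?case using cfP[OF less.prems, of u] cfP[OF less.prems, of v] uv(3) by simp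
      qed
      show "u = v" by (rule cf_eqI[OF G\<tau>[OF uv(1)] G\<tau>[OF uv(2)] eq])
    qed
    show "(\<lambda>u. P [u]) ` G' d = G' d"
    proof (intro equalityI subsetI)
      fix y assume y: "y \<in> G' d"
      \<comment> \<open>The preimage is determined coefficient by coefficient.\<close>
      define x where "x = solve_triangular (\<lambda>i z. fam P i [z]) (\<lambda>j. cf j y)"
      have x: "x j = cf j y - (\<Sum>i<j. fam P (j - i) [x i])" for j
        unfolding x_def by (subst solve_triangular.simps) (rule refl)
      have xG: "x j \<in> G d" for j
      proof (induction j rule: less_induct)
        case (less j)
        have "(\<Sum>i<j. fam P (j - i) [x i]) \<in> G d" by (rule V.G_sum) (simp add: less FG)
        then show ?case
          using V.G_add[OF cf_G[OF y, of j] V.G_minus] by (subst x) simp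
      qed
      have mkG: "mk x \<in> G' d" by (rule mk_G) (rule xG)
      have cfx: "cf j (mk x) = x j" if "j < N" for j
        using that V.\<tau>_G[OF xG, of 0 j] by (simp add: cf_mk parity_sign_def)
      have "P [mk x] = y"
      proof (rule cf_eqI)
        fix j assume j: "j < N"
        have "(\<Sum>i<j. fam P (j - i) [cf i (mk x)]) = (\<Sum>i<j. fam P (j - i) [x i])"
          using j by (intro sum.cong) (auto simp: cfx)
        then show "cf j (P [mk x]) = cf j y"
          unfolding cfP[OF j] cfx[OF j] using x[of j] by simp
      qed (simp_all add: G\<tau> y PG[OF mkG])
      then show "y \<in> (\<lambda>u. P [u]) ` G' d" using mkG by blast
    qed (use PG in auto)
  qed
qed

end

section \<open>Base change to truncated polynomials\<close>

lemma graded_action_graded_module: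
  assumes "graded_module R A"
  shows "graded_action A R"
proof -
  interpret graded_module R A by (rule assms)
  note E = submoduleE[OF gr_submodule]
  show ?thesis
  proof (intro graded_action.intro graded_action_axioms.intro)
    show "abelian_group A" by (rule M.abelian_group_axioms)
    show "\<zero>\<^bsub>A\<^esub> \<in> gr A n" for n
      using subgroup.one_closed[OF submodule.axioms(1)[OF gr_submodule[of n]]] by simp
    show "x \<in> carrier A" if "x \<in> gr A n" for x n using E(1)[of n] that by blast
    show "\<exists>!c. hcomps A x c" if "x \<in> carrier A" for x by (rule gr_direct_sum[OF that])
  qed (auto intro: smult_r_distr E(3,4,5))
qed

locale truncated_module = graded_module R A
  for R :: "('r, 'y) ring_scheme" and A :: "('r, 'a, 'z) gmodule_scheme" +
  fixes N :: nat
  assumes N_pos: "0 < N"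
begin

sublocale A: graded_action A R
  by (rule graded_action_graded_module[OF graded_module_axioms])

abbreviation "Ah \<equiv> hmod R A N"
abbreviation "Rh \<equiv> hring R N"

lemma hmod_simps [simp]:
  "\<zero>\<^bsub>Ah\<^esub> = (\<lambda>_. \<zero>\<^bsub>A\<^esub>)" "x \<oplus>\<^bsub>Ah\<^esub> y = (\<lambda>i. x i \<oplus>\<^bsub>A\<^esub> y i)"
  by (simp_all add: hmod_def)

lemma hmod_carrier: "x \<in> carrier Ah \<longleftrightarrow> (\<forall>i. x i \<in> carrier A) \<and> (\<forall>i\<ge>N. x i = \<zero>\<^bsub>A\<^esub>)"
  by (auto simp: hmod_def) (metis M.zero_closed not_le)

lemma hmod_gr: "x \<in> gr Ah n \<longleftrightarrow> (\<forall>i. x i \<in> gr A n) \<and> (\<forall>i\<ge>N. x i = \<zero>\<^bsub>A\<^esub>)"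
  by (auto simp: hmod_def) (metis A.gr_zero not_le)

lemma hring_carrier: "p \<in> carrier Rh \<Longrightarrow> p i \<in> carrier R"
  by (cases "i < N") (auto simp: hring_def)

lemma hmod_smult:
  "(p \<odot>\<^bsub>Ah\<^esub> x) i = (if i < N then \<Oplus>\<^bsub>A\<^esub>j\<in>{..i}. p j \<odot>\<^bsub>A\<^esub> x (i - j) else \<zero>\<^bsub>A\<^esub>)"
  by (simp add: hmod_def)

lemma abelian_group_hmod: "abelian_group Ah"
proof (rule abelian_groupI)
  fix x assume x: "x \<in> carrier Ah"
  show "\<exists>y\<in>carrier Ah. y \<oplus>\<^bsub>Ah\<^esub> x = \<zero>\<^bsub>Ah\<^esub>"
    using x by (intro bexI[of _ "\<lambda>i. \<ominus>\<^bsub>A\<^esub> x i"]) (auto simp: hmod_carrier M.l_neg)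
qed (auto simp: hmod_carrier M.a_assoc fun_eq_iff intro: M.a_comm)

lemma finsum_hmod_apply:
  assumes "f \<in> I \<rightarrow> carrier Ah"
  shows "finsum Ah f I i = finsum A (\<lambda>n. f n i) I"
proof -
  interpret Ah: abelian_group Ah by (rule abelian_group_hmod)
  show ?thesis
    using assms
  proof (induction I rule: infinite_finite_induct)
    case (infinite I)
    then show ?case by (simp add: Ah.finsum_infinite M.finsum_infinite)
  next
    case (insert n I)
    then have "(\<lambda>n. f n i) \<in> I \<rightarrow> carrier A" "f n i \<in> carrier A" by (auto simp: hmod_carrier Pi_iff)
    then show ?case using insert by (simp add: M.finsum_insert)
  qed simp
qed

lemma smult_terms: "p \<in> carrier Rh \<Longrightarrow> x \<in> carrier Ah \<Longrightarrow> (\<lambda>j. p j \<odot>\<^bsub>A\<^esub> x (i - j)) \<in> I \<rightarrow> carrier A"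
  by (auto simp: hmod_carrier intro: A.smult_closed hring_carrier)

text \<open>
  Homogeneous components are taken coefficientwise. Only finitely many are nonzero, as there are \<open>N\<close>
  coefficients.
\<close>

lemma ex1_hcomps_hmod:
  assumes x: "x \<in> carrier Ah"
  shows "\<exists>!c. hcomps Ah x c"
proof (rule ex1I)
  have xi: "x i \<in> carrier A" for i using x by (simp add: hmod_carrier)
  have x0: "x i = \<zero>\<^bsub>A\<^esub>" if "N \<le> i" for i using x that by (simp add: hmod_carrier)
  define c where "c = (\<lambda>n i. if i < N then A.hcomp (x i) n else \<zero>\<^bsub>A\<^esub>)"
  have ci: "c n i \<in> gr A n" for n i by (simp add: c_def A.hcomp_gr xi A.gr_zero)
  have cA: "c n i \<in> carrier A" for n i by (rule A.gr_carrier[OF ci])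
  have cAh: "c n \<in> carrier Ah" for n by (auto simp: hmod_carrier cA) (simp add: c_def)
  let ?T = "{n. c n \<noteq> \<zero>\<^bsub>Ah\<^esub>}"
  have "?T \<subseteq> (\<Union>i<N. {n. A.hcomp (x i) n \<noteq> \<zero>\<^bsub>A\<^esub>})"
    by (auto simp: c_def fun_eq_iff split: if_splits)
  then have T: "finite ?T"
    by (rule finite_subset) (auto intro: A.finite_hcomp xi)
  have "x i = finsum Ah c ?T i" for i
  proof (cases "i < N")
    case True
    have "emb A (finsum Ah c ?T i) = emb A (finsum A (\<lambda>n. c n i) ?T)"
      by (subst finsum_hmod_apply) (auto simp: cAh)
    also have "\<dots> = (\<Sum>n\<in>?T. emb A (c n i))"
      by (rule M.emb_finsum) (auto simp: cA)
    also have "\<dots> = (\<Sum>n\<in>{n. A.hcomp (x i) n \<noteq> \<zero>\<^bsub>A\<^esub>}. emb A (A.hcomp (x i) n))"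
      by (rule sum.mono_neutral_cong_right[OF T]) (auto simp: c_def True fun_eq_iff intro!: exI[of _ i])
    also have "\<dots> = emb A (x i)" by (rule A.emb_eq_sum_hcomp[OF xi, symmetric])
    finally have "emb A (finsum A (\<lambda>n. c n i) ?T) = emb A (x i)"
      by (subst (asm) finsum_hmod_apply) (auto simp: cAh)
    then have "finsum A (\<lambda>n. c n i) ?T = x i"
      by (subst (asm) M.emb_inj) (auto simp: cA xi intro!: M.finsum_closed)
    then show ?thesis
      by (subst finsum_hmod_apply) (auto simp: cAh)
  next
    case False
    then have "finsum A (\<lambda>n. c n i) ?T = \<zero>\<^bsub>A\<^esub>" by (simp add: c_def)
    then show ?thesis
      using False by (subst finsum_hmod_apply) (auto simp: cAh x0)
  qed
  then show "hcomps Ah x c"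
    using T ci by (auto simp: hcomps_def hmod_gr c_def)
  fix c' assume c': "hcomps Ah x c'"
  have gr': "c' n i \<in> gr A n" for n i using c' by (auto simp: hcomps_def hmod_gr)
  have c'Ah: "c' n \<in> carrier Ah" for n
    using c' A.gr_carrier[OF gr'] by (auto simp: hmod_carrier hcomps_def hmod_gr)
  let ?T' = "{n. c' n \<noteq> \<zero>\<^bsub>Ah\<^esub>}"
  have T': "finite ?T'" using c' by (simp add: hcomps_def)
  have "A.hcomp (x i) = (\<lambda>n. c' n i)" for i
  proof (rule A.hcomp_eq[OF xi], rule A.hcompsI[OF xi gr' T'])
    have "x = finsum Ah c' ?T'" using c' by (simp add: hcomps_def)
    then have "x i = finsum A (\<lambda>n. c' n i) ?T'"
      using finsum_hmod_apply[of c' ?T' i] c'Ah by simp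
    then have "emb A (x i) = emb A (finsum A (\<lambda>n. c' n i) ?T')" by (rule arg_cong)
    also have "\<dots> = (\<Sum>n\<in>?T'. emb A (c' n i))"
      by (rule M.emb_finsum) (auto intro: A.gr_carrier[OF gr'])
    finally show "emb A (x i) = (\<Sum>n\<in>?T'. emb A (c' n i))" .
  qed auto
  moreover have "c' n i = \<zero>\<^bsub>A\<^esub>" if "N \<le> i" for n i
    using c' that by (simp add: hcomps_def hmod_gr)
  ultimately show "c' = c"
    by (auto simp: c_def fun_eq_iff)
qed

lemma graded_action_hmod: "graded_action Ah Rh"
proof (intro graded_action.intro graded_action_axioms.intro)
  show "abelian_group Ah" by (rule abelian_group_hmod)
  interpret Ah: abelian_group Ah by (rule abelian_group_hmod)
  show "p \<odot>\<^bsub>Ah\<^esub> x \<in> carrier Ah" if "p \<in> carrier Rh" "x \<in> carrier Ah" for p x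
    using smult_terms[OF that] by (auto simp: hmod_carrier hmod_smult intro!: M.finsum_closed)
  show "p \<odot>\<^bsub>Ah\<^esub> (x \<oplus>\<^bsub>Ah\<^esub> y) = p \<odot>\<^bsub>Ah\<^esub> x \<oplus>\<^bsub>Ah\<^esub> p \<odot>\<^bsub>Ah\<^esub> y"
    if p: "p \<in> carrier Rh" and xy: "x \<in> carrier Ah" "y \<in> carrier Ah" for p x y
  proof
    fix i
    have "finsum A (\<lambda>j. p j \<odot>\<^bsub>A\<^esub> (x (i - j) \<oplus>\<^bsub>A\<^esub> y (i - j))) {..i}
        = finsum A (\<lambda>j. p j \<odot>\<^bsub>A\<^esub> x (i - j) \<oplus>\<^bsub>A\<^esub> p j \<odot>\<^bsub>A\<^esub> y (i - j)) {..i}"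
      using xy by (intro arg_cong2[where f = "finsum A"] refl ext A.smult_add hring_carrier[OF p])
        (auto simp: hmod_carrier)
    also have "\<dots> = finsum A (\<lambda>j. p j \<odot>\<^bsub>A\<^esub> x (i - j)) {..i} \<oplus>\<^bsub>A\<^esub> finsum A (\<lambda>j. p j \<odot>\<^bsub>A\<^esub> y (i - j)) {..i}"
      by (rule M.finsum_addf[OF smult_terms[OF p xy(1)] smult_terms[OF p xy(2)]])
    finally show "(p \<odot>\<^bsub>Ah\<^esub> (x \<oplus>\<^bsub>Ah\<^esub> y)) i = (p \<odot>\<^bsub>Ah\<^esub> x \<oplus>\<^bsub>Ah\<^esub> p \<odot>\<^bsub>Ah\<^esub> y) i"
      by (simp add: hmod_smult)
  qed
  show "p \<odot>\<^bsub>Ah\<^esub> x \<in> gr Ah n" if p: "p \<in> carrier Rh" and x: "x \<in> gr Ah n" for p x n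
  proof -
    have "finsum A (\<lambda>j. p j \<odot>\<^bsub>A\<^esub> x (i - j)) I \<in> gr A n" for i and I :: "nat set"
    proof -
      have "p j \<odot>\<^bsub>A\<^esub> x (i - j) \<in> gr A n" for j
        using x by (intro A.gr_smult hring_carrier[OF p]) (simp add: hmod_gr)
      moreover from this have "p j \<odot>\<^bsub>A\<^esub> x (i - j) \<in> carrier A" for j by (rule A.gr_carrier)
      ultimately show ?thesis
        by (induction I rule: infinite_finite_induct)
          (simp_all add: A.gr_zero A.gr_add M.finsum_infinite M.finsum_insert Pi_iff)
    qed
    then show ?thesis by (simp add: hmod_gr hmod_smult A.gr_zero)
  qed
  show "\<ominus>\<^bsub>Ah\<^esub> x \<in> gr Ah n" if x: "x \<in> gr Ah n" for x n
  proof -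
    have xi: "x i \<in> gr A n" for i using x by (simp add: hmod_gr)
    have "\<ominus>\<^bsub>Ah\<^esub> x = (\<lambda>i. \<ominus>\<^bsub>A\<^esub> x i)"
      by (rule Ah.minus_equality)
        (use x in \<open>auto simp: hmod_carrier hmod_gr M.l_neg A.gr_carrier[OF xi]\<close>)
    then show ?thesis using x by (simp add: hmod_gr A.gr_minus)
  qed
  show "x \<in> carrier Ah" if "x \<in> gr Ah n" for x n
    using that by (auto simp: hmod_gr hmod_carrier intro: A.gr_carrier)
  show "\<exists>!c. hcomps Ah x c" if "x \<in> carrier Ah" for x by (rule ex1_hcomps_hmod[OF that])
qed (auto simp: hmod_gr A.gr_zero A.gr_add)

sublocale Ah: graded_action Ah Rh
  by (rule graded_action_hmod)

definition coef :: "nat \<Rightarrow> (nat \<Rightarrow> 'a) ab_universe \<Rightarrow> 'a ab_universe" where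
  "coef j u = emb A (prj Ah u j)"

definition of_coefs :: "(nat \<Rightarrow> 'a ab_universe) \<Rightarrow> (nat \<Rightarrow> 'a) ab_universe" where
  "of_coefs x = emb Ah (\<lambda>i. if i < N then prj A (x i) else \<zero>\<^bsub>A\<^esub>)"

definition hshift :: "nat \<Rightarrow> (nat \<Rightarrow> 'a) ab_universe \<Rightarrow> (nat \<Rightarrow> 'a) ab_universe" where
  "hshift i = Ah.u_smult (hpow R N i)"

lemma prj_hmod_carrier [simp]: "prj Ah u i \<in> carrier A"
  using Ah.prj_closed[of u] by (simp add: hmod_carrier)

lemma coefs_carrier: "(\<lambda>i. if i < N then prj A (x i) else \<zero>\<^bsub>A\<^esub>) \<in> carrier Ah"
  by (simp add: hmod_carrier)

lemma prj_of_coefs: "prj Ah (of_coefs x) = (\<lambda>i. if i < N then prj A (x i) else \<zero>\<^bsub>A\<^esub>)"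
  unfolding of_coefs_def by (rule Ah.prj_emb[OF coefs_carrier])

lemma coef_smult:
  assumes p: "p \<in> carrier Rh" and j: "j < N"
  shows "coef j (Ah.u_smult p u) = (\<Sum>a\<le>j. A.u_smult (p a) (coef (j - a) u))"
proof -
  have "coef j (Ah.u_smult p u) = emb A (\<Oplus>\<^bsub>A\<^esub>a\<in>{..j}. p a \<odot>\<^bsub>A\<^esub> prj Ah u (j - a))"
    using j by (simp add: coef_def Ah.prj_smult[OF p] hmod_smult)
  also have "\<dots> = (\<Sum>a\<le>j. emb A (p a \<odot>\<^bsub>A\<^esub> prj Ah u (j - a)))"
    by (rule M.emb_finsum[OF smult_terms[OF p Ah.prj_closed]])
  finally show ?thesis by (simp add: coef_def A.emb_smult hring_carrier[OF p])
qed

lemma coef_ge: "N \<le> j \<Longrightarrow> coef j u = 0"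
  using Ah.prj_closed[of u] by (simp add: coef_def hmod_carrier)

lemma u_smult_zero: "A.u_smult \<zero>\<^bsub>R\<^esub> u = 0"
proof -
  have "\<zero>\<^bsub>R\<^esub> \<odot>\<^bsub>A\<^esub> x \<oplus>\<^bsub>A\<^esub> \<zero>\<^bsub>R\<^esub> \<odot>\<^bsub>A\<^esub> x = \<zero>\<^bsub>R\<^esub> \<odot>\<^bsub>A\<^esub> x" if "x \<in> carrier A" for x
    using smult_l_distr[of "\<zero>\<^bsub>R\<^esub>" "\<zero>\<^bsub>R\<^esub>" x] that by simp
  from this[of "prj A u"] have "\<zero>\<^bsub>R\<^esub> \<odot>\<^bsub>A\<^esub> prj A u = \<zero>\<^bsub>A\<^esub>"
    using M.add.l_cancel_one'[of "\<zero>\<^bsub>R\<^esub> \<odot>\<^bsub>A\<^esub> prj A u" "\<zero>\<^bsub>R\<^esub> \<odot>\<^bsub>A\<^esub> prj A u"] by simp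
  then show ?thesis by (simp add: A.u_smult_def)
qed

lemma u_smult_one: "A.u_smult \<one>\<^bsub>R\<^esub> u = A.u_koszul 0 u"
  by (simp add: A.u_smult_def A.u_koszul_0)

lemma hpow_carrier: "hpow R N i \<in> carrier Rh"
  by (simp add: hpow_def hring_def)

lemma \<tau>_coef: "A.u_koszul 0 (coef j u) = coef j u"
  by (simp add: coef_def A.u_koszul_0)

lemma coef_hshift: "coef j (hshift i u) = (if i \<le> j \<and> j < N then coef (j - i) u else 0)"
proof (cases "j < N")
  case True
  have "coef j (hshift i u) = (\<Sum>a\<le>j. if a = i then coef (j - i) u else 0)"
    unfolding hshift_def coef_smult[OF hpow_carrier True]
    by (rule sum.cong) (use True in \<open>auto simp: hpow_def u_smult_zero u_smult_one \<tau>_coef\<close>)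
  then show ?thesis using True by simp
qed (simp add: coef_ge)

definition hconst :: "'r \<Rightarrow> nat \<Rightarrow> 'r" where "hconst a i = (if i = 0 then a else \<zero>\<^bsub>R\<^esub>)"

lemma hconst_carrier: "a \<in> carrier R \<Longrightarrow> hconst a \<in> carrier Rh"
  using N_pos by (auto simp: hconst_def hring_def)

lemma coef_hconst:
  assumes a: "a \<in> carrier R"
  shows "coef j (Ah.u_smult (hconst a) u) = A.u_smult a (coef j u)"
proof (cases "j < N")
  case True
  have "coef j (Ah.u_smult (hconst a) u) = (\<Sum>i\<le>j. if i = 0 then A.u_smult a (coef j u) else 0)"
    unfolding coef_smult[OF hconst_carrier[OF a] True]
    by (rule sum.cong) (auto simp: hconst_def u_smult_zero)
  then show ?thesis by simp
next
  case False
  then show ?thesis by (simp add: coef_ge additive.zero[OF A.additive_u_smult[OF a]])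
qed

sublocale truncated_extension A.u_gr A.u_koszul "A.u_smult ` carrier R"
  Ah.u_gr Ah.u_koszul "Ah.u_smult ` carrier Rh" coef of_coefs hshift N
proof
  show "0 < N" by (rule N_pos)
  show "coef j (x + y) = coef j x + coef j y" for j x y
    by (simp add: coef_def Ah.prj_add M.emb_add)
  show "coef j (of_coefs x) = (if j < N then A.u_koszul 0 (x j) else 0)" for j x
    by (simp add: coef_def prj_of_coefs A.u_koszul_0)
  show "of_coefs (\<lambda>j. coef j u) = Ah.u_koszul 0 u" for u
  proof -
    have "(\<lambda>i. if i < N then prj A (coef i u) else \<zero>\<^bsub>A\<^esub>) = prj Ah u"
      using Ah.prj_closed[of u] by (auto simp: coef_def hmod_carrier fun_eq_iff)
    then show ?thesis by (simp add: of_coefs_def Ah.u_koszul_0)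
  qed
  show "Ah.u_koszul 0 (of_coefs x) = of_coefs x" for x
    unfolding Ah.u_koszul_0 prj_of_coefs by (simp add: of_coefs_def)
  show "coef j (Ah.u_koszul 0 u) = coef j u" for j u
    by (simp add: coef_def Ah.u_koszul_0)
  show "A.u_koszul 0 (coef j u) = coef j u" for j u by (rule \<tau>_coef)
  show "coef j u \<in> A.u_gr n" if "u \<in> Ah.u_gr n" for j u n
    using Ah.prj_gr[OF that] by (simp add: coef_def hmod_gr A.emb_gr)
  show "of_coefs x \<in> Ah.u_gr n" if "\<And>j. x j \<in> A.u_gr n" for x n
    unfolding of_coefs_def by (rule Ah.emb_gr) (simp add: hmod_gr A.prj_gr that A.gr_zero)
  show "\<exists>r. (\<forall>a. r a \<in> A.u_smult ` carrier R) \<and> (\<forall>j<N. \<forall>u. coef j (\<rho> u) = (\<Sum>a\<le>j. r a (coef (j - a) u)))"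
    if \<rho>: "\<rho> \<in> Ah.u_smult ` carrier Rh" for \<rho>
  proof -
    obtain p where p: "p \<in> carrier Rh" "\<rho> = Ah.u_smult p" using \<rho> by blast
    then show ?thesis
      using coef_smult[OF p(1)] hring_carrier[OF p(1)] by (intro exI[of _ "\<lambda>a. A.u_smult (p a)"]) auto
  qed
  show "hshift i \<in> Ah.u_smult ` carrier Rh" for i
    by (simp add: hshift_def hpow_carrier)
  show "coef j (hshift i u) = (if i \<le> j \<and> j < N then coef (j - i) u else 0)" for i j u
    by (rule coef_hshift)
  show "\<exists>\<rho>\<in>Ah.u_smult ` carrier Rh. \<forall>j u. coef j (\<rho> u) = r (coef j u)"
    if r: "r \<in> A.u_smult ` carrier R" for r
  proof -
    obtain a where a: "a \<in> carrier R" "r = A.u_smult a" using r by blast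
    then show ?thesis
      using coef_hconst[OF a(1)] hconst_carrier[OF a(1)] by (intro bexI[of _ "Ah.u_smult (hconst a)"]) auto
  qed
qed

end

section \<open>Formality and the Kaledin class in terms of power series\<close>

context truncated_module
begin

lemma map2_words:
  assumes "xs \<in> words Ah" "length js = length xs"
  shows "map2 (\<lambda>x l. x l) xs js \<in> words A"
  using assms by (auto simp: words_def hmod_carrier dest!: set_zip_leftD)

lemma hext_terms:
  assumes f: "\<And>xs. xs \<in> words A \<Longrightarrow> f xs \<in> carrier A" and xs: "xs \<in> words Ah"
  shows "(\<lambda>js. f (map2 (\<lambda>x l. x l) xs js)) \<in> {js. length js = length xs \<and> sum_list js = j} \<rightarrow> carrier A"
  using f map2_words[OF xs] by auto

lemma hext_closed:
  assumes f: "\<And>xs. xs \<in> words A \<Longrightarrow> f xs \<in> carrier A" and xs: "xs \<in> words Ah"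
  shows "hext A N f xs \<in> carrier Ah"
proof -
  have "(\<Oplus>\<^bsub>A\<^esub>js\<in>{js. length js = length xs \<and> sum_list js = j}. f (map2 (\<lambda>x l. x l) xs js)) \<in> carrier A" for j
    by (rule M.finsum_closed, rule hext_terms[OF f xs])
  then show ?thesis by (simp add: hext_def hmod_carrier)
qed

lemma prj_coef: "prj A (coef i u) = prj Ah u i"
  by (simp add: coef_def)

lemma coef_hext:
  assumes f: "\<And>xs. xs \<in> words A \<Longrightarrow> f xs \<in> carrier A" and us: "us \<noteq> []" and j: "j < N"
  shows "coef j (emb Ah (hext A N f (map (prj Ah) us)))
    = conv (map (\<lambda>u i. coef i u) us) (\<lambda>l ys. if l = 0 then A.lift_map f ys else 0) j"
proof -
  let ?xs = "map (prj Ah) us"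
  have xs: "?xs \<in> words Ah" by (rule Ah.prj_words[OF us])
  have "coef j (emb Ah (hext A N f ?xs)) = emb A (hext A N f ?xs j)"
    by (simp add: coef_def Ah.prj_emb[OF hext_closed[OF f xs]])
  also have "\<dots> = (\<Sum>js\<in>{js. length js = length us \<and> sum_list js = j}. emb A (f (map2 (\<lambda>x l. x l) ?xs js)))"
    using j M.emb_finsum[OF hext_terms[OF f xs]] by (simp add: hext_def)
  also have "\<dots> = (\<Sum>js\<in>{js. length js = length us \<and> sum_list js = j}.
      A.lift_map f (map2 (\<lambda>x l. x l) (map (\<lambda>u i. coef i u) us) js))"
  proof (rule sum.cong[OF refl])
    fix js assume "js \<in> {js. length js = length us \<and> sum_list js = j}"
    then have len: "length js = length us" by simp
    have "map (prj A) (map2 (\<lambda>x l. x l) (map (\<lambda>u i. coef i u) us) js) = map2 (\<lambda>x l. x l) ?xs js"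
      by (rule nth_equalityI) (simp_all add: len prj_coef)
    then show "emb A (f (map2 (\<lambda>x l. x l) ?xs js))
        = A.lift_map f (map2 (\<lambda>x l. x l) (map (\<lambda>u i. coef i u) us) js)"
      using us len by (cases us; cases js) (simp_all add: A.lift_map_def)
  qed
  finally show ?thesis by (simp add: conv_eq_sum_lists)
qed

lemma lift_map_hext:
  assumes f: "multimaps R A A p f"
  shows "Ah.lift_map (hext A N f) = ext (\<lambda>l ys. if l = 0 then A.lift_map f ys else 0)"
proof (rule ext_eqI)
  note fc = A.multimaps_closed[OF f]
  show "A.u_koszul 0 (if l = 0 then A.lift_map f xs else 0) = (if l = 0 then A.lift_map f xs else 0)" for l xs
    by (simp add: A.lift_map_\<tau>0[OF fc] additive.zero[OF A.\<tau>_additive])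
  show "Ah.u_koszul 0 (Ah.lift_map (hext A N f) xs) = Ah.lift_map (hext A N f) xs" for xs
    by (rule Ah.lift_map_\<tau>0) (rule hext_closed[OF fc])
  show "coef j (Ah.lift_map (hext A N f) us)
      = conv (map (\<lambda>u i. coef i u) us) (\<lambda>l ys. if l = 0 then A.lift_map f ys else 0) j" if "j < N" for j us
    using coef_hext[OF fc _ that] by (cases "us = []") (auto simp: Ah.lift_map_def additive.zero[OF cf_additive])
qed

lemma cone_op_closed:
  assumes m: "\<And>xs. xs \<in> words A \<Longrightarrow> m xs \<in> carrier A" and xs: "xs \<in> words Ah"
  shows "cone_op R A N m xs \<in> carrier Ah"
  using Ah.smult_closed[OF hpow_carrier hext_closed[OF m xs]] Ah.zero_closed
  by (simp add: cone_op_def del: hmod_simps)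

text \<open>
  In arity \<open>i\<close> the operation is $m_i h^{i-2}$, so the coefficient of $h^j$ is concentrated in arity
  \<open>j + 2\<close>.
\<close>

lemma lift_map_cone_op:
  assumes m: "multimaps R A A p m"
  shows "Ah.lift_map (cone_op R A N m) = ext (\<lambda>j. A.lift_map (arity_part A (j + 2) m))"
proof (rule ext_eqI)
  note mc = A.multimaps_closed[OF m]
  show "A.u_koszul 0 (A.lift_map (arity_part A (l + 2) m) xs) = A.lift_map (arity_part A (l + 2) m) xs" for l xs
    by (rule A.lift_map_\<tau>0) (rule A.multimaps_closed[OF A.multimaps_arity_part[OF m]])
  show "Ah.u_koszul 0 (Ah.lift_map (cone_op R A N m) xs) = Ah.lift_map (cone_op R A N m) xs" for xs
    by (rule Ah.lift_map_\<tau>0) (rule cone_op_closed[OF mc])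
  fix j us assume j: "j < N"
  let ?xs = "map (prj Ah) us" and ?cs = "map (\<lambda>u i. coef i u) us" and ?k = "length us - 2"
  show "coef j (Ah.lift_map (cone_op R A N m) us) = conv ?cs (\<lambda>j. A.lift_map (arity_part A (j + 2) m)) j"
  proof (cases "length us < 2")
    case True
    have "conv ?cs (\<lambda>j. A.lift_map (arity_part A (j + 2) m)) j = conv ?cs (\<lambda>j ys. 0) j"
      by (rule conv_cong_length) (use True in \<open>simp add: A.lift_map_arity_part\<close>)
    then show ?thesis
      using True Ah.emb_zero
      by (simp add: Ah.lift_map_def cone_op_def conv_zero additive.zero[OF cf_additive] del: Ah.emb_zero hmod_simps)
  next
    case False
    then have us: "us \<noteq> []" by auto
    have "conv ?cs (\<lambda>j. A.lift_map (arity_part A (j + 2) m)) j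
        = conv ?cs (\<lambda>l ys. if l = ?k then A.lift_map m ys else 0) j"
      by (rule conv_cong_length) (use False in \<open>auto simp: A.lift_map_arity_part\<close>)
    also have "\<dots> = (if ?k \<le> j then coef (j - ?k) (emb Ah (hext A N m ?xs)) else 0)"
      unfolding conv_shift[where k = ?k] using j coef_hext[OF mc us] by simp
    also have "\<dots> = coef j (hshift ?k (emb Ah (hext A N m ?xs)))"
      using j by (simp add: coef_hshift)
    also have "hshift ?k (emb Ah (hext A N m ?xs)) = Ah.lift_map (cone_op R A N m) us"
    proof -
      have "hext A N m ?xs \<in> carrier Ah"
        by (rule hext_closed[OF _ Ah.prj_words[OF us]]) (rule mc)
      then show ?thesis
        using False us by (simp add: Ah.lift_map_def cone_op_def hshift_def Ah.emb_smult[OF hpow_carrier])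
    qed
    finally show ?thesis by simp
  qed
qed

text \<open>
  The same observation for $(i-2)\, m_i h^{i-3}$, whose coefficient of $h^j$ is concentrated in arity
  \<open>j + 3\<close>, where \<open>i - 2 = j + 1\<close>.
\<close>

lemma lift_map_kaledin_cocycle:
  assumes m: "multimaps R A A (\<lambda>i. 2 - int i) m"
  shows "Ah.lift_map (kaledin_cocycle R A m N) = ext (\<lambda>j ys. nat_times (Suc j) (A.ainf_series m (Suc j) ys))"
    and "xs \<in> words Ah \<Longrightarrow> kaledin_cocycle R A m N xs \<in> carrier Ah"
proof -
  note bc = A.multimaps_closed[OF A.multimaps_bar[OF m]]
  have h: "hpow R N k \<odot>\<^bsub>Ah\<^esub> hext A N (bar A m) xs \<in> carrier Ah" if "xs \<in> words Ah" for k xs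
    by (rule Ah.smult_closed[OF hpow_carrier], rule hext_closed[OF _ that]) (rule bc)
  show closed: "kaledin_cocycle R A m N xs \<in> carrier Ah" if "xs \<in> words Ah" for xs
    using that h Ah.zero_closed by (auto simp: kaledin_cocycle_def Ah.add.nat_pow_closed simp del: hmod_simps)
  show "Ah.lift_map (kaledin_cocycle R A m N) = ext (\<lambda>j ys. nat_times (Suc j) (A.ainf_series m (Suc j) ys))"
  proof (rule ext_eqI)
    show "A.u_koszul 0 (nat_times (Suc l) (A.ainf_series m (Suc l) xs)) = nat_times (Suc l) (A.ainf_series m (Suc l) xs)" for l xs
      by (rule A.mmap_\<tau>0[OF A.mmap_nat_times[OF A.cochain_ainf_series[OF m]]])
    show "Ah.u_koszul 0 (Ah.lift_map (kaledin_cocycle R A m N) xs) = Ah.lift_map (kaledin_cocycle R A m N) xs" for xs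
      by (rule Ah.lift_map_\<tau>0) (rule closed)
    fix j us assume j: "j < N"
    let ?xs = "map (prj Ah) us" and ?cs = "map (\<lambda>u i. coef i u) us" and ?k = "length us - 3"
    let ?f = "\<lambda>j ys. nat_times (Suc j) (A.ainf_series m (Suc j) ys)"
    show "coef j (Ah.lift_map (kaledin_cocycle R A m N) us) = conv ?cs ?f j"
    proof (cases "length us < 3")
      case True
      have "conv ?cs ?f j = conv ?cs (\<lambda>j ys. 0) j"
        by (rule conv_cong_length) (use True in \<open>simp add: A.ainf_series_twist del: nat_times.simps\<close>)
      then show ?thesis
        using True Ah.emb_zero
        by (simp add: Ah.lift_map_def kaledin_cocycle_def conv_zero additive.zero[OF cf_additive] Ah.prj_words
            del: Ah.emb_zero hmod_simps)
    next
      case False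
      then have us: "us \<noteq> []" by auto
      let ?n = "length us - 2"
      have "conv ?cs ?f j = conv ?cs (\<lambda>l ys. if l = ?k then nat_times ?n (A.lift_map (bar A m) ys) else 0) j"
        by (rule conv_cong_length)
          (use False in \<open>auto simp: A.ainf_series_twist A.lift_map_bar simp del: nat_times.simps\<close>)
      also have "\<dots> = (if ?k \<le> j then conv ?cs (\<lambda>l ys. nat_times ?n (if l = 0 then A.lift_map (bar A m) ys else 0)) (j - ?k) else 0)"
        unfolding conv_shift[where k = ?k] by (simp add: if_distrib cong: if_cong)
      also have "\<dots> = nat_times ?n (if ?k \<le> j then coef (j - ?k) (emb Ah (hext A N (bar A m) ?xs)) else 0)"
        unfolding conv_additive[OF additive_nat_times] using j coef_hext[OF bc us] by simp
      also have "\<dots> = coef j (nat_times ?n (hshift ?k (emb Ah (hext A N (bar A m) ?xs))))"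
        using j by (simp add: coef_hshift additive_nat_times_commute[OF cf_additive])
      also have "nat_times ?n (hshift ?k (emb Ah (hext A N (bar A m) ?xs))) = Ah.lift_map (kaledin_cocycle R A m N) us"
      proof -
        have "hext A N (bar A m) ?xs \<in> carrier Ah"
          by (rule hext_closed[OF _ Ah.prj_words[OF us]]) (rule bc)
        then show ?thesis
          using False us
          by (simp add: Ah.lift_map_def kaledin_cocycle_def Ah.prj_words hshift_def Ah.emb_smult[OF hpow_carrier]
              Ah.emb_add_pow[OF h[OF Ah.prj_words[OF us]]])
      qed
      finally show ?thesis by simp
    qed
  qed
qed

lemma multimaps_cone_op:
  assumes m: "multimaps R A A (\<lambda>i. 2 - int i) m"
  shows "multimaps Rh Ah Ah (\<lambda>i. 2 - int i) (cone_op R A N m)"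
proof (rule Ah.multimapsI)
  show "cone_op R A N m xs \<in> carrier Ah" if "xs \<in> words Ah" for xs
    by (rule cone_op_closed[OF _ that]) (rule A.multimaps_closed[OF m])
  show "Ah.mmap (\<lambda>i. 2 - int i) (Ah.lift_map (cone_op R A N m))"
    unfolding lift_map_cone_op[OF m]
    by (intro mmap_ext A.mmap_lift_map A.multimaps_arity_part m)
qed

lemma mmap_constant_series:
  "A.mmap p f \<Longrightarrow> A.mmap p (\<lambda>ys. if l = 0 then f ys else 0)" for l :: nat
  by (cases "l = 0") (simp_all add: A.mmap_zero)

lemma multimaps_hext:
  assumes f: "multimaps R A A p f"
  shows "multimaps Rh Ah Ah p (hext A N f)"
proof (rule Ah.multimapsI)
  show "hext A N f xs \<in> carrier Ah" if "xs \<in> words Ah" for xs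
    by (rule hext_closed[OF _ that]) (rule A.multimaps_closed[OF f])
  show "Ah.mmap p (Ah.lift_map (hext A N f))"
    unfolding lift_map_hext[OF f] by (intro mmap_ext mmap_constant_series A.mmap_lift_map f)
qed

lemma hext_arity_part_zero: "length xs \<noteq> k \<Longrightarrow> hext A N (arity_part A k f) xs = \<zero>\<^bsub>Ah\<^esub>"
proof -
  assume len: "length xs \<noteq> k"
  have "(\<Oplus>\<^bsub>A\<^esub>js\<in>{js. length js = length xs \<and> sum_list js = j}. arity_part A k f (map2 (\<lambda>x l. x l) xs js))
      = (\<Oplus>\<^bsub>A\<^esub>js\<in>{js. length js = length xs \<and> sum_list js = j}. \<zero>\<^bsub>A\<^esub>)" for j
    by (rule M.finsum_cong') (use len in \<open>auto simp: arity_part_def\<close>)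
  then show ?thesis by (simp add: hext_def fun_eq_iff)
qed

lemma fam_cone_op:
  assumes m: "multimaps R A A (\<lambda>i. 2 - int i) m" and j: "j < N"
  shows "fam (Ah.lift_map (bar Ah (cone_op R A N m))) j = A.ainf_series m j"
proof -
  have "A.mmap (\<lambda>i. 2 - int i) (A.lift_map (arity_part A (l + 2) m))" for l
    by (intro A.mmap_lift_map A.multimaps_arity_part m)
  from fam_ext[of _ "\<lambda>l. A.lift_map (arity_part A (l + 2) m)", OF this j] show ?thesis
    by (simp add: Ah.lift_map_bar fam_twist lift_map_cone_op[OF m] A.ainf_series_def A.lift_map_bar)
qed

lemma fam_hext:
  assumes f: "multimaps R A A p f" and j: "j < N"
  shows "fam (Ah.lift_map (bar Ah (hext A N f))) j = (\<lambda>ys. if j = 0 then A.lift_map (bar A f) ys else 0)"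
proof -
  have "A.mmap p (\<lambda>ys. if l = 0 then A.lift_map f ys else 0)" for l :: nat
    by (intro mmap_constant_series A.mmap_lift_map f)
  from fam_ext[of _ "\<lambda>l ys. if l = 0 then A.lift_map f ys else 0", OF this j] show ?thesis
    by (simp add: Ah.lift_map_bar fam_twist lift_map_hext[OF f] A.lift_map_bar A.twist_def fun_eq_iff)
qed

text \<open>
  Both sides of the morphism equation are multilinear over $R[h]/h^N$, so they are compared on constant
  arguments and coefficient by coefficient.
\<close>

lemma morphism_iff_formality_defect:
  assumes m: "multimaps R A A (\<lambda>i. 2 - int i) m" and \<gamma>: "multimaps Rh Ah Ah (\<lambda>i. 1 - int i) \<gamma>"
  shows "ainf_morphism Rh Ah (cone_op R A N m) Ah (hext A N (arity_part A 2 m)) \<gamma> \<longleftrightarrow>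
    (\<forall>j<N. A.formality_defect (A.ainf_series m) (fam (Ah.lift_map (bar Ah \<gamma>))) j = (\<lambda>_. 0))"
proof -
  note m2 = A.multimaps_arity_part[OF m, of 2]
  let ?B = "Ah.lift_map (bar Ah (cone_op R A N m))" and ?F = "Ah.lift_map (bar Ah \<gamma>)"
    and ?\<mu> = "Ah.lift_map (bar Ah (hext A N (arity_part A 2 m)))"
  have F: "Ah.mmap (\<lambda>i. 1 - int i) ?F" by (intro Ah.mmap_lift_map Ah.multimaps_bar \<gamma>)
  have B: "Ah.mmap (\<lambda>i. 2 - int i) ?B" by (intro Ah.mmap_lift_map Ah.multimaps_bar multimaps_cone_op m)
  have \<mu>: "Ah.mmap (\<lambda>i. 2 - int i) ?\<mu>" by (intro Ah.mmap_lift_map Ah.multimaps_bar multimaps_hext m2)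
  have L: "fam (coder_act Ah.\<sigma> ?B ?F) j xs
      = (\<Sum>a\<le>j. coder_act A.\<sigma> (A.ainf_series m a) (fam ?F (j - a)) xs)" if j: "j < N" for j xs
    unfolding fam_coder_act[where \<theta>' = Ah.\<sigma> and \<theta> = A.\<sigma> and P = ?F, OF Ah.mmap_slot_linear[OF F] Ah.mmap_\<tau>0[OF F] j const_\<sigma>]
    by (rule sum.cong[OF refl]) (use j in \<open>simp add: fam_cone_op[OF m]\<close>)
  have "fam ?\<mu> i = (\<lambda>_. 0)" if "0 < i" "i < N" for i
    using fam_hext[OF m2 that(2)] that(1) by simp
  moreover have "fam ?\<mu> 0 = A.ainf_series m 0"
    using fam_hext[OF m2 N_pos] by (simp add: A.ainf_series_def numeral_2_eq_2)
  ultimately have R: "fam (bilin_op ?\<mu> ?F ?F) j xs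
      = (\<Sum>a\<le>j. bilin_op (A.ainf_series m 0) (fam ?F a) (fam ?F (j - a)) xs)" if j: "j < N" for j xs
    using fam_bilin_op[OF Ah.mmap_slot_linear[OF \<mu>] Ah.mmap_\<tau>0[OF \<mu>] j] by simp
  have "coder_act Ah.\<sigma> ?B ?F = bilin_op ?\<mu> ?F ?F \<longleftrightarrow>
      (\<forall>j<N. fam (coder_act Ah.\<sigma> ?B ?F) j = fam (bilin_op ?\<mu> ?F ?F) j)"
  proof (rule iffI)
    assume eq: "\<forall>j<N. fam (coder_act Ah.\<sigma> ?B ?F) j = fam (bilin_op ?\<mu> ?F ?F) j"
    show "coder_act Ah.\<sigma> ?B ?F = bilin_op ?\<mu> ?F ?F"
    proof (rule fam_unique)
      show "Ah.slot_linear (coder_act Ah.\<sigma> ?B ?F)"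
        by (intro Ah.slot_linear_coder_act Ah.mmap_slot_linear[OF B] Ah.mmap_slot_linear[OF F] Ah.\<sigma>_K)
      show "Ah.slot_linear (bilin_op ?\<mu> ?F ?F)"
        by (intro Ah.slot_linear_bilin_op Ah.mmap_slot_linear[OF \<mu>] Ah.mmap_slot_linear[OF F])
      show "Ah.u_koszul 0 (coder_act Ah.\<sigma> ?B ?F xs) = coder_act Ah.\<sigma> ?B ?F xs" for xs
        by (simp add: coder_act_def additive.sum[OF Ah.\<tau>_additive] Ah.mmap_\<tau>0[OF F] case_prod_unfold)
      show "Ah.u_koszul 0 (bilin_op ?\<mu> ?F ?F xs) = bilin_op ?\<mu> ?F ?F xs" for xs
        by (rule Ah.mmap_bilin_op_\<tau>0[OF \<mu>])
    qed (use eq in blast)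
  qed simp
  also have "\<dots> \<longleftrightarrow> (\<forall>j<N. A.formality_defect (A.ainf_series m) (fam ?F) j = (\<lambda>_. 0))"
    by (auto simp: fun_eq_iff A.formality_defect_def L R)
  finally show ?thesis
    using Ah.ainf_morphism_iff[OF multimaps_cone_op[OF m] multimaps_hext[OF m2], of \<gamma>]
      hext_arity_part_zero \<gamma> by blast
qed

text \<open>
  A morphism yields the series of its coefficients on constants. Conversely, a series is extended to
  $A[h]/h^{n+1}$; the result is the identity modulo \<open>h\<close>, hence unipotent in arity one, hence a
  quasi-isomorphism.
\<close>

lemma n_formal_iff_series:
  assumes m: "multimaps R A A (\<lambda>i. 2 - int i) m" and N: "N = n + 1"
  shows "n_formal R A m n \<longleftrightarrow>
    (\<exists>F. F 0 = A.unit_map \<and> (\<forall>a. A.cochain 0 (F a)) \<and>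
      (\<forall>j\<le>n. A.formality_defect (A.ainf_series m) F j = (\<lambda>_. 0)))"
proof
  let ?cone = "cone_op R A N m" and ?\<mu> = "hext A N (arity_part A 2 m)"
  assume "n_formal R A m n"
  then obtain \<gamma> where mor: "ainf_morphism Rh Ah ?cone Ah ?\<mu> \<gamma>"
    and \<gamma>1: "\<And>x. x \<in> carrier Ah \<Longrightarrow> \<gamma> [x] 0 = x 0"
    and \<gamma>2: "\<And>xs. xs \<in> words Ah \<Longrightarrow> 2 \<le> length xs \<Longrightarrow> \<gamma> xs 0 = \<zero>\<^bsub>A\<^esub>"
    unfolding n_formal_def ainf_quasi_iso_def N by blast
  have \<gamma>: "multimaps Rh Ah Ah (\<lambda>i. 1 - int i) \<gamma>" using mor by (simp add: ainf_morphism_def)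
  let ?F = "Ah.lift_map (bar Ah \<gamma>)"
  have Fm: "Ah.mmap (\<lambda>i. 1 - int i) ?F" by (intro Ah.mmap_lift_map Ah.multimaps_bar \<gamma>)
  have F0: "fam ?F 0 xs = A.unit_map xs" for xs
  proof -
    let ?us = "Ah.koszul_twist (map const xs)"
    have F: "fam ?F 0 xs = (if xs = [] then 0 else emb A (\<gamma> (map (prj Ah) ?us) 0))"
    proof (cases "xs = []")
      case False
      then have "map (prj Ah) ?us \<in> words Ah" by (intro Ah.prj_words) simp
      from Ah.prj_emb[OF Ah.multimaps_closed[OF \<gamma> this]] False show ?thesis
        by (simp add: fam_def Ah.lift_map_bar Ah.twist_def Ah.lift_map_def coef_def)
    next
      case True
      have "fam ?F 0 [] = 0" by (rule A.mmap_Nil[OF mmap_fam[OF Fm]])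
      with True show ?thesis by simp
    qed
    consider "xs = []" | x where "xs = [x]" | "2 \<le> length xs"
      by (cases xs rule: remdups_adj.cases) auto
    then show ?thesis
    proof cases
      case 1
      then show ?thesis unfolding F by simp
    next
      case (2 x)
      have "emb A (\<gamma> [prj Ah (const x)] 0) = coef 0 (const x)"
        by (simp only: \<gamma>1[OF Ah.prj_closed] coef_def)
      then show ?thesis unfolding F using 2 by (simp add: \<tau>'_const cf_const)
    next
      case 3
      then have "map (prj Ah) ?us \<in> words Ah" by (intro Ah.prj_words) auto
      then have "\<gamma> (map (prj Ah) ?us) 0 = \<zero>\<^bsub>A\<^esub>" using 3 by (intro \<gamma>2) simp_all
      then show ?thesis unfolding F using 3 by (simp add: A.unit_map_eq_0)
    qed
  qed
  have "fam ?F 0 = A.unit_map" using F0 by (simp add: fun_eq_iff)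
  moreover have "A.cochain 0 (fam ?F a)" for a using mmap_fam[OF Fm] by simp
  moreover have "A.formality_defect (A.ainf_series m) (fam ?F) j = (\<lambda>_. 0)" if "j \<le> n" for j
    using morphism_iff_formality_defect[OF m \<gamma>] mor that N by simp
  ultimately show "\<exists>F. F 0 = A.unit_map \<and> (\<forall>a. A.cochain 0 (F a)) \<and>
      (\<forall>j\<le>n. A.formality_defect (A.ainf_series m) F j = (\<lambda>_. 0))" by blast
next
  let ?cone = "cone_op R A N m" and ?\<mu> = "hext A N (arity_part A 2 m)"
  assume "\<exists>F. F 0 = A.unit_map \<and> (\<forall>a. A.cochain 0 (F a)) \<and>
      (\<forall>j\<le>n. A.formality_defect (A.ainf_series m) F j = (\<lambda>_. 0))"
  then obtain F where F0: "F 0 = A.unit_map" and F: "\<And>a. A.cochain 0 (F a)"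
    and X: "\<And>j. j \<le> n \<Longrightarrow> A.formality_defect (A.ainf_series m) F j = (\<lambda>_. 0)" by blast
  \<comment> \<open>The suspended morphism.\<close>
  define P where "P = ext F"
  have F': "A.mmap (\<lambda>i. 1 - int i) (F a)" for a using F[of a] by simp
  have P: "Ah.mmap (\<lambda>i. 1 - int i) P" unfolding P_def by (rule mmap_ext[OF F'])
  \<comment> \<open>Suspension is an involution, so it also removes the suspension from \<open>P\<close>.\<close>
  define \<gamma> where "\<gamma> = bar Ah (Ah.lower_map P)"
  have \<gamma>: "multimaps Rh Ah Ah (\<lambda>i. 1 - int i) \<gamma>"
    unfolding \<gamma>_def by (intro Ah.multimaps_bar Ah.multimaps_lower_map P)
  have lift\<gamma>: "Ah.lift_map \<gamma> = Ah.twist P"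
    unfolding \<gamma>_def Ah.lift_map_bar Ah.lift_map_lower[OF P] ..
  have lift_bar\<gamma>: "Ah.lift_map (bar Ah \<gamma>) = P"
    unfolding Ah.lift_map_bar lift\<gamma> by (rule Ah.twist_twist[OF P])
  have famP: "fam P j = F j" if "j < N" for j
    unfolding P_def by (rule fam_ext[OF F' that])
  have "A.formality_defect (A.ainf_series m) (fam P) j = (\<lambda>_. 0)" if "j < N" for j
  proof -
    have "A.formality_defect (A.ainf_series m) (fam P) j = A.formality_defect (A.ainf_series m) F j"
      unfolding A.formality_defect_def using that by (simp add: famP)
    then show ?thesis using X[of j] that N by simp
  qed
  then have mor: "ainf_morphism Rh Ah ?cone Ah ?\<mu> \<gamma>"
    unfolding morphism_iff_formality_defect[OF m \<gamma>] lift_bar\<gamma> by blast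
  have \<gamma>0: "emb A (\<gamma> xs 0) = A.unit_map (map (coef 0) (Ah.koszul_twist (map (emb Ah) xs)))" if xs: "xs \<in> words Ah" for xs
  proof -
    let ?us = "map (emb Ah) xs"
    have us: "map (prj Ah) ?us = xs" "?us \<noteq> []"
      using xs by (auto simp: words_def intro!: map_idI)
    have "emb A (\<gamma> xs 0) = coef 0 (emb Ah (\<gamma> xs))"
      by (simp add: coef_def Ah.multimaps_closed[OF \<gamma> xs])
    also have "emb Ah (\<gamma> xs) = Ah.lift_map \<gamma> ?us" using us by (simp add: Ah.lift_map_def del: map_map)
    also have "coef 0 \<dots> = F 0 (map (coef 0) (Ah.koszul_twist ?us))"
      unfolding lift\<gamma> Ah.twist_def P_def
      by (subst cf_ext[OF A.mmap_\<tau>0[OF F']]) (simp add: N_pos conv_0 comp_def)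
    finally show ?thesis by (simp only: F0)
  qed
  have c1: "\<gamma> [x] 0 = x 0" if x: "x \<in> carrier Ah" for x
  proof -
    have w: "[x] \<in> words Ah" using x by (simp add: words_def)
    have "emb A (\<gamma> [x] 0) = emb A (x 0)"
      using \<gamma>0[OF w] x by (simp add: cf_absorb \<tau>_cf) (simp add: coef_def)
    then show ?thesis
      using Ah.multimaps_closed[OF \<gamma> w] x by (subst (asm) M.emb_inj) (simp_all add: hmod_carrier)
  qed
  have c2: "\<gamma> xs 0 = \<zero>\<^bsub>A\<^esub>" if xs: "xs \<in> words Ah" "2 \<le> length xs" for xs
  proof -
    have "emb A (\<gamma> xs 0) = emb A \<zero>\<^bsub>A\<^esub>"
      using \<gamma>0[OF xs(1)] xs(2) by (simp add: A.unit_map_eq_0)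
    then show ?thesis
      using Ah.multimaps_closed[OF \<gamma> xs(1)] by (subst (asm) M.emb_inj) (simp_all add: hmod_carrier)
  qed
  have bij: "bij_betw (\<lambda>x. \<gamma> [x]) (gr Ah d) (gr Ah d)" for d
  proof -
    have emb_bij: "bij_betw (emb Ah) (gr Ah d) (Ah.u_gr d)"
      unfolding bij_betw_def Ah.u_gr_def
      by (auto intro!: inj_onI) (metis Ah.emb_inj Ah.gr_carrier)
    have P\<gamma>: "emb Ah (\<gamma> [x]) = P [emb Ah x]" if x: "x \<in> gr Ah d" for x
    proof -
      have "emb Ah (\<gamma> [x]) = Ah.lift_map \<gamma> [emb Ah x]"
        using Ah.gr_carrier[OF x] by (simp add: Ah.lift_map_def)
      also have "\<dots> = P [emb Ah x]"
        unfolding lift\<gamma> using Ah.mmap_absorb_map[OF P, of "[emb Ah x]"] by (simp add: Ah.twist_def)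
      finally show ?thesis .
    qed
    have "bij_betw (\<lambda>u. P [u]) (Ah.u_gr d) (Ah.u_gr d)"
      by (rule bij_betw_unipotent[OF P]) (simp add: famP N_pos F0)
    from bij_betw_trans[OF emb_bij this] have "bij_betw (emb Ah \<circ> (\<lambda>x. \<gamma> [x])) (gr Ah d) (Ah.u_gr d)"
      by (rule bij_betw_cong[THEN iffD1, rotated]) (simp add: P\<gamma>)
    moreover have "\<gamma> [x] \<in> gr Ah d" if x: "x \<in> gr Ah d" for x
      using Ah.multimaps_gr[OF \<gamma>, of "[x]" "[d]"] x by simp
    ultimately show ?thesis
      using bij_betw_comp_iff2[OF emb_bij, of "\<lambda>x. \<gamma> [x]" "gr Ah d"] by blast
  qed
  have "ainf_quasi_iso Rh Ah ?cone Ah ?\<mu> \<gamma>"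
    unfolding ainf_quasi_iso_def
  proof (intro conjI allI)
    show "ainf_morphism Rh Ah ?cone Ah ?\<mu> \<gamma>" by (rule mor)
    fix d
    show "bij_betw (\<lambda>c. \<Union>z\<in>c. cohomology_class (graded_groups Ah) (\<lambda>_ x. ?\<mu> [x]) d (\<gamma> [z]))
        (carrier (cohomology (graded_groups Ah) (\<lambda>_ x. ?cone [x]) d))
        (carrier (cohomology (graded_groups Ah) (\<lambda>_ x. ?\<mu> [x]) d))"
      by (rule Ah.quasi_iso_zero_differential[OF _ _ bij])
        (simp_all add: cone_op_def hext_arity_part_zero del: hmod_simps)
  qed
  then show "n_formal R A m n"
    unfolding n_formal_def N[symmetric] using c1 c2 by blast
qed

lemma fam_bracket:
  assumes B: "Ah.mmap p B" and g: "Ah.mmap q g" and j: "j < N"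
  shows "fam (Ah.bracket B g) j xs = (\<Sum>a\<le>j. A.bracket (fam B (j - a)) (fam g a) xs)"
proof -
  have "fam (Ah.bracket B g) j xs
      = fam (coder_act id g B) j xs - fam (coder_act Ah.\<sigma> B g) j xs"
    by (simp add: fam_def Ah.bracket_def additive.diff[OF cf_additive])
  also have "fam (coder_act id g B) j xs = (\<Sum>a\<le>j. coder_act id (fam g a) (fam B (j - a)) xs)"
    by (rule fam_coder_act[where \<theta>' = id and \<theta> = id and P = B, OF Ah.mmap_slot_linear[OF B] Ah.mmap_\<tau>0[OF B] j]) simp
  also have "fam (coder_act Ah.\<sigma> B g) j xs = (\<Sum>a\<le>j. coder_act A.\<sigma> (fam B a) (fam g (j - a)) xs)"
    by (rule fam_coder_act[where \<theta>' = Ah.\<sigma> and \<theta> = A.\<sigma> and P = g, OF Ah.mmap_slot_linear[OF g] Ah.mmap_\<tau>0[OF g] j const_\<sigma>])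
  also have "\<dots> = (\<Sum>a\<le>j. coder_act A.\<sigma> (fam B (j - a)) (fam g a) xs)"
    by (rule sum.reindex_bij_witness[of _ "\<lambda>a. j - a" "\<lambda>a. j - a"]) auto
  finally show ?thesis by (simp only: A.bracket_def sum_subtractf)
qed

text \<open>
  The equation $\partial_h m = [m, g]$ is multilinear over $R[h]/h^N$ on both sides, and every series of
  cochains over \<open>R\<close> is the series of coefficients of a cochain over $R[h]/h^N$.
\<close>

lemma kaledin_class_iff_series:
  assumes m: "multimaps R A A (\<lambda>i. 2 - int i) m"
  shows "kaledin_class R A m N = \<one>\<^bsub>HH Rh Ah (cone_op R A N m) 2\<^esub> \<longleftrightarrow>
    (\<exists>g. (\<forall>a. A.cochain 0 (g a)) \<and> (\<forall>j<N. A.kaledin_defect (A.ainf_series m) g j = (\<lambda>_. 0)))"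
proof -
  let ?B = "Ah.lift_map (bar Ah (cone_op R A N m))" and ?z = "kaledin_cocycle R A m N"
  let ?k = "\<lambda>j ys. nat_times (Suc j) (A.ainf_series m (Suc j) ys)"
  have B: "Ah.cochain 1 ?B"
    using Ah.mmap_lift_map[OF Ah.multimaps_bar[OF multimaps_cone_op[OF m]]] by simp
  have k: "A.cochain 1 (?k j)" for j
    by (rule A.mmap_nat_times[OF A.cochain_ainf_series[OF m]])
  have z: "Ah.lift_map ?z = ext ?k" by (rule lift_map_kaledin_cocycle(1)[OF m])
  have zm: "Ah.cochain 1 (Ah.lift_map ?z)" unfolding z by (rule mmap_ext[OF k])
  have famz: "fam (Ah.lift_map ?z) j = ?k j" if "j < N" for j unfolding z by (rule fam_ext[OF k that])
  have defect: "Ah.lift_map ?z = Ah.bracket ?B g \<longleftrightarrow>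
      (\<forall>j<N. A.kaledin_defect (A.ainf_series m) (fam g) j = (\<lambda>_. 0))" if g: "Ah.cochain 0 g" for g
  proof -
    note bm = Ah.cochain_bracket[OF B g]
    have fam_eq: "fam (Ah.lift_map ?z) j = fam (Ah.bracket ?B g) j \<longleftrightarrow>
        A.kaledin_defect (A.ainf_series m) (fam g) j = (\<lambda>_. 0)" if j: "j < N" for j
    proof -
      have "fam (Ah.bracket ?B g) j xs = (\<Sum>a\<le>j. A.bracket (A.ainf_series m (j - a)) (fam g a) xs)" for xs
        unfolding fam_bracket[OF B g j] using j by (simp add: fam_cone_op[OF m])
      then show ?thesis
        by (simp add: famz[OF j] A.kaledin_defect_def fun_eq_iff del: nat_times.simps)
    qed
    have "Ah.lift_map ?z = Ah.bracket ?B g" if "\<And>j. j < N \<Longrightarrow> fam (Ah.lift_map ?z) j = fam (Ah.bracket ?B g) j"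
      by (rule fam_unique[OF Ah.mmap_slot_linear[OF zm] Ah.mmap_\<tau>0[OF zm] Ah.mmap_slot_linear[OF bm]
          Ah.mmap_\<tau>0[OF bm] that])
    then show ?thesis using fam_eq by auto
  qed
  have "kaledin_class R A m N = \<one>\<^bsub>HH Rh Ah (cone_op R A N m) 2\<^esub> \<longleftrightarrow>
      (\<exists>g. Ah.cochain 0 g \<and> Ah.lift_map ?z = Ah.bracket ?B g)"
    unfolding kaledin_class_def
    by (rule Ah.HH_class_eq_one_iff[OF multimaps_cone_op[OF m]])
      (simp add: kaledin_cocycle_def, rule lift_map_kaledin_cocycle(2)[OF m])
  also have "\<dots> \<longleftrightarrow> (\<exists>g. (\<forall>a. A.cochain 0 (g a)) \<and> (\<forall>j<N. A.kaledin_defect (A.ainf_series m) g j = (\<lambda>_. 0)))"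
  proof (intro iffI; elim exE conjE)
    fix g assume g: "Ah.cochain 0 g" "Ah.lift_map ?z = Ah.bracket ?B g"
    then show "\<exists>g. (\<forall>a. A.cochain 0 (g a)) \<and> (\<forall>j<N. A.kaledin_defect (A.ainf_series m) g j = (\<lambda>_. 0))"
      using mmap_fam[OF g(1)] defect[OF g(1)] by blast
  next
    fix g assume g: "\<forall>a. A.cochain 0 (g a)" "\<forall>j<N. A.kaledin_defect (A.ainf_series m) g j = (\<lambda>_. 0)"
    have g': "A.cochain 0 (g a)" for a using g(1) by blast
    have "A.kaledin_defect (A.ainf_series m) (fam (ext g)) j = (\<lambda>_. 0)" if "j < N" for j
    proof -
      have "A.kaledin_defect (A.ainf_series m) (fam (ext g)) j = A.kaledin_defect (A.ainf_series m) g j"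
        unfolding A.kaledin_defect_def using that by (simp add: fam_ext[OF g'] del: nat_times.simps)
      then show ?thesis using g(2) that by simp
    qed
    moreover have c: "Ah.cochain 0 (ext g)" by (rule mmap_ext[OF g'])
    ultimately have "Ah.lift_map ?z = Ah.bracket ?B (ext g)" using defect[OF c] by blast
    with c show "\<exists>g. Ah.cochain 0 g \<and> Ah.lift_map ?z = Ah.bracket ?B g" by blast
  qed
  finally show ?thesis .
qed

end

section \<open>Kaledin's criterion\<close>

lemma algebra_nat_inverse:
  assumes k: "field k" and char0: "\<forall>j::nat. 0 < j \<longrightarrow> add_pow k j \<one>\<^bsub>k\<^esub> \<noteq> \<zero>\<^bsub>k\<^esub>" and R: "algebra k R" and j: "0 < (j::nat)"
  shows "\<exists>c\<in>carrier R. add_pow R j c = \<one>\<^bsub>R\<^esub>"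
proof -
  interpret k: field k by (rule k)
  interpret algebra k R by (rule R)
  let ?a = "add_pow k j \<one>\<^bsub>k\<^esub>"
  have a: "?a \<in> carrier k" "?a \<noteq> \<zero>\<^bsub>k\<^esub>" using char0 j by (simp_all add: k.add.nat_pow_closed)
  then have u: "?a \<in> Units k" by (simp add: k.field_Units)
  let ?b = "inv\<^bsub>k\<^esub> ?a"
  have b: "?b \<in> carrier k" using u by (rule k.Units_inv_closed)
  have "add_pow R i (?b \<odot>\<^bsub>R\<^esub> \<one>\<^bsub>R\<^esub>) = (add_pow k i \<one>\<^bsub>k\<^esub> \<otimes>\<^bsub>k\<^esub> ?b) \<odot>\<^bsub>R\<^esub> \<one>\<^bsub>R\<^esub>" for i :: nat
  proof (induction i)
    case 0
    have "\<zero>\<^bsub>k\<^esub> \<odot>\<^bsub>R\<^esub> \<one>\<^bsub>R\<^esub> = \<zero>\<^bsub>R\<^esub>" by (rule smult_l_null) simp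
    then show ?case using b by simp
  next
    case (Suc i)
    then show ?case
      using b by (simp add: k.add.nat_pow_closed k.l_distr smult_l_distr k.add.nat_pow_Suc M.add.nat_pow_Suc)
  qed
  from this[of j] have "add_pow R j (?b \<odot>\<^bsub>R\<^esub> \<one>\<^bsub>R\<^esub>) = \<one>\<^bsub>k\<^esub> \<odot>\<^bsub>R\<^esub> \<one>\<^bsub>R\<^esub>"
    using k.Units_r_inv[OF u] by simp
  then show ?thesis using b by (intro bexI[of _ "?b \<odot>\<^bsub>R\<^esub> \<one>\<^bsub>R\<^esub>"]) simp_all
qed

text \<open>
  Scalars commute with each other, so the multiplication with an inverse of \<open>j + 1\<close> is again an
  operator that may be composed with multilinear maps.
\<close>

lemma (in truncated_module) nat_divisible:
  assumes div: "\<And>j::nat. 0 < j \<Longrightarrow> \<exists>c\<in>carrier R. add_pow R j c = \<one>\<^bsub>R\<^esub>"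
  shows "\<exists>\<rho>\<in>(A.u_smult ` carrier R) \<inter> A.K. \<forall>x. nat_times (Suc j) (\<rho> x) = A.u_koszul 0 x"
proof -
  obtain c where c: "c \<in> carrier R" "add_pow R (Suc j) c = \<one>\<^bsub>R\<^esub>" using div[of "Suc j"] by blast
  have "A.u_smult c (A.u_smult a x) = A.u_smult a (A.u_smult c x)" if a: "a \<in> carrier R" for a x
    using smult_assoc1[OF a c(1), of "prj A x"] smult_assoc1[OF c(1) a, of "prj A x"] R.m_comm[OF a c(1)]
    by (simp add: A.u_smult_def c(1) a)
  then have "A.u_smult c \<in> A.K"
    using c(1) by (auto simp: A.K_def A.additive_u_smult A.S_absorb)
  moreover have "nat_times (Suc j) (A.u_smult c x) = A.u_koszul 0 x" for x
  proof -
    have "nat_times i (emb A (c \<odot>\<^bsub>A\<^esub> prj A x)) = emb A (add_pow R i c \<odot>\<^bsub>A\<^esub> prj A x)" for i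
    proof (induction i)
      case 0
      then show ?case using u_smult_zero[of x] by (simp add: A.u_smult_def)
    next
      case (Suc i)
      have "add_pow R (Suc i) c \<odot>\<^bsub>A\<^esub> prj A x = add_pow R i c \<odot>\<^bsub>A\<^esub> prj A x \<oplus>\<^bsub>A\<^esub> c \<odot>\<^bsub>A\<^esub> prj A x"
        using c(1) by (simp add: R.add.nat_pow_Suc smult_l_distr)
      then show ?case using Suc c(1) by (simp add: M.emb_add add.commute)
    qed
    then show ?thesis
      unfolding A.u_smult_def c(2) by (simp only: c(2)) (simp add: A.u_koszul_0)
  qed
  ultimately show ?thesis using c(1) by blast
qed

theorem corollary5p7:
  fixes k :: "('k, 'x) ring_scheme"
    and R :: "('k, 'r, 'y) module_scheme"
    and A :: "('r, 'a, 'z) gmodule_scheme"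
    and m :: "'a list \<Rightarrow> 'a"
    and n :: nat
  assumes k_field: "field k"
    and k_char_0: "\<forall>j::nat. 0 < j \<longrightarrow> add_pow k j \<one>\<^bsub>k\<^esub> \<noteq> \<zero>\<^bsub>k\<^esub>"
    and R_algebra: "algebra k R"
    and A_ainf: "ainf_algebra R A m"
    and A_minimal: "minimal_ainf A m"
    and A_flat: "flat_ainf R A"
    and n_pos: "1 \<le> n"
  shows "(n_formal R A m n \<longleftrightarrow>
            kaledin_class R A m n = \<one>\<^bsub>HH (hring R n) (hmod R A n) (cone_op R A n m) 2\<^esub>)
         \<and> ((\<forall>i\<in>{3..n + 1}. \<forall>xs\<in>words A. length xs = i \<longrightarrow> m xs = \<zero>\<^bsub>A\<^esub>) \<longrightarrow>
            (n_formal R A m n \<longleftrightarrow>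
               HH_class R A (arity_part A 2 m) 2 (bar A (arity_part A (n + 2) m)) =
                 \<one>\<^bsub>HH R A (arity_part A 2 m) 2\<^esub>))"
proof -
  have A: "graded_module R A" and m: "multimaps R A A (\<lambda>i. 2 - int i) m"
    using A_ainf by (simp_all add: ainf_algebra_def)
  \<comment> \<open>The Kaledin class lives over $R[h]/h^n$, formality over $R[h]/h^{n+1}$; both are compared over \<open>R\<close>.\<close>
  interpret T: truncated_module R A n
    by (intro truncated_module.intro truncated_module_axioms.intro A) (use n_pos in simp)
  interpret T1: truncated_module R A "n + 1"
    by (intro truncated_module.intro truncated_module_axioms.intro A) simp
  have div: "\<exists>\<rho>\<in>(T.A.u_smult ` carrier R) \<inter> T.A.K. \<forall>x. nat_times (Suc j) (\<rho> x) = T.A.u_koszul 0 x" for j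
    by (rule T.nat_divisible) (rule algebra_nat_inverse[OF k_field k_char_0 R_algebra])
  have div': "\<exists>\<rho>\<in>T.A.K. (\<forall>n. \<forall>x\<in>T.A.u_gr n. \<rho> x \<in> T.A.u_gr n) \<and> (\<forall>x. nat_times (Suc j) (\<rho> x) = T.A.u_koszul 0 x)" for j
  proof -
    obtain \<rho> where \<rho>: "\<rho> \<in> T.A.u_smult ` carrier R" "\<rho> \<in> T.A.K" "\<And>x. nat_times (Suc j) (\<rho> x) = T.A.u_koszul 0 x"
      using div[of j] by blast
    then show ?thesis using T.A.S_G[OF \<rho>(1)] by blast
  qed
  let ?M = "T.A.ainf_series m"
  let ?Y = "\<exists>g. (\<forall>a. T.A.cochain 0 (g a)) \<and> (\<forall>j<n. T.A.kaledin_defect ?M g j = (\<lambda>_. 0))"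
  have M: "T.A.cochain 1 (?M a)" for a by (rule T.A.cochain_ainf_series[OF m])
  have quad: "?M 0 xs = 0" if "length xs \<noteq> 2" for xs using that by (simp add: T.A.ainf_series_twist)
  have formal: "n_formal R A m n \<longleftrightarrow> ?Y"
    unfolding T1.n_formal_iff_series[OF m refl] by (rule T.A.formality_iff_kaledin[where M = ?M, OF M quad div'])
  have b: "n_formal R A m n \<longleftrightarrow>
      HH_class R A (arity_part A 2 m) 2 (bar A (arity_part A (n + 2) m)) = \<one>\<^bsub>HH R A (arity_part A 2 m) 2\<^esub>"
    if vanish: "\<forall>i\<in>{3..n + 1}. \<forall>xs\<in>words A. length xs = i \<longrightarrow> m xs = \<zero>\<^bsub>A\<^esub>"
  proof -
    have gap: "?M a = (\<lambda>_. 0)" if a: "1 \<le> a" "a < n" for a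
    proof
      show "?M a us = 0" for us
      proof (cases "length us = a + 2")
        case True
        then have "map (prj A) (T.A.koszul_twist us) \<in> words A" by (intro T.A.prj_words) auto
        then have "m (map (prj A) (T.A.koszul_twist us)) = \<zero>\<^bsub>A\<^esub>"
          using vanish a True by auto
        then show ?thesis
          by (simp add: T.A.ainf_series_twist T.A.twist_def T.A.lift_map_def)
      qed (simp add: T.A.ainf_series_twist)
    qed
    have "HH_class R A (arity_part A 2 m) 2 (bar A (arity_part A (n + 2) m)) = \<one>\<^bsub>HH R A (arity_part A 2 m) 2\<^esub>
        \<longleftrightarrow> (\<exists>d. T.A.cochain 0 d \<and> T.A.lift_map (bar A (arity_part A (n + 2) m))
              = T.A.bracket (T.A.lift_map (bar A (arity_part A 2 m))) d)"
      by (rule T.A.HH_class_eq_one_iff[OF T.A.multimaps_arity_part[OF m] T.A.bar_extensional])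
        (rule T.A.multimaps_closed[OF T.A.multimaps_bar[OF T.A.multimaps_arity_part[OF m]]])
    also have "\<dots> \<longleftrightarrow> (\<exists>d. T.A.cochain 0 d \<and> ?M n = T.A.bracket (?M 0) d)"
      by (simp add: T.A.ainf_series_def numeral_2_eq_2)
    also have "\<dots> \<longleftrightarrow> ?Y"
      by (rule T.A.kaledin_single_term[where M = ?M, OF M gap n_pos div, symmetric])
    finally show ?thesis using formal by simp
  qed
  show ?thesis
    using formal T.kaledin_class_iff_series[OF m] b by simp
qed

end
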